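(* Let $k\ge 2$ be a natural number, let $\alpha_k$ and $\alpha_j$ $(0\le j\le k-2)$ be real numbers, and let $$\varphi(x,y)=c_kx^k+c_{k-1}x^{k-1}y+\cdots+c_1xy^{k-1}+c_0y^k$$ with $c_j\in\mathbb{Z}$ $(0\le j\le k)$. Put $\sigma=\frac{k}{k-1}2^{1-k}$. Then for every $\epsilon>0$ there exists a real number $X(\epsilon,c_k,c_{k-1})$ such that whenever $X\ge X(\epsilon,c_k,c_{k-1})$ one has $$\min_{\substack{0\le |x|,|y|\le X\\ (x,y)\ne(0,0)}}\left\|\alpha_k\varphi(x,y)+\alpha_{k-2}x^{k-2}y^2+\alpha_{k-3}x^{k-3}y^3+\cdots+\alpha_0y^k\right\|<X^{-\sigma+\epsilon},$$ where the minimum is over integers $x,y$.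
   Context: $\|\theta\|$ denotes the distance from the real number $\theta$ to the nearest integer. The threshold $X(\epsilon,c_k,c_{k-1})$ may depend on the fixed degree $k$, on $\epsilon$, and on the two integers $c_k,c_{k-1}$, but not on the real numbers $\alpha_j$ or the other coefficients of $\varphi$. *)

theory Defs
  imports Complex_Main
begin

definition dist_nearest_int :: "real \<Rightarrow> real" where
  "dist_nearest_int \<theta> = \<bar>\<theta> - of_int (round \<theta>)\<bar>"

definition binary_form :: "nat \<Rightarrow> (nat \<Rightarrow> int) \<Rightarrow> int \<Rightarrow> int \<Rightarrow> int" where
  "binary_form k c x y = (\<Sum>j\<le>k. c j * x ^ j * y ^ (k - j))"

text \<open>The coefficient sequence \<open>\<alpha>\<close> is used only at the indices \<open>k\<close> and \<open>0, \<dots>, k - 2\<close>;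
  the value at \<open>k - 1\<close> does not occur.\<close>

definition perturbed_form ::
    "nat \<Rightarrow> (nat \<Rightarrow> int) \<Rightarrow> (nat \<Rightarrow> real) \<Rightarrow> int \<Rightarrow> int \<Rightarrow> real" where
  "perturbed_form k c \<alpha> x y =
     \<alpha> k * of_int (binary_form k c x y)
       + (\<Sum>j\<le>k - 2. \<alpha> j * of_int x ^ j * of_int y ^ (k - j))"

definition sigma_exponent :: "nat \<Rightarrow> real" where
  "sigma_exponent k = real k / (real k - 1) * 2 powr (1 - real k)"

definition box_points :: "real \<Rightarrow> (int \<times> int) set" where
  "box_points X = {(x, y). \<bar>of_int x\<bar> \<le> X \<and> \<bar>of_int y\<bar> \<le> X \<and> (x, y) \<noteq> (0, 0)}"

end

theory Submission
  imports Defs "HOL-Analysis.Analysis" "HOL-Computational_Algebra.Computational_Algebra"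
    "HOL-Real_Asymp.Real_Asymp"
begin

text \<open>
  After a linear substitution the form is \<open>\<alpha> x\<^sup>k + \<Sum>\<^sub>i \<beta>\<^sub>i x\<^sup>i y\<^sup>k\<^sup>-\<^sup>i\<close> with \<open>i \<le> k - 2\<close> and all
  coefficients arbitrary reals. Suppose that it stays at distance \<open>1/H\<close> from the integers, where
  \<open>H\<close> is slightly smaller than \<open>X\<^sup>\<sigma>\<close>, so \<open>H\<close> to the power \<open>2\<^sup>k\<^sup>-\<^sup>1\<close> is almost \<open>X\<close> times \<open>W\<close> with
  \<open>W = X\<^bsup>1/(k-1)\<^esup>\<close>. If \<open>j\<close> is the largest remaining index, then \<open>j\<close> differencing steps in \<open>x\<close>
  split the exponential sum into a product of a sum over \<open>x\<close>, involving only \<open>\<alpha>\<close>, and a sum over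
  \<open>y\<close>, involving only \<open>\<beta>\<^sub>j\<close>. The points \<open>(x, 0)\<close> show that \<open>\<alpha>\<close> has no good approximation with
  denominator at most \<open>X\<close>, so the sum over \<open>x\<close> saves as much as Weyl's inequality can give and only
  a factor corresponding to \<open>W\<close> is left for the sum over \<open>y\<close>. Hence \<open>\<beta>\<^sub>j\<close> has a good rational
  approximation with denominator \<open>r \<le> W\<close>. Replacing \<open>y\<close> by \<open>r y\<close> and shortening its range by the
  factor \<open>W\<close> removes the term in \<open>\<beta>\<^sub>j\<close>. There are \<open>k - 1\<close> coefficients to remove and
  \<open>W\<^sup>k\<^sup>-\<^sup>1 = X\<close>, so this can be repeated until a point \<open>(0, y)\<close> with \<open>1 \<le> y \<le> X\<close> contradicts the
  assumption.
\<close>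

section \<open>Distance to the nearest integer and exponential sums\<close>

text \<open>The largest remaining index has to go first: \<open>j\<close> differences in
  \<open>x\<close> annihilate the terms of index below \<open>j\<close>, so the other coefficients
  may be arbitrary, and it does no harm that each substitution in \<open>y\<close> rescales them.
  The range of \<open>x\<close> is never shortened, because the saving in the sum over
  \<open>x\<close> rests on its full length \<open>X\<close>.

  Index \<open>k - 1\<close> would break the scheme twice. There would be \<open>k\<close>
  coefficients to remove, more than \<open>X\<close> leaves room for, and the Cauchy-Schwarz step
  that separates the two sums needs at least one difference left in each variable
  (\<open>l \<ge> 2\<close>). Hence the preliminary substitution, which works because the top two
  coefficients are integer multiples of the same real \<open>\<alpha> k\<close>. It is also the
  source of the dependence of the threshold on these two integers.

  The number \<open>M\<close> of frequencies enters the final inequality to the power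
  \<open>2 ^ (k - 1)\<close>, so it may exceed \<open>H\<close> only by a tiny power of
  \<open>X\<close>. On the other hand each removal perturbs the values by up to
  \<open>1 / M\<close>; as \<open>M \<ge> 2 ^ k * H\<close>, the distance to the integers is at
  worst halved at every stage.\<close>

abbreviation nint :: "real \<Rightarrow> real" where "nint \<equiv> dist_nearest_int"

lemma nint_nonneg: "0 \<le> nint t"
  by (simp add: dist_nearest_int_def)

lemma nint_le: "nint t \<le> \<bar>t - of_int n\<bar>"
  using round_diff_minimal[of t n] by (simp add: dist_nearest_int_def)

lemma nint_le_half: "nint t \<le> 1/2"
  using of_int_round_abs_le[of t] by (simp add: dist_nearest_int_def abs_minus_commute)

lemma nintE:
  obtains n :: int where "nint t = \<bar>t - of_int n\<bar>"
  by (auto simp: dist_nearest_int_def)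

lemma nint_add_int [simp]: "nint (t + of_int n) = nint t"
proof (rule antisym)
  obtain a where "nint t = \<bar>t - of_int a\<bar>" by (rule nintE)
  then show "nint (t + of_int n) \<le> nint t" using nint_le[of "t + of_int n" "a + n"] by simp
  obtain b where "nint (t + of_int n) = \<bar>t + of_int n - of_int b\<bar>" by (rule nintE)
  then show "nint t \<le> nint (t + of_int n)" using nint_le[of t "b - n"] by simp
qed

lemma nint_minus [simp]: "nint (- t) = nint t"
proof (rule antisym)
  obtain a where "nint t = \<bar>t - of_int a\<bar>" by (rule nintE)
  then show "nint (- t) \<le> nint t" using nint_le[of "- t" "- a"] by simp
  obtain b where "nint (- t) = \<bar>- t - of_int b\<bar>" by (rule nintE)
  then show "nint t \<le> nint (- t)" using nint_le[of t "- b"] by simp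
qed

lemma nint_add_le: "nint (s + t) \<le> nint s + nint t"
proof -
  obtain a where a: "nint s = \<bar>s - of_int a\<bar>" by (rule nintE)
  obtain b where b: "nint t = \<bar>t - of_int b\<bar>" by (rule nintE)
  show ?thesis using nint_le[of "s + t" "a + b"] a b by simp
qed

lemma nint_of_int_mult_le: "nint (of_int n * t) \<le> \<bar>of_int n\<bar> * nint t"
proof -
  obtain a where a: "nint t = \<bar>t - of_int a\<bar>" by (rule nintE)
  have "nint (of_int n * t) \<le> \<bar>of_int n * t - of_int (n * a)\<bar>" by (rule nint_le)
  also have "\<dots> = \<bar>of_int n\<bar> * nint t" by (simp add: a abs_mult flip: right_diff_distrib)
  finally show ?thesis .
qed

lemma nint_of_nat_mult_le: "nint (of_nat n * t) \<le> of_nat n * nint t"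
  using nint_of_int_mult_le[of "int n" t] by simp

definition ee :: "real \<Rightarrow> complex" where "ee t = cis (2 * pi * t)"

lemma norm_ee [simp]: "norm (ee t) = 1" by (simp add: ee_def)

lemma ee_zero [simp]: "ee 0 = 1" by (simp add: ee_def)

lemma ee_add: "ee (s + t) = ee s * ee t" by (simp add: ee_def cis_mult algebra_simps)

lemma cnj_ee: "cnj (ee t) = ee (- t)" by (simp add: ee_def cis_cnj)

lemma ee_of_int [simp]: "ee (of_int n) = 1"
  unfolding ee_def by (rule cis_multiple_2pi) simp

lemma ee_power: "ee t ^ n = ee (of_nat n * t)"
proof -
  have "real n * (2 * pi * t) = 2 * pi * (of_nat n * t)" by simp
  then show ?thesis by (simp only: ee_def Complex.DeMoivre)
qed

lemma sin_ge_linear: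
  assumes "0 \<le> t" "t \<le> 1/2"
  shows "sin (pi * t) \<ge> 2 * t"
proof -
  have "concave_on {0..pi} sin"
    by (rule f''_le0_imp_concave[where f' = cos and f'' = "\<lambda>x. - sin x"])
       (auto intro!: derivative_eq_intros sin_ge_zero)
  from concave_onD[OF this, of "2 * t" 0 "pi / 2"]
  have "sin ((1 - 2*t) *\<^sub>R 0 + (2*t) *\<^sub>R (pi/2)) \<ge> (1 - 2*t) * sin 0 + (2*t) * sin (pi/2)"
    using assms by simp
  then show ?thesis by (simp add: mult.commute)
qed

text \<open>The left side is even and has period 1 in \<open>t\<close>, so \<open>t\<close> may be
  replaced by its distance \<open>s\<close> to the nearest integer. Then it equals
  \<open>2 * sin (pi * s)\<close>, and concavity of the sine supplies the factor 4.\<close>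

lemma norm_one_minus_ee_ge: "norm (1 - ee t) \<ge> 4 * nint t"
proof -
  obtain n where n: "nint t = \<bar>t - of_int n\<bar>" by (rule nintE)
  define s where "s = \<bar>t - of_int n\<bar>"
  have s: "0 \<le> s" "s \<le> 1/2" using nint_le_half[of t] n by (auto simp: s_def)
  have "ee t = ee (t - of_int n)" using ee_add[of "t - of_int n" "of_int n"] by simp
  then have "norm (1 - ee t) = norm (1 - ee s)"
    by (cases "t - of_int n \<ge> 0")
       (simp_all add: s_def, metis complex_cnj_diff complex_cnj_one complex_mod_cnj cnj_ee minus_diff_eq)
  also have "norm (1 - ee s) ^ 2 = (2 * sin (pi * s)) ^ 2"
  proof -
    have "cos (2 * (pi * s)) = 1 - 2 * (sin (pi * s))^2" by (rule cos_double_sin)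
    moreover have "norm (1 - ee s) ^ 2 = 2 - 2 * cos (2 * (pi * s))"
      using sin_cos_squared_add[of "2 * pi * s"]
      unfolding ee_def cmod_power2 by (simp add: power2_diff mult_ac)
    ultimately show ?thesis by (simp add: power_mult_distrib)
  qed
  then have "norm (1 - ee s) = 2 * sin (pi * s)"
    using sin_ge_linear[OF s] s by (subst (asm) power2_eq_iff_nonneg) auto
  finally show ?thesis using sin_ge_linear[OF s] n s_def by simp
qed

lemma norm_geometric_ee_le:
  assumes "nint t > 0"
  shows "norm (\<Sum>i<n. ee (of_nat i * t)) \<le> 1 / (2 * nint t)"
proof -
  have "(1 - ee t) * (\<Sum>i<n. ee (of_nat i * t)) = 1 - ee t ^ n"
    by (simp add: one_diff_power_eq flip: ee_power)
  then have "norm (1 - ee t) * norm (\<Sum>i<n. ee (of_nat i * t)) = norm (1 - ee t ^ n)"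
    by (metis norm_mult)
  also have "\<dots> \<le> 2" using norm_triangle_ineq4[of 1 "ee t ^ n"] by (simp add: norm_power)
  finally have "4 * nint t * norm (\<Sum>i<n. ee (of_nat i * t)) \<le> 2"
    using mult_right_mono[OF norm_one_minus_ee_ge[of t] norm_ge_zero[of "\<Sum>i<n. ee (of_nat i * t)"]]
    by linarith
  then show ?thesis using assms by (simp add: field_simps)
qed

lemma bij_betw_int_interval:
  assumes "a \<le> b + 1"
  shows "bij_betw (\<lambda>i. a + int i) {..<nat (b + 1 - a)} {a..b}"
  using assms by (intro bij_betw_byWitness[where f' = "\<lambda>x. nat (x - a)"]) auto

text \<open>This is \<open>min Y (1/\<parallel>t\<parallel>)\<close>, arranged so that integral \<open>t\<close> gives \<open>Y\<close> and not \<open>1 / 0 = 0\<close>.\<close>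

definition minsum_term :: "real \<Rightarrow> real \<Rightarrow> real" where
  "minsum_term Y t = 1 / max (1 / Y) (nint t)"

text \<open>The subinterval is arbitrary because differencing cuts the range in a way that depends
  on the shifts. Only the full length \<open>Y\<close> is kept in the bound; the constant term
  \<open>c\<close> merely rotates the sum.\<close>

lemma norm_linear_sum_le:
  assumes "{a..b} \<subseteq> {1..int Y}" "Y > 0"
  shows "norm (\<Sum>x\<in>{a..b}. ee (of_int x * t + c)) \<le> minsum_term (real Y) t"
proof (cases "a \<le> b")
  case False
  then show ?thesis using assms by (simp add: minsum_term_def le_max_iff_disj)
next
  case True
  have "(\<Sum>x\<in>{a..b}. ee (of_int x * t + c)) = (\<Sum>i<nat (b + 1 - a). ee (of_int (a + int i) * t + c))"
    using True by (intro sum.reindex_bij_betw[OF bij_betw_int_interval, symmetric]) auto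
  also have "\<dots> = ee (of_int a * t + c) * (\<Sum>i<nat (b + 1 - a). ee (of_nat i * t))"
    by (simp add: sum_distrib_left algebra_simps flip: ee_add)
  finally have eq: "norm (\<Sum>x\<in>{a..b}. ee (of_int x * t + c)) = norm (\<Sum>i<nat (b + 1 - a). ee (of_nat i * t))"
    by (simp add: norm_mult)
  have len: "nat (b + 1 - a) \<le> Y" using True assms by auto
  have "norm (\<Sum>i<nat (b + 1 - a). ee (of_nat i * t)) \<le> real (nat (b + 1 - a))"
    by (rule order_trans[OF norm_sum]) simp
  then have 1: "norm (\<Sum>i<nat (b + 1 - a). ee (of_nat i * t)) \<le> real Y" using len by linarith
  show ?thesis
  proof (cases "nint t \<le> 1 / Y")
    case True
    then show ?thesis using eq 1 by (simp add: minsum_term_def max_def)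
  next
    case False
    moreover have "1 / real Y \<ge> 0" by simp
    ultimately have "nint t > 0" by linarith
    then have "norm (\<Sum>i<nat (b + 1 - a). ee (of_nat i * t)) \<le> 1 / (2 * nint t)"
      by (rule norm_geometric_ee_le)
    also have "\<dots> \<le> 1 / nint t" using \<open>nint t > 0\<close> by (simp add: field_simps)
    finally show ?thesis using eq False by (simp add: minsum_term_def max_def)
  qed
qed

text \<open>Iterated Cauchy-Schwarz, that is, the power mean inequality for exponents
  \<open>2 ^ n\<close>. Each differencing step squares a sum, so no other exponents arise.\<close>

lemma sum_pow_two_power_le:
  fixes f :: "'a \<Rightarrow> real"
  assumes "\<And>i. i \<in> A \<Longrightarrow> f i \<ge> 0"
  shows "(\<Sum>i\<in>A. f i) ^ (2^n) \<le> real (card A) ^ (2^n - 1) * (\<Sum>i\<in>A. f i ^ (2^n))"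
proof (induction n)
  case (Suc n)
  have "(\<Sum>i\<in>A. f i) ^ (2 ^ Suc n) = ((\<Sum>i\<in>A. f i) ^ (2 ^ n))^2"
    by (simp add: power_mult[symmetric] mult.commute)
  also have "\<dots> \<le> (real (card A) ^ (2^n - 1) * (\<Sum>i\<in>A. f i ^ (2^n)))^2"
    by (intro power_mono Suc.IH zero_le_power sum_nonneg assms)
  also have "\<dots> = (real (card A) ^ (2^n - 1))^2 * (\<Sum>i\<in>A. f i ^ (2^n))^2"
    by (simp add: power_mult_distrib)
  also have "\<dots> \<le> (real (card A) ^ (2^n - 1))^2 * ((\<Sum>i\<in>A. (f i ^ (2^n))^2) * card A)"
    by (intro mult_left_mono sum_squared_le_sum_of_squares) auto
  also have "\<dots> = real (card A) ^ Suc (2 * (2^n - 1)) * (\<Sum>i\<in>A. f i ^ (2^Suc n))"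
    by (simp add: power_mult[symmetric] mult.commute power_add mult_2_right mult_2 algebra_simps)
  also have "Suc (2 * (2^n - 1)) = (2::nat)^Suc n - 1"
    using one_le_power[of "2::nat" n] unfolding power_Suc by linarith
  finally show ?case .
qed simp

section \<open>Trigonometric polynomials avoiding the integers\<close>

text \<open>
  If no \<open>\<theta> i\<close> is near an integer, then \<open>1 + ee (\<theta> i) + \<dots> + ee ((L - 1) \<theta> i)\<close> is small against \<open>L\<close>. Its
  \<open>p\<close>-th power keeps the number of frequencies at most \<open>p L\<close> while the diagonal terms of the
  square dominate unless one of the off-diagonal sums is large.
\<close>

lemma sum_norm_ee_ge_of_avoiding:
  fixes \<theta> :: "'a \<Rightarrow> real" and L p :: nat
  assumes fin: "finite P" and avoid: "\<And>i. i \<in> P \<Longrightarrow> nint (\<theta> i) \<ge> \<eta>"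
    and \<eta>: "\<eta> > 0" and L: "L > 0" and p: "p > 0"
    and large: "(2 * \<eta> * L) ^ (2 * p) > 2 * real (p * L)"
  shows "(\<Sum>m=1..p*L. norm (\<Sum>i\<in>P. ee (of_nat m * \<theta> i))) \<ge> real (card P) / 4"
proof (cases "P = {}")
  case True
  then show ?thesis by simp
next
  case False
  define N where "N = p * L"
  have N: "N > 0" using L p by (simp add: N_def)
  \<comment> \<open>The coefficient \<open>r v\<close> counts the representations of
    \<open>v\<close> as a sum of \<open>p\<close> integers below \<open>L\<close>. At
    \<open>ee (\<theta> i)\<close> the modulus is at most \<open>(1 / (2 * \<eta>)) ^ p\<close>,
    while the value at 1 is \<open>L ^ p\<close>; the hypothesis \<open>large\<close> says that the
    squared ratio beats the number \<open>p * L\<close> of frequencies.\<close>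
  define Q :: "complex poly" where "Q = (\<Sum>n<L. monom 1 n) ^ p"
  define r where "r v = coeff Q v" for v
  define D where "D v v' = norm (\<Sum>i\<in>P. ee ((of_nat v - of_nat v') * \<theta> i))" for v v' :: nat
  define T where "T = (\<Sum>m=1..N. norm (\<Sum>i\<in>P. ee (of_nat m * \<theta> i)))"
  define R where "R = (\<Sum>v<N. (norm (r v))\<^sup>2)"
  have degQ: "degree Q < N"
  proof -
    have "degree (\<Sum>n<L. monom (1::complex) n) \<le> L - 1"
      by (rule degree_sum_le) (auto intro: order_trans[OF degree_monom_le])
    then have "degree Q \<le> (L - 1) * p"
      unfolding Q_def by (meson degree_power_le le_trans mult_le_mono1)
    also have "\<dots> < N" using L p by (simp add: N_def mult.commute)
    finally show ?thesis .
  qed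
  have polyQ: "poly Q z = (\<Sum>v<N. r v * z ^ v)" for z
  proof -
    have "poly Q z = (\<Sum>v\<le>degree Q. r v * z ^ v)" by (simp add: poly_altdef r_def)
    also have "\<dots> = (\<Sum>v<N. r v * z ^ v)"
      using degQ by (intro sum.mono_neutral_left) (auto simp: r_def coeff_eq_0)
    finally show ?thesis .
  qed
  have polyQ': "poly Q z = (\<Sum>n<L. z ^ n) ^ p" for z
    by (simp add: Q_def poly_sum poly_monom)
  have upper: "(norm (poly Q (ee (\<theta> i))))\<^sup>2 \<le> (1 / (2 * \<eta>)) ^ (2 * p)" if "i \<in> P" for i
  proof -
    have pos: "nint (\<theta> i) > 0" using avoid[OF that] \<eta> by linarith
    have "norm (\<Sum>n<L. ee (\<theta> i) ^ n) \<le> 1 / (2 * nint (\<theta> i))"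
      using norm_geometric_ee_le[OF pos] by (simp add: ee_power)
    also have "\<dots> \<le> 1 / (2 * \<eta>)" using avoid[OF that] \<eta> by (simp add: frac_le)
    finally have "norm (\<Sum>n<L. ee (\<theta> i) ^ n) ^ (2 * p) \<le> (1 / (2 * \<eta>)) ^ (2 * p)"
      by (rule power_mono) simp
    then show ?thesis
      by (simp add: polyQ' norm_power power_mult[symmetric] mult.commute)
  qed
  \<comment> \<open>Cauchy-Schwarz applied to the sum of the coefficients, which is
    \<open>poly Q 1 = L ^ p\<close>.\<close>
  have Rlow: "real L ^ (2 * p) \<le> R * real N"
  proof -
    have "(\<Sum>v<N. r v) = of_nat (L ^ p)" using polyQ[of 1] polyQ'[of 1] by simp
    then have "real L ^ p = norm (\<Sum>v<N. r v)" by (simp add: norm_power)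
    also have "\<dots> \<le> (\<Sum>v<N. norm (r v))" by (rule norm_sum)
    finally have "(real L ^ p)\<^sup>2 \<le> (\<Sum>v<N. norm (r v))\<^sup>2" by (rule power_mono) simp
    also have "\<dots> \<le> R * card {..<N}" unfolding R_def by (rule sum_squared_le_sum_of_squares)
    finally show ?thesis by (simp add: power_mult[symmetric] mult.commute)
  qed
  have Rpos: "R > 0"
  proof -
    have "real L ^ (2 * p) > 0" using L by simp
    then have "R * real N > 0" using Rlow by linarith
    then show ?thesis using N by (simp add: zero_less_mult_iff)
  qed
  have diag: "D v v = card P" for v by (simp add: D_def)
  have Dsym: "D v v' = D v' v" for v v'
  proof -
    have "D v v' = norm (cnj (\<Sum>i\<in>P. ee ((of_nat v' - of_nat v) * \<theta> i)))"
      by (simp add: D_def cnj_ee cnj_sum algebra_simps)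
    then show ?thesis by (simp only: complex_mod_cnj D_def)
  qed
  \<comment> \<open>In a fixed row each distance \<open>m\<close> between indices occurs at most
    once on either side of the diagonal, and opposite signs give conjugate sums.\<close>
  have row: "(\<Sum>v'\<in>{..<N} - {v}. D v v') \<le> 2 * T" if "v < N" for v
  proof -
    have *: "(\<Sum>v'<v. D v v') \<le> T"
    proof -
      have "(\<Sum>v'<v. D v v') = (\<Sum>m\<in>(\<lambda>v'. v - v') ` {..<v}. norm (\<Sum>i\<in>P. ee (of_nat m * \<theta> i)))"
        by (subst sum.reindex) (auto simp: inj_on_def D_def intro!: sum.cong)
      also have "\<dots> \<le> T" unfolding T_def using that by (intro sum_mono2) auto
      finally show ?thesis .
    qed
    have **: "(\<Sum>v'\<in>{v<..<N}. D v v') \<le> T"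
    proof -
      have "(\<Sum>v'\<in>{v<..<N}. D v v') = (\<Sum>m\<in>(\<lambda>v'. v' - v) ` {v<..<N}. norm (\<Sum>i\<in>P. ee (of_nat m * \<theta> i)))"
        unfolding Dsym[of v] by (subst sum.reindex) (auto simp: inj_on_def D_def intro!: sum.cong)
      also have "\<dots> \<le> T" unfolding T_def using that by (intro sum_mono2) auto
      finally show ?thesis .
    qed
    have un: "{..<N} - {v} = {..<v} \<union> {v<..<N}" using that by auto
    have "(\<Sum>v'\<in>{..<N} - {v}. D v v') = (\<Sum>v'<v. D v v') + (\<Sum>v'\<in>{v<..<N}. D v v')"
      unfolding un by (rule sum.union_disjoint) auto
    then show ?thesis using * ** by linarith
  qed
  have expand: "complex_of_real (\<Sum>i\<in>P. (norm (poly Q (ee (\<theta> i))))\<^sup>2)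
      = (\<Sum>v<N. \<Sum>v'<N. r v * cnj (r v') * (\<Sum>i\<in>P. ee ((of_nat v - of_nat v') * \<theta> i)))"
  proof -
    have "complex_of_real (\<Sum>i\<in>P. (norm (poly Q (ee (\<theta> i))))\<^sup>2)
        = (\<Sum>i\<in>P. poly Q (ee (\<theta> i)) * cnj (poly Q (ee (\<theta> i))))"
      by (simp add: complex_norm_square flip: of_real_power)
    also have "\<dots> = (\<Sum>i\<in>P. \<Sum>v<N. \<Sum>v'<N. r v * cnj (r v') * ee ((of_nat v - of_nat v') * \<theta> i))"
    proof (rule sum.cong[OF refl])
      fix i
      have "ee (\<theta> i) ^ v * cnj (ee (\<theta> i) ^ v') = ee ((of_nat v - of_nat v') * \<theta> i)" for v v'
        by (simp add: ee_power cnj_ee left_diff_distrib flip: ee_add)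
      then show "poly Q (ee (\<theta> i)) * cnj (poly Q (ee (\<theta> i)))
          = (\<Sum>v<N. \<Sum>v'<N. r v * cnj (r v') * ee ((of_nat v - of_nat v') * \<theta> i))"
        unfolding polyQ cnj_sum sum_product by (intro sum.cong refl) (simp add: mult_ac)
    qed
    also have "\<dots> = (\<Sum>v<N. \<Sum>v'<N. \<Sum>i\<in>P. r v * cnj (r v') * ee ((of_nat v - of_nat v') * \<theta> i))"
      by (subst sum.swap, intro sum.cong refl, subst sum.swap) (rule refl)
    finally show ?thesis by (simp add: sum_distrib_left)
  qed
  have swap: "(\<Sum>v<N. \<Sum>v'\<in>{..<N} - {v}. G v v') = (\<Sum>v'<N. \<Sum>v\<in>{..<N} - {v'}. G v v')"
    for G :: "nat \<Rightarrow> nat \<Rightarrow> real"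
  proof -
    have e: "{..<N} - {v} = {v' \<in> {..<N}. v \<noteq> v'}" "{..<N} - {v} = {v' \<in> {..<N}. v' \<noteq> v}" for v
      by auto
    have "(\<Sum>v<N. \<Sum>v'\<in>{..<N} - {v}. G v v') = (\<Sum>v<N. \<Sum>v'\<in>{v' \<in> {..<N}. v \<noteq> v'}. G v v')"
      by (simp only: e(1))
    also have "\<dots> = (\<Sum>v'<N. \<Sum>v\<in>{v \<in> {..<N}. v \<noteq> v'}. G v v')"
      by (rule sum.swap_restrict) auto
    finally show ?thesis by (simp only: e(2))
  qed
  define F where "F v v' = r v * cnj (r v') * (\<Sum>i\<in>P. ee ((of_nat v - of_nat v') * \<theta> i))" for v v'
  have "(\<Sum>v<N. \<Sum>v'<N. F v v') = (\<Sum>v<N. F v v) + (\<Sum>v<N. \<Sum>v'\<in>{..<N} - {v}. F v v')"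
    by (simp add: sum.remove[of "{..<N}"] flip: sum.distrib)
  moreover have "(\<Sum>v<N. F v v) = complex_of_real (R * card P)"
    by (simp add: F_def R_def sum_distrib_right complex_norm_square flip: of_real_power)
  ultimately have "complex_of_real (R * card P) = complex_of_real (\<Sum>i\<in>P. (norm (poly Q (ee (\<theta> i))))\<^sup>2)
      - (\<Sum>v<N. \<Sum>v'\<in>{..<N} - {v}. F v v')"
    using expand unfolding F_def by simp
  then have "norm (complex_of_real (R * card P)) \<le> norm (complex_of_real (\<Sum>i\<in>P. (norm (poly Q (ee (\<theta> i))))\<^sup>2))
      + norm (\<Sum>v<N. \<Sum>v'\<in>{..<N} - {v}. F v v')"
    by (metis norm_triangle_ineq4)
  then have main: "R * card P \<le> (\<Sum>i\<in>P. (norm (poly Q (ee (\<theta> i))))\<^sup>2)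
      + norm (\<Sum>v<N. \<Sum>v'\<in>{..<N} - {v}. F v v')"
    unfolding norm_of_real using Rpos by (simp add: sum_nonneg)
  \<comment> \<open>The Schur test: \<open>a * b \<le> (a\<^sup>2 + b\<^sup>2) / 2\<close> and the
    symmetry of \<open>D\<close> reduce the off-diagonal part to row sums weighted by
    \<open>(norm (r v))\<^sup>2\<close>.\<close>
  have "norm (\<Sum>v<N. \<Sum>v'\<in>{..<N} - {v}. F v v') \<le> (\<Sum>v<N. \<Sum>v'\<in>{..<N} - {v}. norm (F v v'))"
    by (rule order_trans[OF norm_sum sum_mono[OF norm_sum]])
  also have "\<dots> \<le> (\<Sum>v<N. \<Sum>v'\<in>{..<N} - {v}. (norm (r v))\<^sup>2 * D v v' / 2 + (norm (r v'))\<^sup>2 * D v v' / 2)"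
  proof (intro sum_mono)
    fix v v'
    have "norm (r v) * norm (r v') \<le> ((norm (r v))\<^sup>2 + (norm (r v'))\<^sup>2) / 2"
      using sum_squares_bound[of "norm (r v)" "norm (r v')"] by simp
    then have "norm (r v) * norm (r v') * D v v' \<le> ((norm (r v))\<^sup>2 + (norm (r v'))\<^sup>2) / 2 * D v v'"
      by (rule mult_right_mono) (simp add: D_def)
    then show "norm (F v v') \<le> (norm (r v))\<^sup>2 * D v v' / 2 + (norm (r v'))\<^sup>2 * D v v' / 2"
      by (simp add: F_def D_def norm_mult algebra_simps)
  qed
  also have "\<dots> = (\<Sum>v<N. \<Sum>v'\<in>{..<N} - {v}. (norm (r v))\<^sup>2 * D v v' / 2)
      + (\<Sum>v<N. \<Sum>v'\<in>{..<N} - {v}. (norm (r v'))\<^sup>2 * D v v' / 2)"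
    by (simp add: sum.distrib)
  also have "(\<Sum>v<N. \<Sum>v'\<in>{..<N} - {v}. (norm (r v'))\<^sup>2 * D v v' / 2)
      = (\<Sum>v'<N. \<Sum>v\<in>{..<N} - {v'}. (norm (r v'))\<^sup>2 * D v v' / 2)"
    by (rule swap)
  also have "\<dots> = (\<Sum>v<N. \<Sum>v'\<in>{..<N} - {v}. (norm (r v))\<^sup>2 * D v v' / 2)"
    by (simp only: Dsym)
  also have "(\<Sum>v<N. \<Sum>v'\<in>{..<N} - {v}. (norm (r v))\<^sup>2 * D v v' / 2)
      + (\<Sum>v<N. \<Sum>v'\<in>{..<N} - {v}. (norm (r v))\<^sup>2 * D v v' / 2)
      = (\<Sum>v<N. (norm (r v))\<^sup>2 * (\<Sum>v'\<in>{..<N} - {v}. D v v'))"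
    by (simp add: sum_distrib_left mult_ac flip: sum.distrib)
  also have "\<dots> \<le> (\<Sum>v<N. (norm (r v))\<^sup>2 * (2 * T))"
    by (intro sum_mono mult_left_mono row) auto
  also have "\<dots> = R * (2 * T)" by (simp add: R_def sum_distrib_right)
  finally have off: "norm (\<Sum>v<N. \<Sum>v'\<in>{..<N} - {v}. F v v') \<le> R * (2 * T)" .
  have up: "(\<Sum>i\<in>P. (norm (poly Q (ee (\<theta> i))))\<^sup>2) \<le> card P * (1 / (2 * \<eta>)) ^ (2 * p)"
    using sum_bounded_above[of P "\<lambda>i. (norm (poly Q (ee (\<theta> i))))\<^sup>2"] upper by simp
  \<comment> \<open>If \<open>T\<close> were below \<open>card P / 4\<close>, the off-diagonal part
    would take less than half of \<open>R * card P\<close>. The mean square of \<open>Q\<close> over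
    \<open>P\<close> would then exceed \<open>R / 2\<close>, which \<open>upper\<close> and
    \<open>Rlow\<close> forbid.\<close>
  show ?thesis
  proof (rule ccontr)
    assume "\<not> ?thesis"
    then have "T < card P / 4" by (simp add: T_def N_def)
    then have "R * (2 * T) < R * (card P / 2)" using Rpos by simp
    then have "R * card P / 2 < card P * (1 / (2 * \<eta>)) ^ (2 * p)"
      using main off up by (simp add: algebra_simps)
    then have "card P * (R / 2) < card P * (1 / (2 * \<eta>)) ^ (2 * p)"
      by (simp add: algebra_simps)
    then have "R / 2 < (1 / (2 * \<eta>)) ^ (2 * p)"
      using False fin by (simp add: card_gt_0_iff)
    then have "R * (2 * \<eta>) ^ (2 * p) < 2" using \<eta> by (simp add: power_one_over field_simps)
    then have "R * (2 * \<eta>) ^ (2 * p) * N < 2 * N" using N by simp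
    moreover have "real L ^ (2 * p) * (2 * \<eta>) ^ (2 * p) \<le> R * real N * (2 * \<eta>) ^ (2 * p)"
      using \<eta> by (intro mult_right_mono Rlow) auto
    ultimately have "real L ^ (2 * p) * (2 * \<eta>) ^ (2 * p) < 2 * N" by (simp add: mult_ac)
    then show False using large by (simp add: N_def power_mult_distrib mult_ac)
  qed
qed

section \<open>Sums of reciprocal distances\<close>

lemma minsum_term_pos: "Y > 0 \<Longrightarrow> minsum_term Y t > 0"
  by (simp add: minsum_term_def less_max_iff_disj)

lemma minsum_term_le: "Y > 0 \<Longrightarrow> minsum_term Y t \<le> Y"
  unfolding minsum_term_def by (simp add: divide_le_eq less_max_iff_disj) (simp add: field_simps le_max_iff_disj max_def)

lemma minsum_term_le_inverse:
  assumes "Y > 0" "0 < c" "c \<le> nint t"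
  shows "minsum_term Y t \<le> 1 / c"
  unfolding minsum_term_def using assms by (intro divide_left_mono) auto

text \<open>Cells of width \<open>d\<close> for the distance to the nearest integer hold at most one
  point each. The point in cell 0 costs the trivial \<open>Y\<close>, the one in cell
  \<open>s > 0\<close> at most \<open>1 / (s * d)\<close>, hence the harmonic sum. Cells beyond
  \<open>S\<close> are empty because the distance never exceeds 1/2.\<close>

lemma sum_minsum_term_half:
  fixes \<theta> :: "'a \<Rightarrow> real"
  assumes fin: "finite B" and d: "d > 0" and Y: "Y > 0" and S: "1 / (2 * d) \<le> real S"
    and inj: "inj_on (\<lambda>n. nat \<lfloor>nint (\<theta> n) / d\<rfloor>) B"
  shows "(\<Sum>n\<in>B. minsum_term Y (\<theta> n)) \<le> Y + harm S / d"
proof -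
  define h where "h s = (if s = 0 then Y else 1 / (real s * d))" for s :: nat
  define c where "c n = nat \<lfloor>nint (\<theta> n) / d\<rfloor>" for n
  have c: "real (c n) \<le> nint (\<theta> n) / d" for n
    using nint_nonneg[of "\<theta> n"] d by (simp add: c_def)
  have "minsum_term Y (\<theta> n) \<le> h (c n)" for n
  proof (cases "c n = 0")
    case False
    then show ?thesis
      using minsum_term_le_inverse[OF Y, of "real (c n) * d" "\<theta> n"] c[of n] d
      by (simp add: h_def pos_le_divide_eq)
  qed (simp add: h_def minsum_term_le Y)
  then have "(\<Sum>n\<in>B. minsum_term Y (\<theta> n)) \<le> (\<Sum>n\<in>B. h (c n))" by (intro sum_mono)
  also have "\<dots> = (\<Sum>s\<in>c ` B. h s)" using inj by (simp add: sum.reindex c_def[abs_def] o_def)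
  also have "\<dots> \<le> (\<Sum>s\<in>{0..S}. h s)"
  proof (rule sum_mono2)
    show "c ` B \<subseteq> {0..S}"
    proof clarsimp
      fix n
      have "real (c n) \<le> (1/2) / d" using c[of n] nint_le_half[of "\<theta> n"] d
        by (meson divide_right_mono less_imp_le order_trans)
      also have "\<dots> \<le> real S" using S by simp
      finally show "c n \<le> S" by simp
    qed
  qed (use d Y in \<open>auto simp: h_def\<close>)
  also have "\<dots> = h 0 + (\<Sum>s\<in>{1..S}. h s)" by (simp add: sum.atLeast_Suc_atMost)
  also have "(\<Sum>s\<in>{1..S}. h s) = harm S / d"
    unfolding harm_def sum_divide_distrib by (rule sum.cong) (auto simp: h_def field_simps)
  finally show ?thesis by (simp add: h_def)
qed

text \<open>Two points on opposite sides of an integer can be far apart and still have the same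
  distance to it. Treating the two signs of the residue \<open>z\<close> separately repairs this and
  costs the factor 2.\<close>

lemma sum_minsum_term_spaced:
  fixes \<theta> :: "'a \<Rightarrow> real"
  assumes fin: "finite A" and d: "d > 0" and Y: "Y > 0" and S: "1 / (2 * d) \<le> real S"
    and sp: "\<And>n n'. n \<in> A \<Longrightarrow> n' \<in> A \<Longrightarrow> n \<noteq> n' \<Longrightarrow> nint (\<theta> n - \<theta> n') \<ge> d"
  shows "(\<Sum>n\<in>A. minsum_term Y (\<theta> n)) \<le> 2 * (Y + harm S / d)"
proof -
  define z where "z n = \<theta> n - of_int (round (\<theta> n))" for n
  have nz: "nint (\<theta> n) = \<bar>z n\<bar>" for n by (simp add: z_def dist_nearest_int_def)
  have far: "\<bar>z n - z n'\<bar> \<ge> d" if "n \<in> A" "n' \<in> A" "n \<noteq> n'" for n n'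
    using sp[OF that] nint_le[of "\<theta> n - \<theta> n'" "round (\<theta> n) - round (\<theta> n')"] by (simp add: z_def)
  have inj: "inj_on (\<lambda>n. nat \<lfloor>nint (\<theta> n) / d\<rfloor>) B"
    if B: "B \<subseteq> A" and same: "(\<forall>n\<in>B. z n \<ge> 0) \<or> (\<forall>n\<in>B. z n < 0)" for B
  proof (rule inj_onI, rule ccontr)
    fix n n' assume n: "n \<in> B" "n' \<in> B" "n \<noteq> n'"
      and eq: "nat \<lfloor>nint (\<theta> n) / d\<rfloor> = nat \<lfloor>nint (\<theta> n') / d\<rfloor>"
    have "\<lfloor>\<bar>z n\<bar> / d\<rfloor> = \<lfloor>\<bar>z n'\<bar> / d\<rfloor>" using eq d by (simp add: nz eq_nat_nat_iff)
    then have "\<bar>\<bar>z n\<bar> / d - \<bar>z n'\<bar> / d\<bar> < 1" by linarith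
    then have "\<bar>\<bar>z n\<bar> - \<bar>z n'\<bar>\<bar> < d" using d by (simp flip: diff_divide_distrib)
    moreover have "\<bar>\<bar>z n\<bar> - \<bar>z n'\<bar>\<bar> = \<bar>z n - z n'\<bar>" using same n by (auto simp: abs_if)
    ultimately show False using far[of n n'] n B by auto
  qed
  define P where "P = {n \<in> A. z n \<ge> 0}"
  define Q where "Q = {n \<in> A. z n < 0}"
  have "(\<Sum>n\<in>P. minsum_term Y (\<theta> n)) \<le> Y + harm S / d"
    by (intro sum_minsum_term_half inj d Y S) (use fin in \<open>auto simp: P_def\<close>)
  moreover have "(\<Sum>n\<in>Q. minsum_term Y (\<theta> n)) \<le> Y + harm S / d"
    by (intro sum_minsum_term_half inj d Y S) (use fin in \<open>auto simp: Q_def\<close>)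
  moreover have "(\<Sum>n\<in>A. minsum_term Y (\<theta> n)) = (\<Sum>n\<in>P. minsum_term Y (\<theta> n)) + (\<Sum>n\<in>Q. minsum_term Y (\<theta> n))"
    by (subst sum.union_disjoint[symmetric]) (use fin in \<open>auto simp: P_def Q_def intro!: sum.cong\<close>)
  ultimately show ?thesis by simp
qed

text \<open>Within a block of about \<open>r / 2\<close> consecutive \<open>n\<close> the multiples
  of \<open>\<beta>\<close> are spaced by \<open>1 / (2 * r)\<close> modulo 1: for a difference
  \<open>t\<close> with \<open>2 * \<bar>t\<bar> \<le> r\<close> the fraction
  \<open>t * b / r\<close> is at least \<open>1 / r\<close> away from the integers, and replacing
  \<open>b / r\<close> by \<open>\<beta>\<close> moves it by at most half of that.\<close>

lemma sum_minsum_term_rational: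
  fixes \<beta> Y :: real and b :: int and r N :: nat
  assumes Y: "Y > 0" and r: "r > 0" and cop: "coprime b (int r)" and app: "\<bar>real r * \<beta> - of_int b\<bar> \<le> 1 / real r"
  shows "(\<Sum>n=1..N. minsum_term Y (of_nat n * \<beta>)) \<le> (2 * real N / real r + 1) * (2 * Y + 4 * real r * harm r)"
proof -
  have gap: "nint (of_int t * \<beta>) \<ge> 1 / (2 * real r)" if t: "t \<noteq> 0" "2 * \<bar>t\<bar> \<le> int r" for t :: int
  proof -
    obtain c where c: "nint (of_int (t * b) / real r) = \<bar>of_int (t * b) / real r - of_int c\<bar>" by (rule nintE)
    have "\<not> int r dvd t * b"
    proof
      assume "int r dvd t * b"
      then have "int r dvd t" using cop by (simp add: coprime_commute coprime_dvd_mult_left_iff)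
      then have "\<bar>int r\<bar> \<le> \<bar>t\<bar>" by (rule dvd_imp_le_int[OF t(1)])
      then show False using t r by linarith
    qed
    then have "t * b - c * int r \<noteq> 0" by (metis dvd_triv_right eq_iff_diff_eq_0)
    then have "1 \<le> \<bar>t * b - c * int r\<bar>" by linarith
    then have "real_of_int 1 \<le> real_of_int \<bar>t * b - c * int r\<bar>" by (simp only: of_int_le_iff)
    then have "1 \<le> \<bar>of_int (t * b) - of_int c * real r\<bar>"
      by simp
    moreover have "\<bar>of_int (t * b) / real r - of_int c\<bar> = \<bar>of_int (t * b) - of_int c * real r\<bar> / real r"
    proof -
      have "of_int (t * b) / real r - of_int c = (of_int (t * b) - of_int c * real r) / real r"
        using r by (simp add: diff_divide_distrib)
      then show ?thesis by (simp add: abs_divide)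
    qed
    ultimately have 1: "nint (of_int (t * b) / real r) \<ge> 1 / real r"
      using c r by (simp add: divide_right_mono)
    define u where "u = of_int t * (real r * \<beta> - of_int b) / real r"
    have "\<bar>u\<bar> = \<bar>of_int t\<bar> * \<bar>real r * \<beta> - of_int b\<bar> / real r" by (simp add: u_def abs_mult)
    also have "\<dots> \<le> (real r / 2) * (1 / real r) / real r"
      using t app r by (intro divide_right_mono mult_mono) auto
    finally have 2: "\<bar>u\<bar> \<le> 1 / (2 * real r)" using r by simp
    have "of_int (t * b) / real r = of_int t * \<beta> + - u" using r by (simp add: u_def field_simps)
    then have "nint (of_int (t * b) / real r) \<le> nint (of_int t * \<beta>) + nint (- u)"
      using nint_add_le[of "of_int t * \<beta>" "- u"] by simp
    moreover have "nint (- u) \<le> \<bar>u\<bar>" using nint_le[of u 0] by simp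
    ultimately have "nint (of_int t * \<beta>) \<ge> 1 / real r - 1 / (2 * real r)" using 1 2 by linarith
    then show ?thesis by (simp add: field_simps)
  qed
  \<comment> \<open>Two indices in one block of this length differ by at most
    \<open>r div 2\<close>, and \<open>2 * B \<ge> r\<close> keeps the number of blocks below
    \<open>2 * N / r + 1\<close>.\<close>
  define B where "B = r div 2 + 1"
  have "B > 0" "r \<le> 2 * B" unfolding B_def by simp_all
  then have B: "B > 0" "real r \<le> 2 * real B" by simp_all
  define M where "M = 2 * Y + 4 * real r * harm r"
  have M: "M \<ge> 0" unfolding M_def using Y by (intro add_nonneg_nonneg mult_nonneg_nonneg harm_nonneg) auto
  have "(\<Sum>n=1..N. minsum_term Y (of_nat n * \<beta>))
      = (\<Sum>g\<in>{..N div B}. \<Sum>n\<in>{n. n \<in> {1..N} \<and> n div B = g}. minsum_term Y (of_nat n * \<beta>))"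
    by (rule sum.group[symmetric]) (auto intro: div_le_mono)
  also have "\<dots> \<le> (\<Sum>g\<in>{..N div B}. M)"
  proof (rule sum_mono)
    fix g
    have "(\<Sum>n\<in>{n. n \<in> {1..N} \<and> n div B = g}. minsum_term Y (of_nat n * \<beta>)) \<le> 2 * (Y + harm r / (1 / (2 * real r)))"
    proof (rule sum_minsum_term_spaced)
      fix n n' assume n: "n \<in> {n. n \<in> {1..N} \<and> n div B = g}" "n' \<in> {n. n \<in> {1..N} \<and> n div B = g}" "n \<noteq> n'"
      have "n = g * B + n mod B" "n' = g * B + n' mod B"
        using n div_mult_mod_eq[of n B] div_mult_mod_eq[of n' B] by simp_all
      moreover have "n mod B < B" "n' mod B < B" using B by simp_all
      ultimately have "\<bar>int n - int n'\<bar> < int B" by linarith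
      then have "2 * \<bar>int n - int n'\<bar> \<le> int r"
      proof -
        have "int (2 * (r div 2)) \<le> int r" by (simp only: of_nat_le_iff)
        then show ?thesis using \<open>\<bar>int n - int n'\<bar> < int B\<close> by (simp add: B_def)
      qed
      then show "1 / (2 * real r) \<le> nint (of_nat n * \<beta> - of_nat n' * \<beta>)"
        using gap[of "int n - int n'"] n by (simp add: left_diff_distrib)
    qed (use Y r in auto)
    then show "(\<Sum>n\<in>{n. n \<in> {1..N} \<and> n div B = g}. minsum_term Y (of_nat n * \<beta>)) \<le> M"
      using r by (simp add: M_def algebra_simps)
  qed
  also have "\<dots> = (real (N div B) + 1) * M" by simp
  also have "\<dots> \<le> (2 * real N / real r + 1) * M"
  proof -
    have "real (N div B) \<le> real N / real B" by (rule of_nat_div_le_of_nat)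
    also have "\<dots> \<le> real N / (real r / 2)" using B r by (intro divide_left_mono) auto
    finally show ?thesis using M by (intro mult_right_mono) (simp_all add: mult.commute)
  qed
  finally show ?thesis by (simp add: M_def)
qed

text \<open>Dirichlet's theorem always supplies a fraction \<open>b / r\<close>; the point is that
  \<open>r\<close> is small. In the upper bound for the sum every term except
  \<open>4 * N * Y / r\<close> is a small part of \<open>T\<close>, so this term carries at least
  half of \<open>T\<close>, whence \<open>r \<le> 8 * V\<close>.\<close>

lemma rational_approx_of_large_minsum:
  fixes \<beta> V L :: real and Y N :: nat
  assumes Y: "Y > 0" and YN: "Y \<le> N" and V: "V \<ge> 1" and L: "L \<ge> 1" "harm (N * Y) \<le> L"
    and VY: "64 * V * L \<le> real Y"
    and large: "(\<Sum>n=1..N. minsum_term (real Y) (of_nat n * \<beta>)) \<ge> real N * real Y / V"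
  shows "\<exists>r::nat. r \<ge> 1 \<and> real r \<le> 64 * V * L \<and> nint (real r * \<beta>) \<le> 64 * V * L / (real N * real Y)"
proof -
  define T where "T = real N * real Y / V"
  \<comment> \<open>The largest bound on denominators for which \<open>4 * r * L\<close> stays
    within \<open>T / 8\<close>. Its reciprocal is, up to a factor 2 for the floor, the quality
    claimed for the approximation.\<close>
  define q where "q = real N * real Y / (32 * V * L)"
  define A where "A = nat \<lfloor>q\<rfloor>"
  have N: "N > 0" using Y YN by simp
  have VL: "V * L \<ge> 1" using V L by (metis mult_mono' mult_1 zero_le_one)
  have "2 * real N * (32 * V * L) = real N * (64 * V * L)" by simp
  also have "\<dots> \<le> real N * real Y" using VY by (intro mult_left_mono) auto
  finally have q2: "2 * real N \<le> q" using V L by (simp add: q_def field_simps)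
  then have q1: "q \<ge> 1" using N by linarith
  have "A > 0" using q1 by (simp add: A_def)
  moreover have "real A \<le> q" "q < real A + 1" using q1 by (simp_all add: A_def)
  ultimately have A: "real A \<le> q" "q \<le> 2 * real A" "A > 0" by simp_all
  obtain b k where bk: "coprime b k" "0 < k" "k \<le> int A" "\<bar>of_int k * \<beta> - of_int b\<bar> < 1 / real A"
    using Dirichlet_approx_coprime[OF A(3)] by blast
  define r where "r = nat k"
  have r: "r > 0" "k = int r" "r \<le> A" using bk by (auto simp: r_def)
  have "\<bar>real r * \<beta> - of_int b\<bar> \<le> 1 / real A" using bk r by simp
  also have "\<dots> \<le> 1 / real r" using r by (simp add: frac_le)
  finally have "(\<Sum>n=1..N. minsum_term (real Y) (of_nat n * \<beta>))
      \<le> (2 * real N / real r + 1) * (2 * real Y + 4 * real r * harm r)"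
    using bk r Y by (intro sum_minsum_term_rational) auto
  also have "\<dots> \<le> (2 * real N / real r + 1) * (2 * real Y + 4 * real r * L)"
  proof -
    have "q \<le> real N * real Y / 1" unfolding q_def using VL V L by (intro divide_left_mono) auto
    then have "real r \<le> real (N * Y)" using A r by simp
    then have "harm r \<le> (harm (N * Y) :: real)" by (intro harm_mono) (simp only: of_nat_le_iff)
    then show ?thesis using L by (intro mult_left_mono add_left_mono) auto
  qed
  also have "\<dots> = 4 * real N * real Y / real r + 8 * real N * L + 2 * real Y + 4 * real r * L"
    using r by (simp add: field_simps)
  finally have "T \<le> 4 * real N * real Y / real r + 8 * real N * L + 2 * real Y + 4 * real r * L"
    using large by (simp add: T_def)
  moreover have "8 * real N * L \<le> T / 8"
  proof -
    have "real N * (64 * V * L) \<le> real N * real Y" using VY by (intro mult_left_mono) auto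
    then show ?thesis using V by (simp add: T_def field_simps)
  qed
  moreover have "2 * real Y \<le> 2 * real N * L"
  proof -
    have "real N * 1 \<le> real N * L" using L by (intro mult_left_mono) auto
    then show ?thesis using YN by simp
  qed
  moreover have "4 * real r * L \<le> T / 8"
  proof -
    have "4 * real r * L \<le> 4 * q * L" using A r L by (intro mult_right_mono) auto
    also have "\<dots> = T / 8" using L V by (simp add: q_def T_def)
    finally show ?thesis .
  qed
  ultimately have "T / 2 \<le> 4 * real N * real Y / real r" by linarith
  then have "real r * (real N * real Y) \<le> (8 * V) * (real N * real Y)"
    using r V by (simp add: T_def field_simps)
  then have "real r \<le> 8 * V" using N Y by simp
  also have "\<dots> \<le> 64 * V * L" using V L VL by (simp add: mult.assoc)
  finally have rV: "real r \<le> 64 * V * L" .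
  have "nint (real r * \<beta>) \<le> 1 / real A" using nint_le[of "real r * \<beta>" b] bk r by simp
  also have "\<dots> \<le> 1 / (q / 2)" using A q1 by (intro divide_left_mono) auto
  also have "\<dots> = 64 * V * L / (real N * real Y)" using V L by (simp add: q_def)
  finally show ?thesis using r rV by (intro exI[of _ r]) auto
qed

section \<open>The divisor bound\<close>

definition divisor_count :: "nat \<Rightarrow> nat" where "divisor_count n = card {d. d dvd n}"

lemma divisor_count_prime_power_mult:
  assumes "prime p" "m > 0"
  shows "divisor_count (p ^ a * m) \<le> (a + 1) * divisor_count m"
proof -
  have "{d. d dvd p ^ a * m} \<subseteq> (\<lambda>(i, d). p ^ i * d) ` ({..a} \<times> {d. d dvd m})"
  proof
    fix d assume "d \<in> {d. d dvd p ^ a * m}"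
    then obtain b c where bc: "d = b * c" "b dvd p ^ a" "c dvd m"
      using division_decomp[of d "p ^ a" m] by auto
    then obtain i where "i \<le> a" "b = p ^ i"
      using divides_primepow_nat[OF assms(1)] by auto
    then show "d \<in> (\<lambda>(i, d). p ^ i * d) ` ({..a} \<times> {d. d dvd m})" using bc by force
  qed
  then have "card {d. d dvd p ^ a * m} \<le> card ((\<lambda>(i, d). p ^ i * d) ` ({..a} \<times> {d. d dvd m}))"
    using assms by (intro card_mono) auto
  also have "\<dots> \<le> card ({..a} \<times> {d. d dvd m})"
    using assms by (intro card_image_le) auto
  also have "\<dots> = (a + 1) * card {d. d dvd m}" by (simp only: card_cartesian_product card_atMost Suc_eq_plus1)
  finally show ?thesis by (simp only: divisor_count_def)
qed

text \<open>Full prime powers \<open>p ^ a\<close> are split off one at a time. For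
  \<open>p \<ge> 2 powr (1 / \<epsilon>)\<close> the factor \<open>a + 1 \<le> 2 ^ a\<close> is
  covered by \<open>(p powr \<epsilon>) ^ a\<close> with nothing lost; each of the finitely many
  smaller primes costs one constant factor.\<close>

lemma divisor_count_bound:
  fixes \<epsilon> :: real
  assumes \<epsilon>: "\<epsilon> > 0"
  shows "\<exists>C\<ge>1. \<forall>n>0. real (divisor_count n) \<le> C * real n powr \<epsilon>"
proof -
  define u where "u = (2::real) powr \<epsilon> - 1"
  have u: "u > 0" using \<epsilon> by (simp add: u_def)
  \<comment> \<open>Makes \<open>C * u \<ge> 1\<close>, hence
    \<open>a + 1 \<le> C * (1 + a * u) \<le> C * (1 + u) ^ a\<close>, where
    \<open>1 + u = 2 powr \<epsilon>\<close> is at most \<open>p powr \<epsilon>\<close>.\<close>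
  define C where "C = 1 + 1 / u"
  have C: "C \<ge> 1" "C * u \<ge> 1" using u by (simp_all add: C_def field_simps)
  define P where "P = nat \<lceil>(2::real) powr (1 / \<epsilon>)\<rceil>"
  define S where "S n = {p. prime p \<and> p < P \<and> p dvd n}" for n
  have finS: "finite (S n)" for n unfolding S_def by (rule finite_subset[of _ "{..<P}"]) auto
  have main: "real (divisor_count n) \<le> C ^ card (S n) * real n powr \<epsilon>" if "n > 0" for n
    using that
  proof (induction n rule: less_induct)
    case (less n)
    show ?case
    proof (cases "n = 1")
      case True
      then show ?thesis using C by (simp add: divisor_count_def)
    next
      case False
      then obtain p where p: "prime p" "p dvd n" using prime_factor_nat by blast
      define a where "a = multiplicity p n"
      obtain m where m: "n = p ^ a * m" "\<not> p dvd m"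
        using multiplicity_decompose'[of n p] less.prems p not_prime_unit unfolding a_def
        by (metis not_gr_zero)
      have a: "a > 0" using m p by (cases a) auto
      have pw: "q dvd p ^ a \<longleftrightarrow> q = p" if "prime q" for q
        using that p(1) a by (auto simp: prime_dvd_power_iff intro: primes_dvd_imp_eq)
      have m0: "m > 0" using m less.prems by (cases m) auto
      have "p ^ a > 1" using p a by (metis one_less_power prime_gt_1_nat)
      then have "m < n" using m m0 by simp
      then have IH: "real (divisor_count m) \<le> C ^ card (S m) * real m powr \<epsilon>"
        using less.IH m0 by blast
      have split: "real n powr \<epsilon> = (real p powr \<epsilon>) ^ a * real m powr \<epsilon>"
        using p m by (simp add: powr_mult powr_power powr_powr powr_realpow[symmetric] prime_gt_0_nat mult.commute)
      have p2: "real p \<ge> 2" using prime_ge_2_nat[OF p(1)] by simp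
      have "real (divisor_count n) \<le> real (a + 1) * real (divisor_count m)"
        unfolding m(1) by (metis divisor_count_prime_power_mult m0 of_nat_le_iff of_nat_mult p(1))
      also have "\<dots> \<le> real (a + 1) * (C ^ card (S m) * real m powr \<epsilon>)"
        by (intro mult_left_mono IH) auto
      also have "\<dots> \<le> C ^ card (S n) * real n powr \<epsilon>"
      proof (cases "p < P")
        case True
        have "S n = insert p (S m)" "p \<notin> S m"
          using m p True a by (auto simp: S_def prime_dvd_mult_iff pw)
        then have card: "card (S n) = Suc (card (S m))" using finS by simp
        have "real (a + 1) \<le> C * (1 + real a * u)"
        proof -
          have "real a * 1 \<le> real a * (C * u)" using C by (intro mult_left_mono) auto
          then show ?thesis using C by (simp add: algebra_simps)
        qed
        also have "\<dots> \<le> C * (1 + u) ^ a"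
          using C u by (intro mult_left_mono Bernoulli_inequality) auto
        also have "\<dots> \<le> C * (real p powr \<epsilon>) ^ a"
          using C u p2 \<epsilon> by (intro mult_left_mono power_mono) (auto simp: u_def intro: powr_mono2)
        finally have "real (a + 1) * (C ^ card (S m) * real m powr \<epsilon>) \<le> C * (real p powr \<epsilon>) ^ a * (C ^ card (S m) * real m powr \<epsilon>)"
          using C by (intro mult_right_mono) auto
        then show ?thesis by (simp add: card split mult_ac)
      next
        case False
        have "S n = S m"
          using m p False by (auto simp: S_def prime_dvd_mult_iff pw)
        have "(2::real) powr (1 / \<epsilon>) \<le> real p" using False unfolding P_def by linarith
        then have "(2 powr (1 / \<epsilon>)) powr \<epsilon> \<le> real p powr \<epsilon>" using \<epsilon> by (intro powr_mono2) auto
        then have "2 \<le> real p powr \<epsilon>" using \<epsilon> by (simp add: powr_powr)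
        then have "2 ^ a \<le> (real p powr \<epsilon>) ^ a" by (intro power_mono) auto
        moreover have "real (a + 1) \<le> 2 ^ a"
          using Bernoulli_inequality[of 1 a] by simp
        ultimately have "real (a + 1) \<le> (real p powr \<epsilon>) ^ a" by linarith
        then have "real (a + 1) * (C ^ card (S m) * real m powr \<epsilon>) \<le> (real p powr \<epsilon>) ^ a * (C ^ card (S m) * real m powr \<epsilon>)"
          using C by (intro mult_right_mono) auto
        then show ?thesis by (simp add: \<open>S n = S m\<close> split mult_ac)
      qed
      finally show ?thesis .
    qed
  qed
  have "real (divisor_count n) \<le> C ^ P * real n powr \<epsilon>" if "n > 0" for n
  proof -
    have "card (S n) \<le> card {..<P}" by (rule card_mono) (auto simp: S_def)
    then have "C ^ card (S n) \<le> C ^ P" using C by (intro power_increasing) auto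
    then show ?thesis using main[OF that] by (meson mult_right_mono order_trans powr_ge_zero)
  qed
  then show ?thesis using C by (intro exI[of _ "C ^ P"]) auto
qed

section \<open>Boxes of shift vectors for repeated differencing\<close>

definition boxed_lists :: "nat \<Rightarrow> nat \<Rightarrow> int list set" where
  "boxed_lists X n = {hs. set hs \<subseteq> {- int X..int X} \<and> length hs = n}"

lemma finite_boxed_lists [simp]: "finite (boxed_lists X n)"
  unfolding boxed_lists_def by (rule finite_lists_length_eq) simp

lemma card_boxed_lists: "card (boxed_lists X n) = (2 * X + 1) ^ n"
  unfolding boxed_lists_def by (subst card_lists_length_eq) (simp_all add: nat_add_distrib nat_mult_distrib)

lemma card_boxed_lists_le: "X > 0 \<Longrightarrow> card (boxed_lists X n) \<le> (3 * X) ^ n"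
  unfolding card_boxed_lists by (intro power_mono) auto

lemma boxed_lists_0 [simp]: "boxed_lists X 0 = {[]}"
  by (auto simp: boxed_lists_def)

lemma sum_boxed_lists_Suc:
  "(\<Sum>hs\<in>boxed_lists X (Suc n). f hs) = (\<Sum>h\<in>{- int X..int X}. \<Sum>hs\<in>boxed_lists X n. f (h # hs))"
proof -
  have "boxed_lists X (Suc n) = (\<lambda>(h, hs). h # hs) ` ({- int X..int X} \<times> boxed_lists X n)"
    (is "_ = ?R")
  proof
    show "boxed_lists X (Suc n) \<subseteq> ?R"
    proof
      fix xs assume "xs \<in> boxed_lists X (Suc n)"
      then obtain h hs where "xs = h # hs" "h \<in> {- int X..int X}" "hs \<in> boxed_lists X n"
        by (cases xs) (auto simp: boxed_lists_def)
      then show "xs \<in> ?R" by (intro image_eqI[of _ _ "(h, hs)"]) auto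
    qed
  qed (auto simp: boxed_lists_def)
  then have "(\<Sum>hs\<in>boxed_lists X (Suc n). f hs) = (\<Sum>(h, hs)\<in>{- int X..int X} \<times> boxed_lists X n. f (h # hs))"
    by (simp add: sum.reindex inj_on_def case_prod_unfold)
  then show ?thesis by (simp add: sum.cartesian_product)
qed

text \<open>Each entry vanishes on a proportion \<open>1 / (2 * X + 1)\<close> of the box. Vectors
  with a zero entry give no saving in the linear sum, but being rarer by a factor of order
  \<open>X\<close> they cost no more than a full saving would.\<close>

lemma card_boxed_lists_zero:
  "card {hs \<in> boxed_lists X n. 0 \<in> set hs} * (2 * X + 1) \<le> n * (2 * X + 1) ^ n"
proof (induction n)
  case (Suc n)
  define A where "A = {- int X..int X}"
  have cA: "card A = 2 * X + 1" by (simp add: A_def)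
  have "{hs \<in> boxed_lists X (Suc n). 0 \<in> set hs}
      \<subseteq> (#) 0 ` boxed_lists X n \<union> (\<lambda>(h, hs). h # hs) ` (A \<times> {hs \<in> boxed_lists X n. 0 \<in> set hs})"
    (is "?L \<subseteq> ?R")
  proof
    fix xs assume xs: "xs \<in> ?L"
    then obtain h hs where h: "xs = h # hs" "h \<in> A" "hs \<in> boxed_lists X n"
      by (cases xs) (auto simp: boxed_lists_def A_def)
    show "xs \<in> ?R"
    proof (cases "h = 0")
      case False
      then have "xs \<in> (\<lambda>(h, hs). h # hs) ` (A \<times> {hs \<in> boxed_lists X n. 0 \<in> set hs})"
        using h xs by (intro image_eqI[of _ _ "(h, hs)"]) auto
      then show ?thesis by blast
    qed (use h in auto)
  qed
  then have "card {hs \<in> boxed_lists X (Suc n). 0 \<in> set hs}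
      \<le> card ((#) 0 ` boxed_lists X n \<union> (\<lambda>(h, hs). h # hs) ` (A \<times> {hs \<in> boxed_lists X n. 0 \<in> set hs}))"
    by (intro card_mono) (auto simp: A_def)
  also have "\<dots> \<le> card ((#) (0::int) ` boxed_lists X n) + card ((\<lambda>(h, hs). h # hs) ` (A \<times> {hs \<in> boxed_lists X n. 0 \<in> set hs}))"
    by (rule card_Un_le)
  also have "\<dots> \<le> card (boxed_lists X n) + card (A \<times> {hs \<in> boxed_lists X n. 0 \<in> set hs})"
    by (intro add_mono card_image_le) (auto simp: A_def)
  also have "\<dots> = (2 * X + 1) ^ n + (2 * X + 1) * card {hs \<in> boxed_lists X n. 0 \<in> set hs}"
    by (simp only: card_boxed_lists card_cartesian_product cA)
  also have "\<dots> \<le> (2 * X + 1) ^ n + n * (2 * X + 1) ^ n"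
    using Suc by (simp only: mult.commute add_left_mono)
  also have "\<dots> = Suc n * (2 * X + 1) ^ n" by simp
  finally have "card {hs \<in> boxed_lists X (Suc n). 0 \<in> set hs} * (2 * X + 1) \<le> Suc n * (2 * X + 1) ^ n * (2 * X + 1)"
    by (rule mult_right_mono) simp
  also have "\<dots> = Suc n * (2 * X + 1) ^ Suc n" by (simp only: power_Suc mult_ac)
  finally show ?case .
qed simp

lemma card_boxed_lists_dvd:
  assumes "v > 0"
  shows "card {hs \<in> boxed_lists X n. \<forall>h\<in>set hs. h dvd int v} \<le> (2 * divisor_count v) ^ n"
proof -
  define B where "B = {h::int. h dvd int v}"
  have B: "B \<subseteq> int ` {d. d dvd v} \<union> (\<lambda>d. - int d) ` {d. d dvd v}"
  proof
    fix h assume "h \<in> B"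
    then have "nat \<bar>h\<bar> dvd v" by (simp add: B_def nat_abs_dvd_iff)
    moreover have "h = int (nat \<bar>h\<bar>) \<or> h = - int (nat \<bar>h\<bar>)" by linarith
    ultimately show "h \<in> int ` {d. d dvd v} \<union> (\<lambda>d. - int d) ` {d. d dvd v}" by blast
  qed
  have fin: "finite {d. d dvd v}" using assms by simp
  then have finB: "finite B" using B finite_subset by blast
  have "card B \<le> card (int ` {d. d dvd v} \<union> (\<lambda>d. - int d) ` {d. d dvd v})"
    using B fin by (intro card_mono) auto
  also have "\<dots> \<le> card (int ` {d. d dvd v}) + card ((\<lambda>d. - int d) ` {d. d dvd v})" by (rule card_Un_le)
  also have "\<dots> \<le> divisor_count v + divisor_count v"
    unfolding divisor_count_def by (intro add_mono card_image_le fin)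
  finally have cB: "card B \<le> 2 * divisor_count v" by simp
  have "card {hs \<in> boxed_lists X n. \<forall>h\<in>set hs. h dvd int v} \<le> card {hs. set hs \<subseteq> B \<and> length hs = n}"
    by (intro card_mono finite_lists_length_eq finB) (auto simp: B_def boxed_lists_def)
  also have "\<dots> = card B ^ n" by (rule card_lists_length_eq[OF finB])
  also have "\<dots> \<le> (2 * divisor_count v) ^ n" by (intro power_mono cB) simp
  finally show ?thesis .
qed

section \<open>Weyl differencing\<close>

fun diffs :: "int list \<Rightarrow> (int \<Rightarrow> real) \<Rightarrow> int \<Rightarrow> real" where
  "diffs [] f = f"
| "diffs (h # hs) f = diffs hs (\<lambda>x. f (x + h) - f x)"

text \<open>The points \<open>x\<close> for which \<open>x\<close> plus the sum of any sublist of
  \<open>hs\<close> lies in \<open>I\<close>, that is, all arguments at which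
  \<open>diffs hs f x\<close> evaluates \<open>f\<close> are admissible.\<close>

fun diff_dom :: "int list \<Rightarrow> int set \<Rightarrow> int set" where
  "diff_dom [] I = I"
| "diff_dom (h # hs) I = diff_dom hs {x \<in> I. x + h \<in> I}"

lemma diff_dom_subset: "diff_dom hs I \<subseteq> I"
  by (induction hs I rule: diff_dom.induct) auto

text \<open>Intersections of translates of an interval are intervals again; this is what makes the
  final sum with linear phase geometric.\<close>

lemma diff_dom_interval: "\<exists>a b. diff_dom hs {a0..b0} = {a..b}"
proof (induction hs arbitrary: a0 b0)
  case (Cons h hs)
  have "{x \<in> {a0..b0}. x + h \<in> {a0..b0}} = {max a0 (a0 - h)..min b0 (b0 - h)}" by auto
  then show ?case using Cons.IH by simp
qed auto

lemma diff_dom_append: "diff_dom (hs @ gs) I = diff_dom gs (diff_dom hs I)"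
  by (induction hs I rule: diff_dom.induct) auto

lemma diffs_append: "diffs (hs @ gs) f = diffs gs (diffs hs f)"
  by (induction hs f rule: diffs.induct) auto

lemma diffs_add: "diffs hs (\<lambda>x. f x + g x) = (\<lambda>x. diffs hs f x + diffs hs g x)"
proof (induction hs arbitrary: f g)
  case (Cons h hs)
  show ?case using Cons.IH[of "\<lambda>x. f (x + h) - f x" "\<lambda>x. g (x + h) - g x"]
    by (simp add: algebra_simps)
qed auto

lemma norm_sum_square_eq_diffs:
  fixes f :: "int \<Rightarrow> real"
  assumes I: "I \<subseteq> {1..int X}"
  shows "complex_of_real ((norm (\<Sum>x\<in>I. ee (f x)))\<^sup>2)
    = (\<Sum>h\<in>{- int X..int X}. \<Sum>x\<in>{x \<in> I. x + h \<in> I}. ee (f (x + h) - f x))"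
proof -
  have fin: "finite I" using I finite_subset by blast
  have range: "1 \<le> y \<and> y \<le> int X" if "y \<in> I" for y using I that by auto
  have "complex_of_real ((norm (\<Sum>x\<in>I. ee (f x)))\<^sup>2) = (\<Sum>x\<in>I. \<Sum>y\<in>I. ee (f y - f x))"
    unfolding complex_norm_square cnj_sum sum_product
    by (subst sum.swap) (simp add: cnj_ee flip: ee_add)
  also have "\<dots> = (\<Sum>x\<in>I. \<Sum>h\<in>{h \<in> {- int X..int X}. x + h \<in> I}. ee (f (x + h) - f x))"
  proof (rule sum.cong[OF refl])
    fix x assume "x \<in> I"
    then have "y - x \<in> {- int X..int X}" if "y \<in> I" for y
      using range[of x] range[OF that] by auto
    then show "(\<Sum>y\<in>I. ee (f y - f x)) = (\<Sum>h\<in>{h \<in> {- int X..int X}. x + h \<in> I}. ee (f (x + h) - f x))"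
      by (intro sum.reindex_bij_witness[of _ "\<lambda>h. x + h" "\<lambda>y. y - x"]) auto
  qed
  also have "\<dots> = (\<Sum>h\<in>{- int X..int X}. \<Sum>x\<in>{x \<in> I. x + h \<in> I}. ee (f (x + h) - f x))"
    using fin by (intro sum.swap_restrict) auto
  finally show ?thesis .
qed

text \<open>The first step is an identity, so the right side can be kept as the real part of a sum
  without absolute values. With a second variable present, its summation can then still be moved
  inside. With no step at all, a norm would have to be bounded by a real part, hence the start at
  \<open>Suc n\<close>.\<close>

lemma weyl_differencing_Re:
  fixes f :: "int \<Rightarrow> real"
  assumes "I \<subseteq> {1..int X}" "X > 0"
  shows "norm (\<Sum>x\<in>I. ee (f x)) ^ (2 ^ Suc n)
    \<le> (3 * real X) ^ (2 ^ Suc n - Suc n - 1)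
      * Re (\<Sum>hs\<in>boxed_lists X (Suc n). \<Sum>x\<in>diff_dom hs I. ee (diffs hs f x))"
  using assms(1)
proof (induction n arbitrary: f I)
  case 0
  have "complex_of_real ((norm (\<Sum>x\<in>I. ee (f x)))\<^sup>2) = (\<Sum>hs\<in>boxed_lists X (Suc 0). \<Sum>x\<in>diff_dom hs I. ee (diffs hs f x))"
    unfolding sum_boxed_lists_Suc using norm_sum_square_eq_diffs[OF 0] by simp
  then have "(norm (\<Sum>x\<in>I. ee (f x)))\<^sup>2 = Re (\<Sum>hs\<in>boxed_lists X (Suc 0). \<Sum>x\<in>diff_dom hs I. ee (diffs hs f x))"
    by (metis Re_complex_of_real)
  then show ?case by simp
next
  case (Suc n)
  define J where "J h = {x \<in> I. x + h \<in> I}" for h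
  define g where "g h x = f (x + h) - f x" for h x
  define Z where "Z h = (\<Sum>x\<in>J h. ee (g h x))" for h
  define E where "E = (2::nat) ^ Suc n"
  have E: "E \<ge> Suc n + 1" unfolding E_def by (metis Suc_eq_plus1 Suc_leI less_exp)
  have X: "X > 0" by (rule assms)
  have cardB: "card {- int X..int X} = 2 * X + 1" by simp
  have "(norm (\<Sum>x\<in>I. ee (f x)))\<^sup>2 = norm (complex_of_real ((norm (\<Sum>x\<in>I. ee (f x)))\<^sup>2))" unfolding norm_of_real by simp
  also have "\<dots> \<le> (\<Sum>h\<in>{- int X..int X}. norm (Z h))"
    unfolding norm_sum_square_eq_diffs[OF Suc.prems] Z_def J_def g_def by (rule norm_sum)
  finally have "((norm (\<Sum>x\<in>I. ee (f x)))\<^sup>2) ^ E \<le> (\<Sum>h\<in>{- int X..int X}. norm (Z h)) ^ E"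
    by (rule power_mono) simp
  also have "\<dots> \<le> real (2 * X + 1) ^ (E - 1) * (\<Sum>h\<in>{- int X..int X}. norm (Z h) ^ E)"
    using sum_pow_two_power_le[of "{- int X..int X}" "\<lambda>h. norm (Z h)" "Suc n"] unfolding cardB E_def by simp
  also have "\<dots> \<le> (3 * real X) ^ (E - 1) * (\<Sum>h\<in>{- int X..int X}. norm (Z h) ^ E)"
    using X by (intro mult_right_mono power_mono sum_nonneg) auto
  also have "\<dots> \<le> (3 * real X) ^ (E - 1) * (\<Sum>h\<in>{- int X..int X}.
      (3 * real X) ^ (E - Suc n - 1) * Re (\<Sum>hs\<in>boxed_lists X (Suc n). \<Sum>x\<in>diff_dom hs (J h). ee (diffs hs (g h) x)))"
  proof (intro mult_left_mono sum_mono)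
    fix h
    have "J h \<subseteq> {1..int X}" using Suc.prems by (auto simp: J_def)
    then show "norm (Z h) ^ E \<le> (3 * real X) ^ (E - Suc n - 1)
        * Re (\<Sum>hs\<in>boxed_lists X (Suc n). \<Sum>x\<in>diff_dom hs (J h). ee (diffs hs (g h) x))"
      using Suc.IH[of "J h" "g h"] unfolding Z_def E_def by blast
  qed auto
  also have "\<dots> = (3 * real X) ^ ((E - 1) + (E - Suc n - 1)) *
      Re (\<Sum>hs\<in>boxed_lists X (Suc (Suc n)). \<Sum>x\<in>diff_dom hs I. ee (diffs hs f x))"
    unfolding sum_boxed_lists_Suc[of _ X "Suc n"] J_def g_def
    by (simp add: power_add sum_distrib_left[symmetric] Re_sum mult.assoc)
  also have "(E - 1) + (E - Suc n - 1) = 2 ^ Suc (Suc n) - Suc (Suc n) - 1"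
    using E by (simp add: E_def)
  also have "((norm (\<Sum>x\<in>I. ee (f x)))\<^sup>2) ^ E = norm (\<Sum>x\<in>I. ee (f x)) ^ (2 ^ Suc (Suc n))"
    by (simp add: E_def power_mult[symmetric])
  finally show ?case .
qed

lemma weyl_differencing:
  fixes f :: "int \<Rightarrow> real"
  assumes "I \<subseteq> {1..int X}" "X > 0"
  shows "norm (\<Sum>x\<in>I. ee (f x)) ^ (2 ^ n)
    \<le> (3 * real X) ^ (2 ^ n - n - 1)
      * (\<Sum>hs\<in>boxed_lists X n. norm (\<Sum>x\<in>diff_dom hs I. ee (diffs hs f x)))"
proof (cases n)
  case (Suc m)
  have "Re (\<Sum>hs\<in>boxed_lists X n. \<Sum>x\<in>diff_dom hs I. ee (diffs hs f x))
      \<le> (\<Sum>hs\<in>boxed_lists X n. norm (\<Sum>x\<in>diff_dom hs I. ee (diffs hs f x)))"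
    by (rule order_trans[OF complex_Re_le_cmod norm_sum])
  then show ?thesis
    using weyl_differencing_Re[OF assms, of f m] unfolding Suc
    by (meson mult_left_mono order_trans zero_le_power mult_nonneg_nonneg of_nat_0_le_iff zero_le_numeral)
qed simp

lemma diff_polynomial_step:
  fixes c :: "nat \<Rightarrow> real" and h :: real
  shows "\<exists>c'. c' n = real (Suc n) * h * c (Suc n) \<and>
    (\<forall>x. (\<Sum>i\<le>Suc n. c i * (x + h) ^ i) - (\<Sum>i\<le>Suc n. c i * x ^ i) = (\<Sum>i\<le>n. c' i * x ^ i))"
proof -
  define c' where "c' m = (\<Sum>i\<in>{m<..Suc n}. c i * real (i choose m) * h ^ (i - m))" for m
  have "(\<Sum>i\<le>Suc n. c i * (x + h) ^ i) - (\<Sum>i\<le>Suc n. c i * x ^ i) = (\<Sum>i\<le>n. c' i * x ^ i)" for x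
  proof -
    have "(x + h) ^ i - x ^ i = (\<Sum>m<i. real (i choose m) * x ^ m * h ^ (i - m))" for i
      unfolding binomial_ring by (simp flip: lessThan_Suc_atMost)
    then have "(\<Sum>i\<le>Suc n. c i * (x + h) ^ i) - (\<Sum>i\<le>Suc n. c i * x ^ i)
        = (\<Sum>i\<le>Suc n. \<Sum>m<i. c i * (real (i choose m) * x ^ m * h ^ (i - m)))"
      by (simp add: sum_distrib_left del: sum.atMost_Suc flip: sum_subtractf right_diff_distrib)
    also have "\<dots> = (\<Sum>i\<in>{..Suc n}. \<Sum>m\<in>{m\<in>{..n}. m < i}. c i * (real (i choose m) * x ^ m * h ^ (i - m)))"
      by (intro sum.cong refl) auto
    also have "\<dots> = (\<Sum>m\<in>{..n}. \<Sum>i\<in>{i\<in>{..Suc n}. m < i}. c i * (real (i choose m) * x ^ m * h ^ (i - m)))"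
      by (rule sum.swap_restrict) auto
    also have "\<dots> = (\<Sum>m\<le>n. c' m * x ^ m)"
      unfolding c'_def sum_distrib_right by (intro sum.cong) auto
    finally show ?thesis .
  qed
  moreover have "c' n = real (Suc n) * h * c (Suc n)"
  proof -
    have "{n<..Suc n} = {Suc n}" by auto
    then show ?thesis by (simp add: c'_def)
  qed
  ultimately show ?thesis by blast
qed

text \<open>The quotient of factorials is the falling factorial produced by \<open>length hs\<close>
  steps, with its denominator moved to the left. The cases of interest are
  \<open>length hs = N\<close>, where a constant is left, and \<open>length hs = N - 1\<close>,
  where the phase becomes linear.\<close>

lemma diffs_polynomial:
  fixes c :: "nat \<Rightarrow> real"
  assumes "length hs \<le> N"
  shows "\<exists>c'. c' (N - length hs) * fact (N - length hs) = fact N * of_int (prod_list hs) * c N \<and>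
    (\<forall>x. diffs hs (\<lambda>x. \<Sum>i\<le>N. c i * of_int x ^ i) x = (\<Sum>i\<le>N - length hs. c' i * of_int x ^ i))"
  using assms
proof (induction hs arbitrary: c N)
  case Nil
  then show ?case by (intro exI[of _ c]) auto
next
  case (Cons h hs)
  then obtain n where N: "N = Suc n" by (cases N) auto
  obtain c1 where c1: "c1 n = real (Suc n) * of_int h * c (Suc n)"
    "\<And>x. (\<Sum>i\<le>Suc n. c i * (x + of_int h) ^ i) - (\<Sum>i\<le>Suc n. c i * x ^ i) = (\<Sum>i\<le>n. c1 i * x ^ i)"
    using diff_polynomial_step[where c = c and h = "of_int h" and n = n] by blast
  have "length hs \<le> n" using Cons.prems N by simp
  then obtain c' where c': "c' (n - length hs) * fact (n - length hs) = fact n * of_int (prod_list hs) * c1 n"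
    "\<And>x. diffs hs (\<lambda>x. \<Sum>i\<le>n. c1 i * of_int x ^ i) x = (\<Sum>i\<le>n - length hs. c' i * of_int x ^ i)"
    using Cons.IH by blast
  show ?case
  proof (intro exI[of _ c'] conjI allI)
    show "c' (N - length (h # hs)) * fact (N - length (h # hs)) = fact N * of_int (prod_list (h # hs)) * c N"
      using c'(1) by (simp add: N c1(1) algebra_simps)
    show "diffs (h # hs) (\<lambda>x. \<Sum>i\<le>N. c i * of_int x ^ i) x = (\<Sum>i\<le>N - length (h # hs). c' i * of_int x ^ i)" for x
      using c'(2)[of x] c1(2) by (simp add: N del: sum.atMost_Suc)
  qed
qed

section \<open>Counting shift vectors by the value of their product\<close>

lemma dvd_prod_list: "x \<in> set xs \<Longrightarrow> x dvd prod_list (xs :: int list)"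
  by (induction xs) auto

lemma abs_prod_list_le: "hs \<in> boxed_lists X n \<Longrightarrow> nat \<bar>prod_list hs\<bar> \<le> X ^ n"
proof (induction n arbitrary: hs)
  case (Suc n)
  then obtain h gs where h: "hs = h # gs" "nat \<bar>h\<bar> \<le> X" "gs \<in> boxed_lists X n"
    by (cases hs) (auto simp: boxed_lists_def)
  then have "nat \<bar>h\<bar> * nat \<bar>prod_list gs\<bar> \<le> X * X ^ n" using Suc.IH by (intro mult_le_mono) auto
  then show ?case using h by (simp add: abs_mult nat_mult_distrib)
qed simp

lemma minsum_term_of_nat_abs:
  "minsum_term Y (of_nat a * of_int z * \<beta>) = minsum_term Y (of_nat (a * nat \<bar>z\<bar>) * \<beta>)"
proof -
  have "of_nat a * of_int z * \<beta> = of_nat (a * nat \<bar>z\<bar>) * \<beta> \<or> of_nat a * of_int z * \<beta> = - (of_nat (a * nat \<bar>z\<bar>) * \<beta>)"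
    by (cases "z \<ge> 0") simp_all
  then show ?thesis by (auto simp: minsum_term_def)
qed

text \<open>A nonzero product is divisible by \<open>m\<close> and by every entry, so few tuples
  share the same value \<open>v\<close>. This lets a sum over tuples of shifts be replaced by a sum
  over single multiples, at the cost of a divisor bound.\<close>

lemma card_box_triples_with_product:
  assumes "v > 0"
  shows "card {(m, hs, gs) \<in> {1..M} \<times> boxed_lists X j \<times> boxed_lists Y n.
      c * m * nat \<bar>prod_list hs * prod_list gs\<bar> = v}
    \<le> divisor_count v * (2 * divisor_count v) ^ j * (2 * divisor_count v) ^ n"
proof -
  define A where "A = {m. m dvd v}"
  define B where "B = {hs \<in> boxed_lists X j. \<forall>h\<in>set hs. h dvd int v}"
  define C where "C = {gs \<in> boxed_lists Y n. \<forall>h\<in>set gs. h dvd int v}"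
  have "{(m, hs, gs) \<in> {1..M} \<times> boxed_lists X j \<times> boxed_lists Y n.
      c * m * nat \<bar>prod_list hs * prod_list gs\<bar> = v} \<subseteq> A \<times> B \<times> C"
  proof clarsimp
    fix m hs gs
    assume a: "hs \<in> boxed_lists X j" "gs \<in> boxed_lists Y n" "v = c * m * nat \<bar>prod_list hs * prod_list gs\<bar>"
    have iv: "int v = int c * int m * \<bar>prod_list hs * prod_list gs\<bar>" using a(3) by simp
    have "prod_list hs dvd \<bar>prod_list hs * prod_list gs\<bar>" "prod_list gs dvd \<bar>prod_list hs * prod_list gs\<bar>" by simp_all
    then have "prod_list hs dvd int v" "prod_list gs dvd int v" unfolding iv by (meson dvd_mult)+
    then show "m \<in> A \<and> hs \<in> B \<and> gs \<in> C"
      using a dvd_prod_list dvd_trans unfolding A_def B_def C_def by (auto simp: mult.assoc)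
  qed
  then have "card {(m, hs, gs) \<in> {1..M} \<times> boxed_lists X j \<times> boxed_lists Y n.
      c * m * nat \<bar>prod_list hs * prod_list gs\<bar> = v} \<le> card (A \<times> B \<times> C)"
    using assms by (intro card_mono) (auto simp: A_def B_def C_def)
  also have "\<dots> = divisor_count v * (card B * card C)"
    by (simp add: card_cartesian_product A_def divisor_count_def)
  also have "\<dots> \<le> divisor_count v * ((2 * divisor_count v) ^ j * (2 * divisor_count v) ^ n)"
    unfolding B_def C_def by (intro mult_le_mono card_boxed_lists_dvd assms order_refl)
  finally show ?thesis by (simp only: mult.assoc)
qed

text \<open>A zero entry in \<open>hs\<close> saves \<open>2 * X + 1\<close> and one in
  \<open>gs\<close> saves \<open>2 * Y + 1\<close>; by \<open>Y \<le> X\<close> the smaller saving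
  is available in both cases.\<close>

lemma card_box_pairs_zero:
  assumes YX: "Y \<le> X"
  shows "card {(hs, gs) \<in> boxed_lists X j \<times> boxed_lists Y n. prod_list hs * prod_list gs = 0} * (2 * Y + 1)
    \<le> (j + n) * ((2 * X + 1) ^ j * (2 * Y + 1) ^ n)"
proof -
  define B where "B = boxed_lists X j"
  define C where "C = boxed_lists Y n"
  define B0 where "B0 = {hs \<in> B. 0 \<in> set hs}"
  define C0 where "C0 = {gs \<in> C. 0 \<in> set gs}"
  have fin: "finite B" "finite C" "finite B0" "finite C0" by (simp_all add: B_def C_def B0_def C0_def)
  have "{(hs, gs) \<in> B \<times> C. prod_list hs * prod_list gs = 0} \<subseteq> (B0 \<times> C) \<union> (B \<times> C0)"
    by (auto simp: B0_def C0_def prod_list_zero_iff)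
  then have "card {(hs, gs) \<in> B \<times> C. prod_list hs * prod_list gs = 0} \<le> card ((B0 \<times> C) \<union> (B \<times> C0))"
    using fin by (intro card_mono) auto
  also have "\<dots> \<le> card (B0 \<times> C) + card (B \<times> C0)" by (rule card_Un_le)
  also have "\<dots> = card B0 * (2 * Y + 1) ^ n + (2 * X + 1) ^ j * card C0"
    by (simp only: card_cartesian_product) (simp only: B_def C_def card_boxed_lists)
  finally have "card {(hs, gs) \<in> B \<times> C. prod_list hs * prod_list gs = 0} * (2 * Y + 1)
      \<le> (card B0 * (2 * Y + 1) ^ n + (2 * X + 1) ^ j * card C0) * (2 * Y + 1)"
    by (rule mult_right_mono) simp
  also have "\<dots> = (card B0 * (2 * Y + 1)) * (2 * Y + 1) ^ n + (2 * X + 1) ^ j * (card C0 * (2 * Y + 1))"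
    by (simp add: algebra_simps)
  also have "\<dots> \<le> (j * (2 * X + 1) ^ j) * (2 * Y + 1) ^ n + (2 * X + 1) ^ j * (n * (2 * Y + 1) ^ n)"
  proof (intro add_mono mult_right_mono mult_left_mono)
    have "card B0 * (2 * Y + 1) \<le> card B0 * (2 * X + 1)" using YX by simp
    also have "\<dots> \<le> j * (2 * X + 1) ^ j" unfolding B0_def B_def by (rule card_boxed_lists_zero)
    finally show "card B0 * (2 * Y + 1) \<le> j * (2 * X + 1) ^ j" .
    show "card C0 * (2 * Y + 1) \<le> n * (2 * Y + 1) ^ n"
      unfolding C0_def C_def by (rule card_boxed_lists_zero)
  qed auto
  also have "\<dots> = (j + n) * ((2 * X + 1) ^ j * (2 * Y + 1) ^ n)" by (simp add: algebra_simps)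
  finally show ?thesis by (simp add: B_def C_def)
qed

text \<open>What remains of a Weyl sum after \<open>j\<close> differences with shifts
  \<open>hs\<close>, which enter the sums over both variables, and \<open>n\<close> more with shifts
  \<open>gs\<close> in one variable. The factor \<open>c\<close> holds factorials and
  \<open>m\<close> is the frequency. Up to constants the trivial size is
  \<open>M * X ^ j * Y ^ (n + 1)\<close>, the yardstick for all savings below.\<close>

definition box_minsum :: "nat \<Rightarrow> nat \<Rightarrow> nat \<Rightarrow> nat \<Rightarrow> nat \<Rightarrow> nat \<Rightarrow> real \<Rightarrow> real" where
  "box_minsum c M X j Y n \<beta> = (\<Sum>m=1..M. \<Sum>hs\<in>boxed_lists X j. \<Sum>gs\<in>boxed_lists Y n.
     minsum_term (real Y) (of_nat (c * m) * of_int (prod_list hs * prod_list gs) * \<beta>))"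

text \<open>Tuples with product 0 get the trivial bound \<open>Y\<close> but are rarer by a factor
  of order \<open>Y\<close>. The others are grouped by the value \<open>v\<close> of
  \<open>\<kappa>\<close>, with multiplicity at most \<open>D\<close>.\<close>

lemma box_minsum_le:
  fixes \<beta> D :: real
  assumes pos: "c > 0" "Y > 0" and YX: "Y \<le> X"
    and D: "\<And>v. v \<ge> 1 \<Longrightarrow> v \<le> c * M * X ^ j * Y ^ n \<Longrightarrow>
        real (divisor_count v * (2 * divisor_count v) ^ j * (2 * divisor_count v) ^ n) \<le> D"
  shows "box_minsum c M X j Y n \<beta> \<le> (real (j + n) * 3 ^ (j + n)) * (real M * real X ^ j * real Y ^ n)
      + D * (\<Sum>v=1..c * M * X ^ j * Y ^ n. minsum_term (real Y) (of_nat v * \<beta>))"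
proof -
  define N where "N = c * M * X ^ j * Y ^ n"
  define P where "P = {1..M} \<times> boxed_lists X j \<times> boxed_lists Y n"
  define \<kappa> where "\<kappa> = (\<lambda>(m, hs, gs). c * m * nat \<bar>prod_list hs * prod_list gs\<bar>)"
  define F where "F v = minsum_term (real Y) (of_nat v * \<beta>)" for v :: nat
  have finP: "finite P" by (simp add: P_def)
  have F0: "F v \<ge> 0" for v using minsum_term_pos[of "real Y"] pos by (simp add: F_def less_imp_le)
  have "box_minsum c M X j Y n \<beta> = (\<Sum>p\<in>P. F (\<kappa> p))"
    unfolding box_minsum_def P_def F_def \<kappa>_def minsum_term_of_nat_abs
    by (simp add: sum.cartesian_product case_prod_unfold)
  also have "\<dots> = (\<Sum>p\<in>{p\<in>P. \<kappa> p = 0}. F (\<kappa> p)) + (\<Sum>p\<in>{p\<in>P. \<kappa> p \<noteq> 0}. F (\<kappa> p))"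
    using finP by (subst sum.union_disjoint[symmetric]) (auto intro!: sum.cong)
  also have "(\<Sum>p\<in>{p\<in>P. \<kappa> p = 0}. F (\<kappa> p)) \<le> (real (j + n) * 3 ^ (j + n)) * (real M * real X ^ j * real Y ^ n)"
  proof -
    define Z where "Z = {(hs, gs) \<in> boxed_lists X j \<times> boxed_lists Y n. prod_list hs * prod_list gs = 0}"
    have finZ: "finite Z" unfolding Z_def by (rule finite_subset[of _ "boxed_lists X j \<times> boxed_lists Y n"]) auto
    have "(\<Sum>p\<in>{p\<in>P. \<kappa> p = 0}. F (\<kappa> p)) \<le> of_nat (card {p\<in>P. \<kappa> p = 0}) * real Y"
      by (rule sum_bounded_above) (use pos in \<open>simp add: F_def minsum_term_le\<close>)
    also have "card {p\<in>P. \<kappa> p = 0} \<le> card ({1..M} \<times> Z)"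
      using pos finZ by (intro card_mono) (auto simp: P_def Z_def \<kappa>_def)
    also have "card ({1..M} \<times> Z) = M * card Z" by (simp add: card_cartesian_product)
    also have "real (M * card Z) * real Y \<le> real M * (real (card Z) * real (2 * Y + 1))"
      by (simp add: mult.assoc mult_left_mono)
    also have "\<dots> \<le> real M * (real (j + n) * ((3 * real X) ^ j * (3 * real Y) ^ n))"
    proof (rule mult_left_mono)
      have "real (card Z) * real (2 * Y + 1) \<le> real ((j + n) * ((2 * X + 1) ^ j * (2 * Y + 1) ^ n))"
        using card_box_pairs_zero[OF YX, of j n] unfolding Z_def of_nat_mult[symmetric] of_nat_le_iff .
      also have "\<dots> \<le> real (j + n) * ((3 * real X) ^ j * (3 * real Y) ^ n)"
        using pos YX unfolding of_nat_mult of_nat_power by (intro mult_left_mono mult_mono power_mono) auto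
      finally show "real (card Z) * real (2 * Y + 1) \<le> real (j + n) * ((3 * real X) ^ j * (3 * real Y) ^ n)" .
    qed simp
    also have "\<dots> = (real (j + n) * 3 ^ (j + n)) * (real M * real X ^ j * real Y ^ n)"
      by (simp add: power_mult_distrib power_add mult_ac)
    finally show ?thesis by (simp add: mult_right_mono)
  qed
  also have "(\<Sum>p\<in>{p\<in>P. \<kappa> p \<noteq> 0}. F (\<kappa> p)) \<le> D * (\<Sum>v=1..N. F v)"
  proof -
    have img: "\<kappa> ` {p\<in>P. \<kappa> p \<noteq> 0} \<subseteq> {1..N}"
    proof clarify
      fix m hs gs assume a: "(m, hs, gs) \<in> P" "0 < \<kappa> (m, hs, gs)"
      have "nat \<bar>prod_list hs * prod_list gs\<bar> = nat \<bar>prod_list hs\<bar> * nat \<bar>prod_list gs\<bar>"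
        by (simp add: abs_mult nat_mult_distrib)
      also have "\<dots> \<le> X ^ j * Y ^ n" using a by (intro mult_le_mono abs_prod_list_le) (auto simp: P_def)
      finally have "c * m * nat \<bar>prod_list hs * prod_list gs\<bar> \<le> c * M * (X ^ j * Y ^ n)"
        using a by (intro mult_le_mono) (auto simp: P_def)
      then have "\<kappa> (m, hs, gs) \<le> N" by (simp add: \<kappa>_def N_def mult.assoc)
      then show "\<kappa> (m, hs, gs) \<in> {1..N}" using a(2) by simp
    qed
    have "(\<Sum>p\<in>{p\<in>P. \<kappa> p \<noteq> 0}. F (\<kappa> p)) = (\<Sum>v\<in>{1..N}. \<Sum>p\<in>{p. p \<in> {p\<in>P. \<kappa> p \<noteq> 0} \<and> \<kappa> p = v}. F (\<kappa> p))"
      using finP img by (intro sum.group[symmetric]) auto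
    also have "\<dots> \<le> (\<Sum>v\<in>{1..N}. D * F v)"
    proof (rule sum_mono)
      fix v assume v: "v \<in> {1..N}"
      have "(\<Sum>p\<in>{p. p \<in> {p\<in>P. \<kappa> p \<noteq> 0} \<and> \<kappa> p = v}. F (\<kappa> p)) = (\<Sum>p\<in>{p\<in>P. \<kappa> p = v}. F v)"
        using v by (intro sum.cong) auto
      also have "\<dots> = real (card {p\<in>P. \<kappa> p = v}) * F v" by simp
      also have "{p\<in>P. \<kappa> p = v} = {(m, hs, gs) \<in> {1..M} \<times> boxed_lists X j \<times> boxed_lists Y n.
          c * m * nat \<bar>prod_list hs * prod_list gs\<bar> = v}"
        by (auto simp: P_def \<kappa>_def)
      also have "real (card \<dots>) * F v \<le> D * F v"
      proof (rule mult_right_mono[OF _ F0])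
        show "real (card {(m, hs, gs) \<in> {1..M} \<times> boxed_lists X j \<times> boxed_lists Y n.
            c * m * nat \<bar>prod_list hs * prod_list gs\<bar> = v}) \<le> D"
          using of_nat_mono[OF card_box_triples_with_product[of v M X j Y n c], where ?'a = real] D[of v] v
          unfolding N_def by simp
      qed
      finally show "(\<Sum>p\<in>{p. p \<in> {p\<in>P. \<kappa> p \<noteq> 0} \<and> \<kappa> p = v}. F (\<kappa> p)) \<le> D * F v" .
    qed
    finally show ?thesis by (simp add: sum_distrib_left)
  qed
  finally show ?thesis by (simp add: F_def N_def)
qed

text \<open>\<open>V\<close> is a saving that the box sum does not exceed, and \<open>E\<close>
  gathers all losses: divisor multiplicities, the logarithm and factorials. The second bound on
  \<open>E\<close> lets the tuples with product 0 take at most half of the lower bound.\<close>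

lemma rational_approx_of_large_box_minsum:
  fixes \<beta> D V E L :: real
  assumes pos: "c > 0" "Y > 0" "M > 0" "n > 0" and YX: "Y \<le> X"
    and D: "\<And>v. v \<ge> 1 \<Longrightarrow> v \<le> c * M * X ^ j * Y ^ n \<Longrightarrow>
        real (divisor_count v * (2 * divisor_count v) ^ j * (2 * divisor_count v) ^ n) \<le> D" "D \<ge> 1"
    and L: "L \<ge> 1" "harm (c * M * X ^ j * Y ^ n * Y) \<le> L"
    and E: "E \<ge> 128 * D * real c * L" "E \<ge> 2 * (real (j + n) * 3 ^ (j + n))"
    and V: "V \<ge> 1" "V * E \<le> real Y"
    and large: "box_minsum c M X j Y n \<beta> \<ge> real M * real X ^ j * real Y ^ Suc n / V"
  shows "\<exists>r::nat. r \<ge> 1 \<and> real r \<le> V * E \<and> nint (real r * \<beta>) \<le> V * E / (real M * real X ^ j * real Y ^ Suc n)"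
proof -
  define N where "N = c * M * X ^ j * Y ^ n"
  define Q where "Q = real M * real X ^ j * real Y ^ n"
  define T where "T = (\<Sum>v=1..N. minsum_term (real Y) (of_nat v * \<beta>))"
  \<comment> \<open>The factor 2 is for the tuples with product 0, \<open>D\<close> for
    multiplicities, and \<open>c\<close> because the multiples of \<open>\<beta>\<close> run up to
    \<open>N = c * Q\<close>.\<close>
  define V' where "V' = 2 * D * real c * V"
  have X: "X > 0" using pos YX by simp
  have Q: "Q > 0" using pos X by (simp add: Q_def)
  have NQ: "real N = real c * Q" by (simp add: N_def Q_def)
  have Vp: "V > 0" using V by simp
  have "box_minsum c M X j Y n \<beta> \<le> (real (j + n) * 3 ^ (j + n)) * Q + D * T"
    unfolding Q_def T_def N_def by (rule box_minsum_le[OF pos(1,2) YX D(1)])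
  moreover have "real M * real X ^ j * real Y ^ Suc n = Q * real Y" by (simp add: Q_def)
  ultimately have "Q * real Y / V \<le> (real (j + n) * 3 ^ (j + n)) * Q + D * T"
    using large by (simp only: order_trans)
  moreover have "(real (j + n) * 3 ^ (j + n)) * Q \<le> Q * real Y / V / 2"
  proof -
    have "2 * (real (j + n) * 3 ^ (j + n)) * V \<le> E * V" using E(2) Vp by (intro mult_right_mono) auto
    also have "\<dots> \<le> real Y" using V(2) by (simp only: mult.commute)
    finally have "2 * (real (j + n) * 3 ^ (j + n)) * V \<le> real Y" .
    then have "Q * (2 * (real (j + n) * 3 ^ (j + n)) * V) \<le> Q * real Y" using Q by (intro mult_left_mono) auto
    then show ?thesis using Vp by (simp add: field_simps)
  qed
  ultimately have "Q * real Y / V / 2 \<le> D * T" by linarith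
  then have "real N * real Y / V' \<le> T"
    using D(2) pos Vp by (simp add: NQ V'_def field_simps)
  have c1: "real c \<ge> 1" using pos by simp
  have "1 * 1 \<le> D * real c" using D(2) c1 by (intro mult_mono) auto
  then have V'1: "V' \<ge> 1" using V(1) mult_mono[of 1 "D * real c" 1 V] by (simp add: V'_def)
  have VE: "64 * V' * L \<le> V * E"
  proof -
    have "64 * V' * L = V * (128 * D * real c * L)" by (simp add: V'_def)
    also have "\<dots> \<le> V * E" using E Vp by (intro mult_left_mono) auto
    finally show ?thesis .
  qed
  have YN: "Y \<le> N"
  proof -
    have "Y ^ 1 \<le> Y ^ n" using pos by (intro power_increasing) auto
    moreover have "c * M * X ^ j \<ge> 1" using pos X by simp
    ultimately have "1 * Y \<le> (c * M * X ^ j) * Y ^ n" by (intro mult_le_mono) auto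
    then show ?thesis by (simp add: N_def)
  qed
  have "\<exists>r::nat. r \<ge> 1 \<and> real r \<le> 64 * V' * L \<and> nint (real r * \<beta>) \<le> 64 * V' * L / (real N * real Y)"
    using \<open>real N * real Y / V' \<le> T\<close> YN V'1 L VE V pos
    by (intro rational_approx_of_large_minsum) (auto simp: T_def N_def mult_ac)
  then obtain r :: nat where r: "r \<ge> 1" "real r \<le> 64 * V' * L" "nint (real r * \<beta>) \<le> 64 * V' * L / (real N * real Y)"
    by blast
  have "64 * V' * L / (real N * real Y) \<le> V * E / (Q * real Y)"
  proof (rule frac_le)
    show "Q * real Y \<le> real N * real Y" using c1 Q unfolding NQ by (intro mult_right_mono) auto
    have "0 \<le> 64 * V' * L" using V'1 L by simp
    then show "0 \<le> V * E" using VE by linarith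
  qed (use VE Q pos in auto)
  then show ?thesis using r VE by (intro exI[of _ r]) (auto simp: Q_def mult_ac)
qed

section \<open>Separation of the variables in the differenced double sum\<close>

lemma diffs_leading_term:
  fixes b :: "nat \<Rightarrow> real"
  shows "diffs hs (\<lambda>x. a * of_int x ^ k + (\<Sum>i\<le>length hs. b i * of_int x ^ i)) x
    = diffs hs (\<lambda>x. a * of_int x ^ k) x + fact (length hs) * of_int (prod_list hs) * b (length hs)"
proof -
  obtain c' where c': "c' (length hs - length hs) * fact (length hs - length hs) = fact (length hs) * of_int (prod_list hs) * b (length hs)"
    "\<And>x. diffs hs (\<lambda>x. \<Sum>i\<le>length hs. b i * of_int x ^ i) x = (\<Sum>i\<le>length hs - length hs. c' i * of_int x ^ i)"
    using diffs_polynomial[of hs "length hs" b] by auto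
  then show ?thesis unfolding diffs_add by simp
qed

lemma diffs_monomial_linear:
  fixes a :: real
  assumes "Suc (length hs) = k"
  shows "\<exists>d. \<forall>x. diffs hs (\<lambda>x. a * of_int x ^ k) x = of_int x * (fact k * of_int (prod_list hs) * a) + d"
proof -
  define c :: "nat \<Rightarrow> real" where "c = (\<lambda>i. if i = k then a else 0)"
  have c: "(\<Sum>i\<le>k. c i * of_int x ^ i) = a * of_int x ^ k" for x :: int
    by (simp add: c_def if_distrib[of "\<lambda>t. t * _"] sum.delta cong: if_cong)
  have kl: "k - length hs = 1" "length hs \<le> k" using assms by auto
  obtain c' where c': "c' 1 * fact 1 = fact k * of_int (prod_list hs) * c k"
    "\<And>x. diffs hs (\<lambda>x. \<Sum>i\<le>k. c i * of_int x ^ i) x = (\<Sum>i\<le>1. c' i * of_int x ^ i)"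
    using diffs_polynomial[of hs k c] kl by auto
  have "diffs hs (\<lambda>x. a * of_int x ^ k) x = of_int x * (fact k * of_int (prod_list hs) * a) + c' 0" for x
    using c'(1) c'(2)[of x] unfolding c by (simp add: c_def)
  then show ?thesis by blast
qed

text \<open>Differencing in \<open>x\<close> leaves only the two top terms, and these are in separate variables.\<close>

lemma norm_double_sum_differenced:
  fixes a :: real and b :: "nat \<Rightarrow> real"
  assumes "X > 0" "Y > 0"
  shows "norm (\<Sum>x\<in>{1..int X}. \<Sum>y\<in>{1..int Y}. ee (a * of_int x ^ k + (\<Sum>i\<le>j. b i * of_int x ^ i * of_int y ^ (k - i)))) ^ (2 ^ j)
    \<le> real Y ^ (2 ^ j - 1) * (3 * real X) ^ (2 ^ j - j - 1) *
      (\<Sum>hs\<in>boxed_lists X j. norm (\<Sum>x\<in>diff_dom hs {1..int X}. ee (diffs hs (\<lambda>x. a * of_int x ^ k) x))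
        * norm (\<Sum>y\<in>{1..int Y}. ee (fact j * of_int (prod_list hs) * b j * of_int y ^ (k - j))))"
proof -
  define f where "f y x = a * of_int x ^ k + (\<Sum>i\<le>j. b i * of_int x ^ i * of_int y ^ (k - i))" for x y :: int
  define I where "I = {1..int X}"
  define T where "T hs = (\<Sum>x\<in>diff_dom hs I. ee (diffs hs (\<lambda>x. a * of_int x ^ k) x))" for hs
  define U where "U hs = (\<Sum>y\<in>{1..int Y}. ee (fact j * of_int (prod_list hs) * b j * of_int y ^ (k - j)))" for hs
  define W where "W = (\<Sum>hs\<in>boxed_lists X j. norm (T hs) * norm (U hs))"
  have df: "diffs hs (f y) x = diffs hs (\<lambda>x. a * of_int x ^ k) x + fact j * of_int (prod_list hs) * b j * of_int y ^ (k - j)"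
    if "hs \<in> boxed_lists X j" for hs x y
  proof -
    have len: "length hs = j" using that by (simp add: boxed_lists_def)
    have "f y = (\<lambda>x. a * of_int x ^ k + (\<Sum>i\<le>length hs. (b i * of_int y ^ (k - i)) * of_int x ^ i))"
      unfolding f_def len by (simp add: mult_ac)
    then show ?thesis
      using diffs_leading_term[of hs a k "\<lambda>i. b i * of_int y ^ (k - i)" x] by (simp add: len mult.assoc)
  qed
  have inner: "(\<Sum>y\<in>{1..int Y}. \<Sum>hs\<in>boxed_lists X j. \<Sum>x\<in>diff_dom hs I. ee (diffs hs (f y) x))
      = (\<Sum>hs\<in>boxed_lists X j. T hs * U hs)"
  proof -
    have "(\<Sum>y\<in>{1..int Y}. \<Sum>hs\<in>boxed_lists X j. \<Sum>x\<in>diff_dom hs I. ee (diffs hs (f y) x))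
        = (\<Sum>hs\<in>boxed_lists X j. \<Sum>y\<in>{1..int Y}. \<Sum>x\<in>diff_dom hs I. ee (diffs hs (f y) x))"
      by (rule sum.swap)
    also have "\<dots> = (\<Sum>hs\<in>boxed_lists X j. T hs * U hs)"
    proof (rule sum.cong[OF refl])
      fix hs assume hs: "hs \<in> boxed_lists X j"
      show "(\<Sum>y\<in>{1..int Y}. \<Sum>x\<in>diff_dom hs I. ee (diffs hs (f y) x)) = T hs * U hs"
        unfolding T_def U_def sum_product df[OF hs] ee_add by (rule sum.swap)
    qed
    finally show ?thesis .
  qed
  have normW: "norm (\<Sum>hs\<in>boxed_lists X j. T hs * U hs) \<le> W"
    unfolding W_def by (rule order_trans[OF norm_sum]) (simp add: norm_mult)
  have swap: "(\<Sum>x\<in>I. \<Sum>y\<in>{1..int Y}. ee (f y x)) = (\<Sum>y\<in>{1..int Y}. \<Sum>x\<in>I. ee (f y x))"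
    by (rule sum.swap)
  have "norm (\<Sum>x\<in>I. \<Sum>y\<in>{1..int Y}. ee (f y x)) ^ (2 ^ j)
      \<le> real Y ^ (2 ^ j - 1) * (3 * real X) ^ (2 ^ j - j - 1) * W"
  proof (cases j)
    \<comment> \<open>Without differencing the double sum is already a product.\<close>
    case 0
    have "(\<Sum>x\<in>I. \<Sum>y\<in>{1..int Y}. ee (f y x)) = (\<Sum>hs\<in>boxed_lists X j. T hs * U hs)"
      using inner unfolding swap by (simp add: 0)
    then show ?thesis using normW 0 by simp
  next
    case (Suc n)
    have "norm (\<Sum>x\<in>I. \<Sum>y\<in>{1..int Y}. ee (f y x)) ^ (2 ^ j) \<le> (\<Sum>y\<in>{1..int Y}. norm (\<Sum>x\<in>I. ee (f y x))) ^ (2 ^ j)"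
      unfolding swap by (rule power_mono[OF norm_sum]) simp
    also have "\<dots> \<le> real Y ^ (2 ^ j - 1) * (\<Sum>y\<in>{1..int Y}. norm (\<Sum>x\<in>I. ee (f y x)) ^ (2 ^ j))"
      using sum_pow_two_power_le[of "{1..int Y}" "\<lambda>y. norm (\<Sum>x\<in>I. ee (f y x))" j] by simp
    also have "\<dots> \<le> real Y ^ (2 ^ j - 1) * (\<Sum>y\<in>{1..int Y}. (3 * real X) ^ (2 ^ j - j - 1)
        * Re (\<Sum>hs\<in>boxed_lists X j. \<Sum>x\<in>diff_dom hs I. ee (diffs hs (f y) x)))"
      unfolding Suc by (intro mult_left_mono sum_mono weyl_differencing_Re) (use assms in \<open>auto simp: I_def\<close>)
    \<comment> \<open>The sum over \<open>y\<close> moves inside the real part. Only then does each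
      summand factor as \<open>T hs * U hs\<close>, and absolute values are taken
      afterwards.\<close>
    also have "\<dots> = real Y ^ (2 ^ j - 1) * (3 * real X) ^ (2 ^ j - j - 1)
        * Re (\<Sum>y\<in>{1..int Y}. \<Sum>hs\<in>boxed_lists X j. \<Sum>x\<in>diff_dom hs I. ee (diffs hs (f y) x))"
      by (simp add: sum_distrib_left[symmetric] Re_sum mult.assoc)
    also have "\<dots> \<le> real Y ^ (2 ^ j - 1) * (3 * real X) ^ (2 ^ j - j - 1) * W"
      unfolding inner using normW by (intro mult_left_mono order_trans[OF complex_Re_le_cmod normW]) auto
    finally show ?thesis .
  qed
  then show ?thesis unfolding f_def I_def W_def T_def U_def .
qed

text \<open>The phase left by the first \<open>j\<close> differences still has degree
  \<open>l\<close> in \<open>x\<close>, and \<open>l - 1\<close> further ones make it linear.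
  Together these are \<open>k - 1\<close> differences of a monomial of degree \<open>k\<close>,
  hence the factor \<open>fact k\<close> in the slope.\<close>

lemma sum_norm_power_x_le:
  fixes \<alpha> :: real
  assumes "X > 0" and k: "k = j + l" and l: "l \<ge> 1"
  shows "(\<Sum>m=1..M. \<Sum>hs\<in>boxed_lists X j. norm (\<Sum>x\<in>diff_dom hs {1..int X}. ee (diffs hs (\<lambda>x. (of_nat m * \<alpha>) * of_int x ^ k) x)) ^ (2 ^ (l - 1)))
    \<le> (3 * real X) ^ (2 ^ (l - 1) - l) * box_minsum (fact k) M X j X (l - 1) \<alpha>"
proof -
  define f where "f m = (\<lambda>x. (of_nat m * \<alpha>) * of_int x ^ k)" for m :: nat
  have "norm (\<Sum>x\<in>diff_dom hs {1..int X}. ee (diffs hs (f m) x)) ^ (2 ^ (l - 1))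
      \<le> (3 * real X) ^ (2 ^ (l - 1) - l) * (\<Sum>gs\<in>boxed_lists X (l - 1).
          minsum_term (real X) (of_nat (fact k * m) * of_int (prod_list hs * prod_list gs) * \<alpha>))"
    if hs: "hs \<in> boxed_lists X j" for m hs
  proof -
    have "norm (\<Sum>x\<in>diff_dom hs {1..int X}. ee (diffs hs (f m) x)) ^ (2 ^ (l - 1))
      \<le> (3 * real X) ^ (2 ^ (l - 1) - (l - 1) - 1) * (\<Sum>gs\<in>boxed_lists X (l - 1).
          norm (\<Sum>x\<in>diff_dom gs (diff_dom hs {1..int X}). ee (diffs gs (diffs hs (f m)) x)))"
      by (rule weyl_differencing) (use assms diff_dom_subset in auto)
    also have "2 ^ (l - 1) - (l - 1) - 1 = 2 ^ (l - 1) - l" using l by simp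
    also have "(3 * real X) ^ (2 ^ (l - 1) - l) * (\<Sum>gs\<in>boxed_lists X (l - 1).
          norm (\<Sum>x\<in>diff_dom gs (diff_dom hs {1..int X}). ee (diffs gs (diffs hs (f m)) x)))
      \<le> (3 * real X) ^ (2 ^ (l - 1) - l) * (\<Sum>gs\<in>boxed_lists X (l - 1).
          minsum_term (real X) (of_nat (fact k * m) * of_int (prod_list hs * prod_list gs) * \<alpha>))"
    proof (intro mult_left_mono sum_mono)
      fix gs assume gs: "gs \<in> boxed_lists X (l - 1)"
      have len: "Suc (length (hs @ gs)) = k" using hs gs k l by (simp add: boxed_lists_def)
      obtain d where d: "\<And>x. diffs (hs @ gs) (f m) x = of_int x * (fact k * of_int (prod_list (hs @ gs)) * (of_nat m * \<alpha>)) + d"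
        using diffs_monomial_linear[OF len, of "of_nat m * \<alpha>"] unfolding f_def by blast
      obtain u v where uv: "diff_dom (hs @ gs) {1..int X} = {u..v}" using diff_dom_interval by blast
      then have sub: "{u..v} \<subseteq> {1..int X}" using diff_dom_subset by metis
      have "norm (\<Sum>x\<in>{u..v}. ee (of_int x * (fact k * of_int (prod_list (hs @ gs)) * (of_nat m * \<alpha>)) + d))
          \<le> minsum_term (real X) (fact k * of_int (prod_list (hs @ gs)) * (of_nat m * \<alpha>))"
        using sub assms by (intro norm_linear_sum_le) auto
      moreover have eq: "fact k * of_int (prod_list (hs @ gs)) * (of_nat m * \<alpha>) = of_nat (fact k * m) * of_int (prod_list hs * prod_list gs) * \<alpha>"
        by (simp add: mult_ac)
      ultimately show "norm (\<Sum>x\<in>diff_dom gs (diff_dom hs {1..int X}). ee (diffs gs (diffs hs (f m)) x))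
          \<le> minsum_term (real X) (of_nat (fact k * m) * of_int (prod_list hs * prod_list gs) * \<alpha>)"
        unfolding diffs_append[symmetric] diff_dom_append[symmetric] uv d eq by simp
    qed auto
    finally show ?thesis .
  qed
  then have "(\<Sum>m=1..M. \<Sum>hs\<in>boxed_lists X j. norm (\<Sum>x\<in>diff_dom hs {1..int X}. ee (diffs hs (f m) x)) ^ (2 ^ (l - 1)))
    \<le> (\<Sum>m=1..M. \<Sum>hs\<in>boxed_lists X j. (3 * real X) ^ (2 ^ (l - 1) - l) * (\<Sum>gs\<in>boxed_lists X (l - 1).
          minsum_term (real X) (of_nat (fact k * m) * of_int (prod_list hs * prod_list gs) * \<alpha>)))"
    by (intro sum_mono)
  then show ?thesis by (simp add: f_def box_minsum_def sum_distrib_left)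
qed

text \<open>Nothing has been differenced in \<open>y\<close> yet, but its coefficient already
  carries \<open>fact j * prod_list hs\<close> from the differences in \<open>x\<close>. This is why
  both box sums share the shifts \<open>hs\<close> bounded by \<open>X\<close>.\<close>

lemma sum_norm_power_y_le:
  fixes \<beta> :: real
  assumes "Y > 0" and l: "l \<ge> 1"
  shows "(\<Sum>m=1..M. \<Sum>hs\<in>boxed_lists X j. norm (\<Sum>y\<in>{1..int Y}. ee (fact j * of_int (prod_list hs) * (of_nat m * \<beta>) * of_int y ^ l)) ^ (2 ^ (l - 1)))
    \<le> (3 * real Y) ^ (2 ^ (l - 1) - l) * box_minsum (fact j * fact l) M X j Y (l - 1) \<beta>"
proof -
  have "norm (\<Sum>y\<in>{1..int Y}. ee (fact j * of_int (prod_list hs) * (of_nat m * \<beta>) * of_int y ^ l)) ^ (2 ^ (l - 1))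
      \<le> (3 * real Y) ^ (2 ^ (l - 1) - l) * (\<Sum>gs\<in>boxed_lists Y (l - 1).
          minsum_term (real Y) (of_nat (fact j * fact l * m) * of_int (prod_list hs * prod_list gs) * \<beta>))"
    for m hs
  proof -
    define a where "a = fact j * of_int (prod_list hs) * (of_nat m * \<beta>)"
    have "norm (\<Sum>y\<in>{1..int Y}. ee (a * of_int y ^ l)) ^ (2 ^ (l - 1))
      \<le> (3 * real Y) ^ (2 ^ (l - 1) - (l - 1) - 1) * (\<Sum>gs\<in>boxed_lists Y (l - 1).
          norm (\<Sum>y\<in>diff_dom gs {1..int Y}. ee (diffs gs (\<lambda>y. a * of_int y ^ l) y)))"
      by (rule weyl_differencing) (use assms in auto)
    also have "2 ^ (l - 1) - (l - 1) - 1 = 2 ^ (l - 1) - l" using l by simp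
    also have "(3 * real Y) ^ (2 ^ (l - 1) - l) * (\<Sum>gs\<in>boxed_lists Y (l - 1).
          norm (\<Sum>y\<in>diff_dom gs {1..int Y}. ee (diffs gs (\<lambda>y. a * of_int y ^ l) y)))
      \<le> (3 * real Y) ^ (2 ^ (l - 1) - l) * (\<Sum>gs\<in>boxed_lists Y (l - 1).
          minsum_term (real Y) (of_nat (fact j * fact l * m) * of_int (prod_list hs * prod_list gs) * \<beta>))"
    proof (intro mult_left_mono sum_mono)
      fix gs assume gs: "gs \<in> boxed_lists Y (l - 1)"
      have len: "Suc (length gs) = l" using gs l by (simp add: boxed_lists_def)
      obtain d where d: "\<And>x. diffs gs (\<lambda>y. a * of_int y ^ l) x = of_int x * (fact l * of_int (prod_list gs) * a) + d"
        using diffs_monomial_linear[OF len, of a] by blast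
      obtain u v where uv: "diff_dom gs {1..int Y} = {u..v}" using diff_dom_interval by blast
      then have sub: "{u..v} \<subseteq> {1..int Y}" using diff_dom_subset by metis
      have "norm (\<Sum>x\<in>{u..v}. ee (of_int x * (fact l * of_int (prod_list gs) * a) + d))
          \<le> minsum_term (real Y) (fact l * of_int (prod_list gs) * a)"
        using sub assms by (intro norm_linear_sum_le) auto
      moreover have eq: "fact l * of_int (prod_list gs) * a = of_nat (fact j * fact l * m) * of_int (prod_list hs * prod_list gs) * \<beta>"
        by (simp add: a_def mult_ac)
      ultimately show "norm (\<Sum>y\<in>diff_dom gs {1..int Y}. ee (diffs gs (\<lambda>y. a * of_int y ^ l) y))
          \<le> minsum_term (real Y) (of_nat (fact j * fact l * m) * of_int (prod_list hs * prod_list gs) * \<beta>)"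
        unfolding uv d eq by simp
    qed auto
    finally show ?thesis by (simp add: a_def)
  qed
  then have "(\<Sum>m=1..M. \<Sum>hs\<in>boxed_lists X j. norm (\<Sum>y\<in>{1..int Y}. ee (fact j * of_int (prod_list hs) * (of_nat m * \<beta>) * of_int y ^ l)) ^ (2 ^ (l - 1)))
    \<le> (\<Sum>m=1..M. \<Sum>hs\<in>boxed_lists X j. (3 * real Y) ^ (2 ^ (l - 1) - l) * (\<Sum>gs\<in>boxed_lists Y (l - 1).
          minsum_term (real Y) (of_nat (fact j * fact l * m) * of_int (prod_list hs * prod_list gs) * \<beta>)))"
    by (intro sum_mono)
  then show ?thesis by (simp add: box_minsum_def sum_distrib_left)
qed

text \<open>Cauchy-Schwarz separates the factors, then the power mean raises each of them to the
  full exponent. The separation consumes one squaring, so the exponent is at least 2; below this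
  becomes \<open>l \<ge> 2\<close>.\<close>

lemma sum_product_power_le:
  fixes f g :: "'a \<Rightarrow> real"
  assumes "finite A" "\<And>i. i \<in> A \<Longrightarrow> f i \<ge> 0" "\<And>i. i \<in> A \<Longrightarrow> g i \<ge> 0"
  shows "(\<Sum>i\<in>A. f i * g i) ^ (2 ^ Suc n)
    \<le> real (card A) ^ (2 ^ Suc n - 2) * ((\<Sum>i\<in>A. f i ^ (2 ^ Suc n)) * (\<Sum>i\<in>A. g i ^ (2 ^ Suc n)))"
proof -
  define q where "q = (2::nat) ^ n"
  have q: "2 ^ Suc n = 2 * q" "(q - 1) + (q - 1) = 2 ^ Suc n - 2" by (simp_all add: q_def)
  have *: "(\<Sum>i\<in>A. (f i)\<^sup>2) ^ q \<le> real (card A) ^ (q - 1) * (\<Sum>i\<in>A. f i ^ (2 * q))" for f :: "'a \<Rightarrow> real"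
    using sum_pow_two_power_le[of A "\<lambda>i. (f i)\<^sup>2" n] by (simp add: q_def power_mult[symmetric])
  have "(\<Sum>i\<in>A. f i * g i) ^ (2 * q) = ((\<Sum>i\<in>A. f i * g i)\<^sup>2) ^ q" by (simp add: power_mult)
  also have "\<dots> \<le> ((\<Sum>i\<in>A. (f i)\<^sup>2) * (\<Sum>i\<in>A. (g i)\<^sup>2)) ^ q"
    by (intro power_mono Cauchy_Schwarz_ineq_sum) simp
  also have "\<dots> = (\<Sum>i\<in>A. (f i)\<^sup>2) ^ q * (\<Sum>i\<in>A. (g i)\<^sup>2) ^ q" by (rule power_mult_distrib)
  also have "\<dots> \<le> (real (card A) ^ (q - 1) * (\<Sum>i\<in>A. f i ^ (2 * q))) * (real (card A) ^ (q - 1) * (\<Sum>i\<in>A. g i ^ (2 * q)))"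
    by (intro mult_mono *) (simp_all add: sum_nonneg power_mult)
  also have "\<dots> = real (card A) ^ ((q - 1) + (q - 1)) * ((\<Sum>i\<in>A. f i ^ (2 * q)) * (\<Sum>i\<in>A. g i ^ (2 * q)))"
    by (simp add: power_add mult_ac)
  finally show ?thesis by (simp only: q)
qed

text \<open>Measured against the trivial sizes \<open>M * X ^ k\<close> and
  \<open>M * X ^ j * Y ^ l\<close>, the two box sums cannot save more than
  \<open>(36 * M) ^ (2 ^ (k - 1))\<close> together. The exponent \<open>2 ^ j * 2 ^ (l - 1)\<close>
  is that of Weyl's inequality in one variable of degree \<open>k\<close>, although savings are made
  in both variables.\<close>

lemma box_minsum_product_ge:
  fixes \<alpha> :: real and b :: "nat \<Rightarrow> real"
  assumes pos: "X > 0" "Y > 0" "M > 0" and k: "k = j + l" and l: "l \<ge> 2"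
    and large: "(\<Sum>m=1..M. norm (\<Sum>x\<in>{1..int X}. \<Sum>y\<in>{1..int Y}.
        ee (of_nat m * (\<alpha> * of_int x ^ k + (\<Sum>i\<le>j. b i * of_int x ^ i * of_int y ^ (k - i)))))) \<ge> real X * real Y / 4"
  shows "(real M * real X ^ k) * (real M * real X ^ j * real Y ^ l)
    \<le> (36 * real M) ^ (2 ^ (k - 1)) * (box_minsum (fact k) M X j X (l - 1) \<alpha> * box_minsum (fact j * fact l) M X j Y (l - 1) (b j))"
proof -
  define J p where "J = (2::nat) ^ j" and "p = (2::nat) ^ (l - 1)"
  define S where "S m = norm (\<Sum>x\<in>{1..int X}. \<Sum>y\<in>{1..int Y}.
        ee (of_nat m * (\<alpha> * of_int x ^ k + (\<Sum>i\<le>j. b i * of_int x ^ i * of_int y ^ (k - i)))))" for m :: nat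
  define T where "T m hs = norm (\<Sum>x\<in>diff_dom hs {1..int X}. ee (diffs hs (\<lambda>x. (of_nat m * \<alpha>) * of_int x ^ k) x))" for m :: nat and hs
  define U where "U m hs = norm (\<Sum>y\<in>{1..int Y}. ee (fact j * of_int (prod_list hs) * (of_nat m * b j) * of_int y ^ l))" for m :: nat and hs
  define W where "W = (\<Sum>m=1..M. \<Sum>hs\<in>boxed_lists X j. T m hs * U m hs)"
  define Bx where "Bx = box_minsum (fact k) M X j X (l - 1) \<alpha>"
  define By where "By = box_minsum (fact j * fact l) M X j Y (l - 1) (b j)"
  have T0: "T m hs \<ge> 0" and U0: "U m hs \<ge> 0" for m hs by (simp_all add: T_def U_def)
  have W0: "W \<ge> 0" unfolding W_def by (intro sum_nonneg mult_nonneg_nonneg T0 U0)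
  \<comment> \<open>Names for truncated differences; the additive equations in \<open>J\<close> and
    \<open>p\<close> below allow the exponents to be compared without subtraction.\<close>
  define e1 e2 e3 e4 where "e1 = J - 1" and "e2 = J - j - 1" and "e3 = p - 2" and "e4 = p - l"
  have lt: "j < J" "l - 1 < p" unfolding J_def p_def by (rule less_exp)+
  have J: "J = e1 + 1" "J = e2 + j + 1" using lt by (auto simp: e1_def e2_def)
  have p2: "p \<ge> 2" using l power_increasing[of 1 "l - 1" "2::nat"] by (simp add: p_def)
  have p: "p = e3 + 2" "p = e4 + l" using lt p2 l by (auto simp: e3_def e4_def)
  have K: "2 ^ (k - 1) = J * p" using k l by (simp add: J_def p_def power_add[symmetric])
  have step1: "S m ^ J \<le> real Y ^ e1 * (3 * real X) ^ e2 * (\<Sum>hs\<in>boxed_lists X j. T m hs * U m hs)" for m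
  proof -
    have "of_nat m * (\<alpha> * of_int x ^ k + (\<Sum>i\<le>j. b i * of_int x ^ i * of_int y ^ (k - i)))
       = (of_nat m * \<alpha>) * of_int x ^ k + (\<Sum>i\<le>j. (of_nat m * b i) * of_int x ^ i * of_int y ^ (k - i))" for x y :: int
      by (simp add: distrib_left sum_distrib_left mult_ac)
    then show ?thesis
      using norm_double_sum_differenced[OF pos(1,2), where a = "of_nat m * \<alpha>" and k = k and j = j and b = "\<lambda>i. of_nat m * b i"] k
      unfolding S_def T_def U_def J_def e1_def e2_def by simp
  qed
  have step2: "(real X * real Y / 4) ^ J \<le> real M ^ e1 * (real Y ^ e1 * (3 * real X) ^ e2 * W)"
  proof -
    have "(real X * real Y / 4) ^ J \<le> (\<Sum>m=1..M. S m) ^ J"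
      using large unfolding S_def by (intro power_mono) auto
    also have "\<dots> \<le> real M ^ e1 * (\<Sum>m=1..M. S m ^ J)"
      using sum_pow_two_power_le[of "{1..M}" S j] by (simp add: S_def J_def e1_def)
    also have "\<dots> \<le> real M ^ e1 * (\<Sum>m=1..M. real Y ^ e1 * (3 * real X) ^ e2 * (\<Sum>hs\<in>boxed_lists X j. T m hs * U m hs))"
      by (intro mult_left_mono sum_mono step1) auto
    finally show ?thesis by (simp add: W_def sum_distrib_left)
  qed
  have Bxy: "Bx \<ge> 0" "By \<ge> 0"
    unfolding Bx_def By_def box_minsum_def using pos
    by (auto intro!: sum_nonneg less_imp_le[OF minsum_term_pos])
  define Ct where "Ct = real M * (3 * real X) ^ j"
  have step3: "W ^ p \<le> Ct ^ e3 * ((3 * real X) ^ e4 * Bx * ((3 * real Y) ^ e4 * By))"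
  proof -
    define A where "A = {1..M} \<times> boxed_lists X j"
    have "Suc (l - 2) = l - 1" using l by simp
    then have pl: "p = 2 ^ Suc (l - 2)" unfolding p_def by (simp only:)
    have "W = (\<Sum>(m, hs)\<in>A. T m hs * U m hs)" by (simp add: W_def A_def sum.cartesian_product)
    then have "W ^ p \<le> real (card A) ^ e3 * ((\<Sum>(m, hs)\<in>A. T m hs ^ p) * (\<Sum>(m, hs)\<in>A. U m hs ^ p))"
      using sum_product_power_le[of A "\<lambda>(m, hs). T m hs" "\<lambda>(m, hs). U m hs" "l - 2"] T0 U0
      unfolding e3_def pl by (simp add: A_def case_prod_unfold)
    also have "\<dots> \<le> Ct ^ e3 * ((\<Sum>(m, hs)\<in>A. T m hs ^ p) * (\<Sum>(m, hs)\<in>A. U m hs ^ p))"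
    proof (intro mult_right_mono power_mono)
      have "card A \<le> M * (3 * X) ^ j"
        unfolding A_def card_cartesian_product using card_boxed_lists_le[OF pos(1), of j] by simp
      then have "real (card A) \<le> real (M * (3 * X) ^ j)" by (simp only: of_nat_le_iff)
      then show "real (card A) \<le> Ct" by (simp add: Ct_def)
      show "0 \<le> (\<Sum>(m, hs)\<in>A. T m hs ^ p) * (\<Sum>(m, hs)\<in>A. U m hs ^ p)"
        using T0 U0 by (intro mult_nonneg_nonneg sum_nonneg) (auto simp: case_prod_unfold)
    qed simp
    also have "\<dots> \<le> Ct ^ e3 * ((3 * real X) ^ e4 * Bx * ((3 * real Y) ^ e4 * By))"
    proof (intro mult_left_mono mult_mono)
      show "(\<Sum>(m, hs)\<in>A. T m hs ^ p) \<le> (3 * real X) ^ e4 * Bx"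
        using sum_norm_power_x_le[OF pos(1) k, where M = M and \<alpha> = \<alpha>] l
        unfolding A_def T_def p_def e4_def Bx_def by (simp add: sum.cartesian_product)
      show "0 \<le> (3 * real X) ^ e4 * Bx" using Bxy by simp
      show "(\<Sum>(m, hs)\<in>A. U m hs ^ p) \<le> (3 * real Y) ^ e4 * By"
        using sum_norm_power_y_le[OF pos(2), where l = l and M = M and X = X and j = j and \<beta> = "b j"] l
        unfolding A_def U_def p_def e4_def By_def by (simp add: sum.cartesian_product)
      show "0 \<le> (\<Sum>(m, hs)\<in>A. U m hs ^ p)"
        using U0 by (intro sum_nonneg) (auto simp: case_prod_unfold)
      show "0 \<le> Ct ^ e3" by (simp add: Ct_def)
    qed
    finally show ?thesis .
  qed
  define x y m where "x = real X" and "y = real Y" and "m = real M"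
  have xym: "x > 0" "y > 0" "m > 0" using pos by (simp_all add: x_def y_def m_def)
  have "((x * y / 4) ^ J) ^ p \<le> (m ^ e1 * (y ^ e1 * (3 * x) ^ e2 * W)) ^ p"
    using step2 xym by (intro power_mono) (auto simp: x_def y_def m_def)
  also have "\<dots> = (m ^ e1 * (y ^ e1 * (3 * x) ^ e2)) ^ p * W ^ p" by (simp add: power_mult_distrib mult_ac)
  also have "\<dots> \<le> (m ^ e1 * (y ^ e1 * (3 * x) ^ e2)) ^ p * ((m * (3 * x) ^ j) ^ e3 * ((3 * x) ^ e4 * Bx * ((3 * y) ^ e4 * By)))"
    using step3 xym by (intro mult_left_mono) (auto simp: Ct_def x_def y_def m_def)
  finally have main: "(x * y / 4) ^ (J * p) \<le> (m ^ e1 * (y ^ e1 * (3 * x) ^ e2)) ^ p * ((m * (3 * x) ^ j) ^ e3 * ((3 * x) ^ e4 * (3 * y) ^ e4)) * (Bx * By)"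
    by (simp add: power_mult mult_ac)
  define E3 where "E3 = e2 * p + j * e3 + e4 + e4"
  \<comment> \<open>Homogeneity: after multiplication by the two trivial sizes, \<open>m\<close>,
    \<open>x\<close> and \<open>y\<close> all reach the exponent \<open>J * p\<close>.\<close>
  have ex: "e1 * p + e3 + 2 = J * p" "e2 * p + j * e3 + e4 + k + j = J * p" "e1 * p + e4 + l = J * p"
  proof -
    show "e1 * p + e3 + 2 = J * p" using J(1) p(1) by simp
    show "e1 * p + e4 + l = J * p" using J(1) p(2) by simp
    have "j * p = j * e3 + j * 2" using p(1) by (metis distrib_left)
    then show "e2 * p + j * e3 + e4 + k + j = J * p" using J(2) p(2) k by (simp add: distrib_right)
  qed
  have "(m ^ e1 * (y ^ e1 * (3 * x) ^ e2)) ^ p * ((m * (3 * x) ^ j) ^ e3 * ((3 * x) ^ e4 * (3 * y) ^ e4)) * ((m * x ^ k) * (m * x ^ j * y ^ l))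
      = m ^ (e1 * p + e3 + 2) * x ^ (e2 * p + j * e3 + e4 + k + j) * y ^ (e1 * p + e4 + l) * 3 ^ E3"
    by (simp add: E3_def power_add power_mult_distrib power_mult[symmetric] power2_eq_square mult_ac)
  also have "\<dots> = m ^ (J * p) * x ^ (J * p) * y ^ (J * p) * 3 ^ E3" unfolding ex ..
  also have "\<dots> \<le> m ^ (J * p) * x ^ (J * p) * y ^ (J * p) * 9 ^ (J * p)"
  proof (rule mult_left_mono)
    have "p \<le> J * p" using lt by simp
    then have "E3 \<le> 2 * (J * p)" using ex(2) p unfolding E3_def by linarith
    then have "(3::real) ^ E3 \<le> 3 ^ (2 * (J * p))" by (intro power_increasing) auto
    then show "(3::real) ^ E3 \<le> 9 ^ (J * p)" by (simp add: power_mult)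
  qed (use xym in auto)
  finally have coll: "(m ^ e1 * (y ^ e1 * (3 * x) ^ e2)) ^ p * ((m * (3 * x) ^ j) ^ e3 * ((3 * x) ^ e4 * (3 * y) ^ e4)) * ((m * x ^ k) * (m * x ^ j * y ^ l))
      \<le> (9 * m * x * y) ^ (J * p)" by (simp add: power_mult_distrib mult_ac)
  define G where "G = (m ^ e1 * (y ^ e1 * (3 * x) ^ e2)) ^ p * ((m * (3 * x) ^ j) ^ e3 * ((3 * x) ^ e4 * (3 * y) ^ e4))"
  define R where "R = (m * x ^ k) * (m * x ^ j * y ^ l)"
  have R: "R > 0" using xym by (simp add: R_def)
  have "(x * y / 4) ^ (J * p) * R \<le> G * (Bx * By) * R"
    using main R unfolding G_def by (intro mult_right_mono) auto
  also have "\<dots> = (G * R) * (Bx * By)" by (simp add: mult_ac)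
  also have "\<dots> \<le> (9 * m * x * y) ^ (J * p) * (Bx * By)"
    using coll Bxy unfolding G_def R_def by (intro mult_right_mono) auto
  \<comment> \<open>36 is the product of 4, from the lower bound \<open>x * y / 4\<close>, and 9,
    from the factors 3 collected in \<open>3 ^ E3\<close>.\<close>
  also have "\<dots> = (x * y / 4) ^ (J * p) * ((36 * m) ^ (J * p) * (Bx * By))"
  proof -
    have "9 * m * x * y = (x * y / 4) * (36 * m)" by simp
    then have "(9 * m * x * y) ^ (J * p) = (x * y / 4) ^ (J * p) * (36 * m) ^ (J * p)"
      by (simp only: power_mult_distrib)
    then show ?thesis by (simp only: mult.assoc)
  qed
  finally have "R \<le> (36 * m) ^ (J * p) * (Bx * By)"
    using xym by simp
  then show ?thesis by (simp only: R_def x_def y_def m_def K Bx_def By_def)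
qed

section \<open>Removing one coefficient at a time\<close>

text \<open>By \<open>far\<close> the number \<open>\<alpha>\<close> has no good approximation, so
  the box sum for \<open>\<alpha>\<close> saves more than \<open>X / E\<close>. The total saving is
  limited to \<open>w ^ k / E ^ 2 = X * w / E ^ 2\<close>, which leaves at most \<open>w / E\<close>
  for the box sum of \<open>b j\<close>, and so little saving forces a denominator up to
  \<open>w\<close>. The square of \<open>E\<close> pays for the two uses of the approximation
  lemma.\<close>

lemma descent_step:
  fixes \<alpha> D E L :: real and b :: "nat \<Rightarrow> real"
  assumes k: "k = j + l" and l: "l \<ge> 2" and M: "M > 0" and X: "X = w ^ (k - 1)"
    and wY: "0 < w" "w \<le> Y" "Y \<le> X"
    and large: "(\<Sum>m=1..M. norm (\<Sum>x\<in>{1..int X}. \<Sum>y\<in>{1..int Y}.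
        ee (of_nat m * (\<alpha> * of_int x ^ k + (\<Sum>i\<le>j. b i * of_int x ^ i * of_int y ^ (k - i)))))) \<ge> real X * real Y / 4"
    and far: "\<And>q. 1 \<le> q \<Longrightarrow> q \<le> X \<Longrightarrow> nint (\<alpha> * real q ^ k) > 1 / real M"
    and D: "\<And>v. v \<ge> 1 \<Longrightarrow> v \<le> fact k * M * X ^ k \<Longrightarrow> (2 * real (divisor_count v)) ^ k \<le> D" "D \<ge> 1"
    and L: "L \<ge> 1" "harm (fact k * M * X ^ k) \<le> L"
    and E: "E \<ge> 128 * D * fact k * L" "E \<ge> 2 * (real k * 3 ^ k)"
    and Ew: "E \<le> real w" "E ^ 2 * (36 * real M) ^ (2 ^ (k - 1)) \<le> real w ^ k"
  shows "\<exists>r::nat. r \<ge> 1 \<and> r \<le> w \<and> nint (real r * b j) \<le> real w / (real M * real X ^ j * real Y ^ l)"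
proof -
  have pos: "X > 0" "Y > 0" using wY by auto
  have E1: "E \<ge> 1"
  proof -
    have "1 * 1 \<le> D * fact k" using D(2) by (intro mult_mono) auto
    then have "1 * 1 \<le> (D * fact k) * L" using L by (intro mult_mono) auto
    then show ?thesis using E(1) by linarith
  qed
  \<comment> \<open>Used with \<open>Z = X\<close> and \<open>V = X / E\<close> for
    \<open>\<alpha>\<close>, then with \<open>Z = Y\<close> and \<open>V = w / E\<close> for
    \<open>b j\<close>.\<close>
  have gen: "\<exists>r::nat. r \<ge> 1 \<and> real r \<le> V * E \<and> nint (real r * \<beta>) \<le> V * E / (real M * real X ^ j * real Z ^ l)"
    if c: "0 < c" "c \<le> fact k" and Z: "0 < Z" "Z \<le> X" and V: "V \<ge> 1" "V * E \<le> real Z"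
      and lg: "box_minsum c M X j Z (l - 1) \<beta> \<ge> real M * real X ^ j * real Z ^ l / V"
    for c Z V \<beta>
  proof -
    have N: "c * M * X ^ j * Z ^ (l - 1) * Z \<le> fact k * M * X ^ k"
    proof -
      have "Z ^ (l - 1) * Z = Z ^ l" using l by (cases l) auto
      then have "c * M * X ^ j * Z ^ (l - 1) * Z = c * M * (X ^ j * Z ^ l)" by (simp add: mult.assoc)
      also have "\<dots> \<le> fact k * M * (X ^ j * X ^ l)"
        using c Z by (intro mult_le_mono power_mono order_refl) auto
      finally show ?thesis by (simp add: k power_add)
    qed
    have N': "c * M * X ^ j * Z ^ (l - 1) \<le> fact k * M * X ^ k"
    proof -
      have "c * M * X ^ j * Z ^ (l - 1) * 1 \<le> c * M * X ^ j * Z ^ (l - 1) * Z"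
        using Z by (intro mult_le_mono2) auto
      from order_trans[OF this N] show ?thesis by (simp only: mult_1_right)
    qed
    \<comment> \<open>There are \<open>1 + j + (l - 1) = k\<close> divisor counts: for
      \<open>m\<close>, for the entries of \<open>hs\<close> and for those of
      \<open>gs\<close>.\<close>
    have Dv: "real (divisor_count v * (2 * divisor_count v) ^ j * (2 * divisor_count v) ^ (l - 1)) \<le> D"
      if v: "v \<ge> 1" "v \<le> c * M * X ^ j * Z ^ (l - 1)" for v
    proof -
      have "divisor_count v * (2 * divisor_count v) ^ j * (2 * divisor_count v) ^ (l - 1)
          \<le> (2 * divisor_count v) ^ 1 * (2 * divisor_count v) ^ j * (2 * divisor_count v) ^ (l - 1)"
        by (intro mult_le_mono) auto
      also have "\<dots> = (2 * divisor_count v) ^ k" unfolding power_add[symmetric] using k l by simp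
      finally have "real (divisor_count v * (2 * divisor_count v) ^ j * (2 * divisor_count v) ^ (l - 1)) \<le> real ((2 * divisor_count v) ^ k)"
        by (simp only: of_nat_le_iff)
      also have "\<dots> \<le> D" using D(1)[of v] v N' by simp
      finally show ?thesis .
    qed
    have Sl: "Suc (l - 1) = l" using l by simp
    have "\<exists>r::nat. r \<ge> 1 \<and> real r \<le> V * E \<and> nint (real r * \<beta>) \<le> V * E / (real M * real X ^ j * real Z ^ Suc (l - 1))"
    proof (rule rational_approx_of_large_box_minsum[OF c(1) Z(1) M _ Z(2) Dv D(2) L(1) _ _ _ V])
      show "harm (c * M * X ^ j * Z ^ (l - 1) * Z) \<le> L"
        using harm_mono[OF N, where ?'a = real] L(2) by linarith
      have "real c \<le> real (fact k)" using c by (simp only: of_nat_le_iff)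
      then have "128 * D * real c * L \<le> 128 * D * fact k * L"
        using D(2) L by (intro mult_left_mono mult_right_mono) auto
      then show "128 * D * real c * L \<le> E" using E(1) by linarith
      have "real (j + (l - 1)) * 3 ^ (j + (l - 1)) \<le> real k * 3 ^ k"
        using k by (intro mult_mono power_increasing) auto
      then show "2 * (real (j + (l - 1)) * 3 ^ (j + (l - 1))) \<le> E" using E(2) by linarith
      show "real M * real X ^ j * real Z ^ Suc (l - 1) / V \<le> box_minsum c M X j Z (l - 1) \<beta>"
        unfolding Sl by (rule lg)
    qed (use l in auto)
    then show ?thesis unfolding Sl .
  qed
  define Bx where "Bx = box_minsum (fact k) M X j X (l - 1) \<alpha>"
  define By where "By = box_minsum (fact j * fact l) M X j Y (l - 1) (b j)"
  have By0: "By \<ge> 0" unfolding By_def box_minsum_def using pos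
    by (auto intro!: sum_nonneg less_imp_le[OF minsum_term_pos])
  have Xk: "real X ^ j * real X ^ l = real X * real X ^ (k - 1)"
  proof -
    have "Suc (k - 1) = j + l" using k l by simp
    then show ?thesis by (metis power_Suc power_add)
  qed
  have "Bx < real M * real X ^ k * E / real X"
  proof (rule ccontr)
    assume "\<not> Bx < real M * real X ^ k * E / real X"
    then have lg: "Bx \<ge> real M * real X ^ j * real X ^ l / (real X / E)"
      using k by (simp add: power_add mult.assoc)
    have "\<exists>q::nat. q \<ge> 1 \<and> real q \<le> real X / E * E \<and> nint (real q * \<alpha>) \<le> real X / E * E / (real M * real X ^ j * real X ^ l)"
      using lg E1 Ew wY pos unfolding Bx_def by (intro gen) auto
    then obtain q :: nat where q: "q \<ge> 1" "q \<le> X" "nint (real q * \<alpha>) \<le> real X / (real M * real X ^ j * real X ^ l)"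
      using E1 by auto
    \<comment> \<open>Multiplying the approximation of \<open>q * \<alpha>\<close> by
      \<open>q ^ (k - 1) \<le> X ^ (k - 1)\<close> raises the error to \<open>1 / M\<close> at most,
      which contradicts \<open>far\<close>.\<close>
    have "\<alpha> * real q ^ k = of_nat (q ^ (k - 1)) * (real q * \<alpha>)"
      using power_minus_mult[of k "real q"] k l by simp
    then have "nint (\<alpha> * real q ^ k) \<le> of_nat (q ^ (k - 1)) * nint (real q * \<alpha>)"
      by (metis nint_of_nat_mult_le)
    also have "\<dots> \<le> real X ^ (k - 1) * (real X / (real M * real X ^ j * real X ^ l))"
      using q by (intro mult_mono) (auto intro: power_mono simp: nint_nonneg)
    also have "\<dots> = 1 / real M"
      using pos M by (simp add: mult.assoc Xk)
    finally show False using far[OF q(1,2)] by simp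
  qed
  then have Bx: "Bx * real X \<le> real M * real X ^ k * E" using pos by (simp add: field_simps)
  define K where "K = (36 * real M) ^ (2 ^ (k - 1))"
  have K0: "K > 0" using M by (simp add: K_def)
  define R where "R = real M * real X ^ j * real Y ^ l"
  define S where "S = real M * real X ^ k"
  have RS: "R > 0" "S > 0" using M pos by (simp_all add: R_def S_def)
  have prod: "S * R \<le> K * (Bx * By)"
    using box_minsum_product_ge[OF pos M k l large] by (simp add: K_def Bx_def By_def R_def S_def)
  have "S * (R * real X) \<le> K * By * (Bx * real X)"
    using mult_right_mono[OF prod, of "real X"] by (simp add: mult_ac)
  also have "\<dots> \<le> K * By * (S * E)" using Bx By0 K0 unfolding S_def by (intro mult_left_mono) auto
  also have "\<dots> = S * (K * E * By)" by (simp add: mult_ac)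
  finally have "R * real X \<le> K * E * By" using RS by simp
  then have "R * (real X * real w) \<le> K * E * By * real w"
    using mult_right_mono[of "R * real X" "K * E * By" "real w"] by (simp add: mult_ac)
  moreover have "real X * real w = real w ^ k" using power_minus_mult[of k "real w"] k l unfolding X by simp
  moreover have "R * (E ^ 2 * K) \<le> R * real w ^ k" using Ew(2) RS unfolding K_def by (intro mult_left_mono) auto
  ultimately have "R * (E ^ 2 * K) \<le> K * E * By * real w" by simp
  then have "(K * E) * (R * E) \<le> (K * E) * (By * real w)" by (simp add: power2_eq_square mult_ac)
  then have "R * E \<le> By * real w" using K0 E1 by simp
  then have lg: "By \<ge> R / (real w / E)" using wY E1 by (simp add: field_simps)
  have jl: "fact j * fact l \<le> (fact k :: nat)"
    using k by (metis dvd_imp_le fact_fact_dvd_fact fact_gt_zero)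
  have "\<exists>r::nat. r \<ge> 1 \<and> real r \<le> real w / E * E \<and> nint (real r * b j) \<le> real w / E * E / (real M * real X ^ j * real Y ^ l)"
    using lg E1 Ew wY pos jl unfolding By_def R_def by (intro gen) auto
  then show ?thesis using E1 by auto
qed

text \<open>All size conditions concern \<open>w\<close>, \<open>M\<close>, \<open>H\<close>,
  \<open>D\<close>, \<open>E\<close> and \<open>L\<close>; none mentions \<open>\<alpha>\<close> or
  \<open>b\<close>, and this is the source of the uniformity in the real coefficients.\<close>

lemma exists_small_value:
  fixes \<alpha> D E L H :: real and b :: "nat \<Rightarrow> real"
  assumes k: "k \<ge> 2" and w: "w > 0" and X: "X = w ^ (k - 1)" and M: "M = p * Q" "p > 0" "Q > 0"
    and H: "H > 0" "2 ^ k * H \<le> real M" "(2 * (1 / (2 ^ k * H)) * real Q) ^ (2 * p) > 2 * real (p * Q)"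
    and D: "\<And>v. v \<ge> 1 \<Longrightarrow> v \<le> fact k * M * X ^ k \<Longrightarrow> (2 * real (divisor_count v)) ^ k \<le> D" "D \<ge> 1"
    and L: "L \<ge> 1" "harm (fact k * M * X ^ k) \<le> L"
    and E: "E \<ge> 128 * D * fact k * L" "E \<ge> 2 * (real k * 3 ^ k)"
    and Ew: "E \<le> real w" "E ^ 2 * (36 * real M) ^ (2 ^ (k - 1)) \<le> real w ^ k"
  shows "\<exists>x y::int. (x, y) \<noteq> (0, 0) \<and> 0 \<le> x \<and> x \<le> int X \<and> 0 \<le> y \<and> y \<le> int X \<and>
    nint (\<alpha> * of_int x ^ k + (\<Sum>i\<le>k - 2. b i * of_int x ^ i * of_int y ^ (k - i))) < 1 / H"
proof (rule ccontr)
  assume neg: "\<not> ?thesis"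
  have all: "nint (\<alpha> * of_int x ^ k + (\<Sum>i\<le>k - 2. b i * of_int x ^ i * of_int y ^ (k - i))) \<ge> 1 / H"
    if "(x, y) \<noteq> (0, 0)" "0 \<le> x" "x \<le> int X" "0 \<le> y" "y \<le> int X" for x y :: int
    using neg that by (meson not_le)
  have M0: "M > 0" using M by simp
  have twok: "(2::real) ^ 1 \<le> 2 ^ k" using k by (intro power_increasing) auto
  have MH: "1 / real M < 1 / H"
  proof -
    have "1 * H < 2 ^ k * H" using twok H(1) by (intro mult_strict_right_mono) auto
    then have "H < real M" using H(2) by linarith
    then show ?thesis using H(1) by (intro divide_strict_left_mono) auto
  qed
  have far: "nint (\<alpha> * real q ^ k) > 1 / real M" if "1 \<le> q" "q \<le> X" for q
  proof -
    have "(\<Sum>i\<le>k - 2. b i * of_int (int q) ^ i * of_int 0 ^ (k - i)) = 0"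
      using k by (intro sum.neutral) auto
    then show ?thesis using all[of "int q" 0] that MH by auto
  qed
  \<comment> \<open>\<open>R\<close> is the product of the denominators found in the first \<open>s\<close> steps.\<close>
  define inv where "inv s R \<longleftrightarrow> 1 \<le> R \<and> R \<le> w ^ s \<and>
    (\<forall>x\<in>{1..int X}. \<forall>y\<in>{1..int (w ^ (k - 1 - s))}.
      nint (\<alpha> * of_int x ^ k + (\<Sum>i\<le>k - 2 - s. b i * real R ^ (k - i) * of_int x ^ i * of_int y ^ (k - i))) \<ge> 1 / (2 ^ s * H))" for s R
  have step: "\<exists>r::nat. r \<ge> 1 \<and> r \<le> w \<and> nint (real r * (b (k - 2 - s) * real R ^ (s + 2)))
      \<le> real w / (real M * real X ^ (k - 2 - s) * real (w ^ (k - 1 - s)) ^ (s + 2))"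
    if inv: "inv s R" and s: "s \<le> k - 2" for s R
  proof -
    define j l Y where "j = k - 2 - s" and "l = s + 2" and "Y = w ^ (k - 1 - s)"
    have jl: "k = j + l" "l \<ge> 2" "k - j = l" using s k by (auto simp: j_def l_def)
    define \<theta> where "\<theta> = (\<lambda>(x, y). \<alpha> * of_int x ^ k + (\<Sum>i\<le>j. (b i * real R ^ (k - i)) * of_int x ^ i * of_int y ^ (k - i)))"
    define P where "P = {1..int X} \<times> {1..int Y}"
    \<comment> \<open>The choice of \<open>\<eta>\<close> lies below the lower bounds of all stages
      of the descent, so a single kernel of length \<open>Q\<close> serves every one of
      them.\<close>
    have "(\<Sum>m=1..p * Q. norm (\<Sum>z\<in>P. ee (of_nat m * \<theta> z))) \<ge> real (card P) / 4"
    proof (rule sum_norm_ee_ge_of_avoiding[where \<eta> = "1 / (2 ^ k * H)"])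
      fix z assume "z \<in> P"
      then have "1 / (2 ^ s * H) \<le> nint (\<theta> z)"
        using inv unfolding inv_def P_def \<theta>_def j_def Y_def by auto
      moreover have "1 / (2 ^ k * H) \<le> 1 / (2 ^ s * H)"
        using H s by (intro divide_left_mono mult_right_mono power_increasing) auto
      ultimately show "1 / (2 ^ k * H) \<le> nint (\<theta> z)" by linarith
    qed (use M H in \<open>auto simp: P_def\<close>)
    then have large: "(\<Sum>m=1..M. norm (\<Sum>x\<in>{1..int X}. \<Sum>y\<in>{1..int Y}.
        ee (of_nat m * (\<alpha> * of_int x ^ k + (\<Sum>i\<le>j. (b i * real R ^ (k - i)) * of_int x ^ i * of_int y ^ (k - i)))))) \<ge> real X * real Y / 4"
      by (simp add: P_def \<theta>_def M sum.cartesian_product card_cartesian_product case_prod_unfold)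
    have wY: "w \<le> Y" "Y \<le> X"
    proof -
      have "w ^ 1 \<le> w ^ (k - 1 - s)" using w s k by (intro power_increasing) auto
      then show "w \<le> Y" by (simp add: Y_def)
      show "Y \<le> X" unfolding Y_def X using w by (intro power_increasing) auto
    qed
    have "\<exists>r::nat. r \<ge> 1 \<and> r \<le> w \<and> nint (real r * (b j * real R ^ (k - j))) \<le> real w / (real M * real X ^ j * real Y ^ l)"
      by (rule descent_step[where b = "\<lambda>i. b i * real R ^ (k - i)", OF jl(1,2) M0 X w wY large far D L E Ew]) auto
    then show ?thesis unfolding jl(3) by (simp only: j_def l_def Y_def)
  qed
  have ex: "\<exists>R. inv s R" if "s \<le> k - 2" for s
    using that
  proof (induction s)
    case 0
    have "inv 0 1" unfolding inv_def using all w by (auto simp: X)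
    then show ?case ..
  next
    case (Suc s)
    then obtain R where inv: "inv s R" by auto
    define j l Y Y' where "j = k - 2 - s" and "l = s + 2" and "Y = w ^ (k - 1 - s)" and "Y' = w ^ (k - 1 - Suc s)"
    have s: "s \<le> k - 2" "Suc s \<le> k - 2" using Suc.prems by auto
    have jl: "k = j + l" "k - j = l" "k - 2 - Suc s = j - 1" "j \<ge> 1" using s k by (auto simp: j_def l_def)
    have YY: "Y = w * Y'"
    proof -
      have "k - 1 - s = Suc (k - 1 - Suc s)" using s k by simp
      then show ?thesis unfolding Y_def Y'_def by simp
    qed
    obtain r :: nat where r: "r \<ge> 1" "r \<le> w" "nint (real r * (b j * real R ^ l)) \<le> real w / (real M * real X ^ j * real Y ^ l)"
      using step[OF inv s(1)] unfolding j_def l_def Y_def by blast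
    have "inv (Suc s) (r * R)"
      unfolding inv_def
    proof (intro conjI ballI)
      show "1 \<le> r * R" using r inv by (simp add: inv_def)
      show "r * R \<le> w ^ Suc s" using r inv mult_le_mono[of r w R "w ^ s"] by (simp add: inv_def)
      fix x y assume xy: "x \<in> {1..int X}" "y \<in> {1..int (w ^ (k - 1 - Suc s))}"
      then have y: "1 \<le> y" "y \<le> int Y'" by (simp_all add: Y'_def)
      define G where "G = \<alpha> * of_int x ^ k + (\<Sum>i\<le>k - 2 - Suc s. b i * real (r * R) ^ (k - i) * of_int x ^ i * of_int y ^ (k - i))"
      define t where "t = of_int (x ^ j * y ^ l * int r ^ (l - 1)) * (real r * (b j * real R ^ l))"
      \<comment> \<open>Replacing \<open>y\<close> by \<open>r * y\<close> uses up one factor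
        \<open>w\<close> of the range. In the term of index \<open>j\<close> one factor
        \<open>r\<close> completes the approximated number, and \<open>r ^ (l - 1)\<close> is left
        over.\<close>
      have "int r * y \<in> {1..int Y}"
      proof -
        have "1 * 1 \<le> int r * y" using r y by (intro mult_mono) auto
        moreover have "int r * y \<le> int w * int Y'" using r y by (intro mult_mono) auto
        ultimately show ?thesis by (simp add: YY)
      qed
      then have "1 / (2 ^ s * H) \<le> nint (\<alpha> * of_int x ^ k + (\<Sum>i\<le>j. b i * real R ^ (k - i) * of_int x ^ i * of_int (int r * y) ^ (k - i)))"
        using inv xy unfolding inv_def j_def Y_def by blast
      also have "\<alpha> * of_int x ^ k + (\<Sum>i\<le>j. b i * real R ^ (k - i) * of_int x ^ i * of_int (int r * y) ^ (k - i)) = G + t"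
      proof -
        have j: "j = Suc (j - 1)" using jl by simp
        have "(\<Sum>i\<le>j. b i * real R ^ (k - i) * of_int x ^ i * of_int (int r * y) ^ (k - i))
          = (\<Sum>i\<le>j - 1. b i * real R ^ (k - i) * of_int x ^ i * of_int (int r * y) ^ (k - i))
            + b j * real R ^ (k - j) * of_int x ^ j * of_int (int r * y) ^ (k - j)"
          using jl(4) by (cases j) auto
        also have "b j * real R ^ (k - j) * of_int x ^ j * of_int (int r * y) ^ (k - j) = t"
          unfolding t_def jl(2) by (simp add: l_def power_mult_distrib mult_ac)
        finally show ?thesis unfolding G_def jl(3) by (simp add: power_mult_distrib mult_ac)
      qed
      also have "nint (G + t) \<le> nint G + nint t" by (rule nint_add_le)
      also have "nint t \<le> 1 / (2 ^ Suc s * H)"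
      proof -
        have "nint t \<le> \<bar>of_int (x ^ j * y ^ l * int r ^ (l - 1))\<bar> * nint (real r * (b j * real R ^ l))"
          unfolding t_def by (rule nint_of_int_mult_le)
        also have "\<bar>of_int (x ^ j * y ^ l * int r ^ (l - 1)) :: real\<bar> = of_int x ^ j * of_int y ^ l * real r ^ (l - 1)"
          using xy y by (simp add: abs_mult power_abs)
        also have "\<dots> * nint (real r * (b j * real R ^ l)) \<le> (real X ^ j * real Y' ^ l * real w ^ (l - 1)) * (real w / (real M * real X ^ j * real Y ^ l))"
        proof (intro mult_mono power_mono r(3))
          have "real_of_int x \<le> real_of_int (int X)" "real_of_int y \<le> real_of_int (int Y')"
            using xy y by (simp_all only: of_int_le_iff atLeastAtMost_iff)
          then show "of_int x \<le> real X" "of_int y \<le> real Y'" by simp_all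
        qed (use xy y r w in \<open>auto simp: nint_nonneg\<close>)
        \<comment> \<open>Since \<open>Y = w * Y'\<close>, the \<open>l\<close> factors
          \<open>w\<close> in \<open>Y ^ l\<close> cancel against
          \<open>w ^ (l - 1) * w\<close>.\<close>
        also have "\<dots> = 1 / real M"
        proof -
          have "real Y ^ l = real w * (real w ^ (l - 1) * real Y' ^ l)"
            by (simp add: YY power_mult_distrib l_def)
          then show ?thesis using w M0 X by (simp add: Y'_def)
        qed
        also have "\<dots> \<le> 1 / (2 ^ k * H)" using H M0 by (intro divide_left_mono) auto
        also have "\<dots> \<le> 1 / (2 ^ Suc s * H)"
          using H s by (intro divide_left_mono mult_right_mono power_increasing) auto
        finally show ?thesis .
      qed
      finally have split: "1 / (2 ^ s * H) \<le> nint G + 1 / (2 ^ Suc s * H)" by simp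
      have double: "1 / (2 ^ s * H) = 2 * (1 / (2 ^ Suc s * H))" by simp
      have half: "h \<le> g" if "a \<le> g + h" "a = 2 * h" for a g h :: real using that by linarith
      show "1 / (2 ^ Suc s * H) \<le> nint (\<alpha> * of_int x ^ k + (\<Sum>i\<le>k - 2 - Suc s. b i * real (r * R) ^ (k - i) * of_int x ^ i * of_int y ^ (k - i)))"
        using half[OF split double] unfolding G_def .
    qed
    then show ?case ..
  qed
  \<comment> \<open>Another round of the induction would call for an index below 0. The
    approximation of the last coefficient is therefore used at the point \<open>(0, r * R)\<close>
    of the original form, where \<open>r * R \<le> w * w ^ (k - 2) = X\<close>.\<close>
  obtain R where inv: "inv (k - 2) R" using ex by blast
  have k2: "k - 2 + 2 = k" "k - 1 - (k - 2) = 1" using k by auto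
  obtain r :: nat where r: "r \<ge> 1" "r \<le> w" "nint (real r * (b 0 * real R ^ k)) \<le> real w / (real M * real w ^ k)"
    using step[OF inv order_refl] unfolding k2 by auto
  have R: "1 \<le> R" "R \<le> w ^ (k - 2)" using inv by (auto simp: inv_def)
  have rR: "1 \<le> r * R" "r * R \<le> X"
  proof -
    show "1 \<le> r * R" using r R by simp
    have "r * R \<le> w * w ^ (k - 2)" using r R by (intro mult_le_mono) auto
    also have "\<dots> = w ^ Suc (k - 2)" by simp
    also have "Suc (k - 2) = k - 1" using k by simp
    finally show "r * R \<le> X" by (simp add: X)
  qed
  \<comment> \<open>Since \<open>0 ^ 0 = 1\<close>, exactly the term with \<open>i = 0\<close>
    survives at \<open>x = 0\<close>.\<close>
  have "\<alpha> * of_int 0 ^ k + (\<Sum>i\<le>k - 2. b i * of_int 0 ^ i * of_int (int (r * R)) ^ (k - i)) = b 0 * real (r * R) ^ k"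
  proof -
    have "(\<Sum>i\<le>k - 2. b i * of_int 0 ^ i * of_int (int (r * R)) ^ (k - i))
        = (\<Sum>i\<in>{0}. b i * of_int 0 ^ i * of_int (int (r * R)) ^ (k - i))"
      by (rule sum.mono_neutral_right) auto
    then show ?thesis using k by simp
  qed
  also have "b 0 * real (r * R) ^ k = of_nat (r ^ (k - 1)) * (real r * (b 0 * real R ^ k))"
    using k by (cases k) (auto simp: power_mult_distrib mult_ac)
  finally have val: "\<alpha> * of_int 0 ^ k + (\<Sum>i\<le>k - 2. b i * of_int 0 ^ i * of_int (int (r * R)) ^ (k - i)) = of_nat (r ^ (k - 1)) * (real r * (b 0 * real R ^ k))" .
  have "1 / H \<le> nint (of_nat (r ^ (k - 1)) * (real r * (b 0 * real R ^ k)))"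
  proof -
    have "int (r * R) \<le> int X" using rR by (simp only: of_nat_le_iff)
    then show ?thesis using all[of 0 "int (r * R)"] rR unfolding val by auto
  qed
  also have "\<dots> \<le> of_nat (r ^ (k - 1)) * nint (real r * (b 0 * real R ^ k))" by (rule nint_of_nat_mult_le)
  also have "\<dots> \<le> real w ^ (k - 1) * (real w / (real M * real w ^ k))"
    using r by (intro mult_mono) (auto intro: power_mono simp: nint_nonneg)
  also have "\<dots> = 1 / real M"
  proof -
    have "real w ^ k = real w ^ (k - 1) * real w" using k by (cases k) auto
    then show ?thesis using w by simp
  qed
  finally show False using MH by simp
qed

section \<open>Choice of the parameters\<close>

lemma harm_le_ln: "n > 0 \<Longrightarrow> harm n \<le> 1 + ln (real n)"
proof -
  assume "n > 0"
  then obtain m where m: "n = Suc m" by (cases n) auto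
  have "harm (Suc m) - ln (real (Suc m)) \<le> harm (Suc 0) - ln (real (Suc 0))"
    using decseqD[OF decseq_harm_diff_ln, of 0 m] by simp
  then show ?thesis by (simp add: m harm_def)
qed

lemma eventually_powr_log_bound:
  fixes a b c1 c2 B :: real
  assumes "0 < a" "a < b" "c1 > 0" "c2 > 0" "B > 0"
  shows "eventually (\<lambda>w. c1 * w powr a * (1 + B * ln w) + c2 \<le> w powr b) at_top"
  using assms by real_asymp

lemma eventually_le_powr:
  fixes c d :: real
  assumes "d > 0"
  shows "eventually (\<lambda>w. c \<le> w powr d) at_top"
  using assms by real_asymp

text \<open>With \<open>K = 2 ^ (k - 1)\<close> and \<open>H ^ K = w powr (k - e)\<close>, the
  missing \<open>w powr e\<close> is the budget for all losses. The integer \<open>w\<close> is the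
  parameter, rather than \<open>X\<close>, so that each stage of the descent divides the range of
  \<open>y\<close> exactly.\<close>

lemma exists_small_value_large:
  fixes e :: real and k :: nat
  assumes k: "k \<ge> 2" and e: "0 < e" "e \<le> 1"
  shows "\<exists>w0. \<forall>w\<ge>w0. \<forall>\<alpha> :: real. \<forall>b :: nat \<Rightarrow> real. \<exists>x y::int. (x, y) \<noteq> (0, 0) \<and>
    0 \<le> x \<and> x \<le> int (w ^ (k - 1)) \<and> 0 \<le> y \<and> y \<le> int (w ^ (k - 1)) \<and>
    nint (\<alpha> * of_int x ^ k + (\<Sum>i\<le>k - 2. b i * of_int x ^ i * of_int y ^ (k - i)))
      < real w powr (- ((real k - e) / 2 ^ (k - 1)))"
proof -
  define K where "K = (2::nat) ^ (k - 1)"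
  have K2: "K \<ge> 2" using power_increasing[of 1 "k - 1" "2::nat"] k by (simp add: K_def)
  \<comment> \<open>The budget \<open>e\<close> splits into \<open>e / 4\<close> for
    \<open>E ^ 2\<close>, \<open>e / 2\<close> for the constant \<open>(72 * p) ^ K\<close>, and
    \<open>e / 4 = K * \<delta>\<close> for the excess of the kernel length over
    \<open>H\<close>.\<close>
  define \<delta> where "\<delta> = e / (4 * real K)"
  have \<delta>: "0 < \<delta>" "\<delta> \<le> 1" "real K * \<delta> = e / 4" using e K2 by (auto simp: \<delta>_def field_simps)
  \<comment> \<open>Gives \<open>v powr (2 * p * \<delta>) \<ge> v ^ (k + 1)\<close>, one power of
    \<open>v\<close> above the number of frequencies, which is at most
    \<open>2 * p * v ^ k\<close>.\<close>
  define p where "p = nat \<lceil>(real k + 1) / (2 * \<delta>)\<rceil>"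
  have p: "(real k + 1) / (2 * \<delta>) \<le> real p" by (simp add: p_def real_nat_ceiling_ge)
  have p': "real k + 1 \<le> 2 * real p * \<delta>" using p \<delta> by (simp add: field_simps)
  have p0: "p > 0" using p' \<delta>(1) by (cases p) auto
  \<comment> \<open>\<open>fact k * M * X ^ k\<close> is at most
    \<open>v ^ (1 + k + (k - 1) * k)\<close>, where one factor \<open>v\<close> swallows the
    constants.\<close>
  define B where "B = k * k + 1"
  have B0: "real B > 0" by (simp only: B_def of_nat_0_less_iff)
  \<comment> \<open>The \<open>k\<close>-th power of a divisor count of a number up to
    \<open>v ^ B\<close> costs the exponent \<open>B * \<epsilon>1 * k = e / 32\<close>; the
    logarithm and constants fit into the \<open>e / 8\<close> allowed for \<open>E\<close>.\<close>
  define \<epsilon>1 where "\<epsilon>1 = e / (32 * real B * real k)"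
  have \<epsilon>1: "\<epsilon>1 > 0" unfolding \<epsilon>1_def using e k B0 by (intro divide_pos_pos mult_pos_pos) auto
  obtain C where C: "C \<ge> 1" "\<And>n. n > 0 \<Longrightarrow> real (divisor_count n) \<le> C * real n powr \<epsilon>1"
    using divisor_count_bound[OF \<epsilon>1] by blast
  define c1 where "c1 = 128 * (2 * C) ^ k * fact k"
  define c2 where "c2 = 2 * (real k * 3 ^ k)"
  have c: "c1 > 0" "c2 > 0" using C k by (simp_all add: c1_def c2_def)
  have "eventually (\<lambda>w::real. c1 * w powr (e / 32) * (1 + real B * ln w) + c2 \<le> w powr (e / 8)) at_top"
    by (rule eventually_powr_log_bound) (use e c B0 in auto)
  moreover have "eventually (\<lambda>w::real. (72 * real p) ^ K \<le> w powr (e / 2)) at_top"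
    using e by (intro eventually_le_powr) auto
  moreover have "eventually (\<lambda>w::real. 2 ^ k \<le> w powr \<delta>) at_top"
    using \<delta> by (intro eventually_le_powr) auto
  moreover have "eventually (\<lambda>w::real. w > 4 * real p * (2 ^ k) ^ (2 * p)) at_top"
    by (rule eventually_gt_at_top)
  moreover have "eventually (\<lambda>w::real. w \<ge> 2 * real p * fact k) at_top"
    by (rule eventually_ge_at_top)
  moreover have "eventually (\<lambda>w::real. w \<ge> 1) at_top"
    by (rule eventually_ge_at_top)
  ultimately have "eventually (\<lambda>w::real. c1 * w powr (e / 32) * (1 + real B * ln w) + c2 \<le> w powr (e / 8)
      \<and> (72 * real p) ^ K \<le> w powr (e / 2) \<and> 2 ^ k \<le> w powr \<delta> \<and> w > 4 * real p * (2 ^ k) ^ (2 * p)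
      \<and> w \<ge> 2 * real p * fact k \<and> w \<ge> 1) at_top"
    by eventually_elim auto
  then obtain W where W: "\<And>w. w \<ge> W \<Longrightarrow> c1 * w powr (e / 32) * (1 + real B * ln w) + c2 \<le> w powr (e / 8)
      \<and> (72 * real p) ^ K \<le> w powr (e / 2) \<and> 2 ^ k \<le> w powr \<delta> \<and> w > 4 * real p * (2 ^ k) ^ (2 * p)
      \<and> w \<ge> 2 * real p * fact k \<and> w \<ge> 1"
    unfolding eventually_at_top_linorder by blast
  show ?thesis
  proof (intro exI[of _ "nat \<lceil>W\<rceil>"] allI impI)
    fix w \<alpha> and b :: "nat \<Rightarrow> real" assume "w \<ge> nat \<lceil>W\<rceil>"
    then have "real w \<ge> W" by linarith
    note W = W[OF this]
    define v where "v = real w"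
    have v1: "v \<ge> 1" and w0: "w > 0" using W by (auto simp: v_def)
    have vp: "v ^ n = v powr real n" for n using v1 by (simp add: powr_realpow)
    have pw: "(v powr x) ^ n = v powr (x * real n)" for x n
      using v1 by (subst powr_realpow[symmetric]) (simp_all add: powr_powr)
    define H where "H = v powr ((real k - e) / real K)"
    define Q where "Q = nat \<lceil>H * v powr \<delta>\<rceil>"
    define M where "M = p * Q"
    define X where "X = w ^ (k - 1)"
    define D where "D = (2 * C) ^ k * v powr (e / 32)"
    define L where "L = 1 + real B * ln v"
    define E where "E = 128 * D * fact k * L + c2"
    have H1: "H \<ge> 1" using e k v1 by (simp add: H_def ge_one_powr_ge_zero)
    have vd: "v powr \<delta> \<ge> 1" using \<delta> v1 by (simp add: ge_one_powr_ge_zero)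
    have "1 * 1 \<le> H * v powr \<delta>" using H1 vd by (intro mult_mono) auto
    then have Q: "H * v powr \<delta> \<le> real Q" "real Q \<le> 2 * (H * v powr \<delta>)" "Q > 0"
      unfolding Q_def by linarith+
    have Hd: "H * v powr \<delta> \<le> v ^ k"
    proof -
      have "H * v powr \<delta> = v powr ((real k - e) / real K + \<delta>)" by (simp add: H_def powr_add)
      also have "\<dots> \<le> v powr real k"
      proof (rule powr_mono)
        have "(real k - e) / real K + \<delta> = (real k - 3 * e / 4) / real K" using K2 by (simp add: \<delta>_def field_simps)
        also have "\<dots> \<le> real k / 1" using K2 e k by (intro frac_le) auto
        finally show "(real k - e) / real K + \<delta> \<le> real k" by simp
      qed (rule v1)
      also have "\<dots> = v ^ k" using v1 by (simp add: powr_realpow)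
      finally show ?thesis .
    qed
    have M0: "M > 0" using p0 Q by (simp add: M_def)
    have Mle: "real M \<le> 2 * real p * (H * v powr \<delta>)"
      using Q(2) p0 by (simp add: M_def mult_left_mono)
    have Mv: "real M \<le> 2 * real p * v ^ k"
      using Mle Hd by (meson mult_left_mono of_nat_0_le_iff order_trans mult_nonneg_nonneg zero_le_numeral)
    have N: "fact k * real M * real X ^ k \<le> v ^ B"
    proof -
      have "fact k * real M * real X ^ k \<le> fact k * (2 * real p * v ^ k) * real X ^ k"
        using Mv by (intro mult_left_mono mult_right_mono) auto
      also have "\<dots> = (2 * real p * fact k) * (v ^ k * (v ^ (k - 1)) ^ k)" by (simp add: X_def v_def)
      also have "\<dots> \<le> v * (v ^ k * (v ^ (k - 1)) ^ k)"
        using W v1 by (intro mult_right_mono) (auto simp: v_def)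
      also have "\<dots> = v ^ (1 + k + (k - 1) * k)" by (simp add: power_add power_mult)
      also have "1 + k + (k - 1) * k = B" using k by (cases k) (auto simp: B_def)
      finally show ?thesis .
    qed
    have "\<exists>x y::int. (x, y) \<noteq> (0, 0) \<and> 0 \<le> x \<and> x \<le> int X \<and> 0 \<le> y \<and> y \<le> int X \<and>
      nint (\<alpha> * of_int x ^ k + (\<Sum>i\<le>k - 2. b i * of_int x ^ i * of_int y ^ (k - i))) < 1 / H"
    proof (rule exists_small_value[OF k w0 X_def M_def p0 Q(3)])
      show "H > 0" using H1 by simp
      show "2 ^ k * H \<le> real M"
      proof -
        have "H * 2 ^ k \<le> H * v powr \<delta>" using W H1 by (intro mult_left_mono) (auto simp: v_def)
        also have "\<dots> \<le> 1 * real Q" using Q by simp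
        also have "\<dots> \<le> real p * real Q" using p0 by (intro mult_right_mono) auto
        finally show ?thesis by (simp add: M_def mult.commute)
      qed
      show "(2 * (1 / (2 ^ k * H)) * real Q) ^ (2 * p) > 2 * real (p * Q)"
      proof -
        have "v powr \<delta> / 2 ^ k = (1 / (2 ^ k * H)) * (H * v powr \<delta>)" using H1 by simp
        also have "\<dots> \<le> (1 / (2 ^ k * H)) * real Q" using Q H1 by (intro mult_left_mono) auto
        also have "\<dots> \<le> 2 * (1 / (2 ^ k * H)) * real Q"
        proof (rule mult_right_mono)
          have "0 \<le> 1 / (2 ^ k * H)" using H1 by simp
          then show "1 / (2 ^ k * H) \<le> 2 * (1 / (2 ^ k * H))" by (simp only: mult_2 le_add_same_cancel1)
        qed simp
        finally have "(v powr \<delta> / 2 ^ k) ^ (2 * p) \<le> (2 * (1 / (2 ^ k * H)) * real Q) ^ (2 * p)"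
          using v1 by (intro power_mono) auto
        moreover have "(v powr \<delta>) ^ (2 * p) \<ge> v ^ (k + 1)"
        proof -
          have "v ^ (k + 1) = v powr (real k + 1)" unfolding vp by (simp add: add.commute)
          also have "\<dots> \<le> v powr (2 * real p * \<delta>)" using p' v1 by (rule powr_mono)
          also have "\<dots> = (v powr \<delta>) ^ (2 * p)" unfolding pw by (simp add: mult_ac)
          finally show ?thesis .
        qed
        then have "(v powr \<delta> / 2 ^ k) ^ (2 * p) \<ge> v ^ (k + 1) / (2 ^ k) ^ (2 * p)"
          by (simp add: power_divide divide_right_mono)
        moreover have "v ^ (k + 1) / (2 ^ k) ^ (2 * p) > 4 * real p * v ^ k"
        proof -
          have "4 * real p * (2 ^ k) ^ (2 * p) * v ^ k < v * v ^ k"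
            using W v1 by (intro mult_strict_right_mono) (auto simp: v_def)
          then show ?thesis by (simp add: field_simps)
        qed
        moreover have "2 * real (p * Q) \<le> 4 * real p * v ^ k" using Mv unfolding M_def by linarith
        ultimately show ?thesis by linarith
      qed
      show "(2 * real (divisor_count n)) ^ k \<le> D" if n: "n \<ge> 1" "n \<le> fact k * M * X ^ k" for n
      proof -
        have "real n \<le> real (fact k * M * X ^ k)" using n by (simp only: of_nat_le_iff)
        then have "real n \<le> v ^ B" using N by simp
        then have "real n powr \<epsilon>1 \<le> (v ^ B) powr \<epsilon>1" using \<epsilon>1 by (intro powr_mono2) auto
        also have "\<dots> = v powr (real B * \<epsilon>1)" by (simp only: vp powr_powr)
        finally have np: "real n powr \<epsilon>1 \<le> v powr (real B * \<epsilon>1)" .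
        have "2 * real (divisor_count n) \<le> 2 * (C * real n powr \<epsilon>1)" using C(2)[of n] n by simp
        also have "\<dots> \<le> 2 * (C * v powr (real B * \<epsilon>1))" using np C(1) by simp
        finally have "(2 * real (divisor_count n)) ^ k \<le> (2 * (C * v powr (real B * \<epsilon>1))) ^ k"
          by (rule power_mono) simp
        also have "\<dots> = (2 * C) ^ k * (v powr (real B * \<epsilon>1)) ^ k" by (simp add: power_mult_distrib)
        also have "(v powr (real B * \<epsilon>1)) ^ k = v powr (e / 32)"
        proof -
          have "real B * \<epsilon>1 * real k = e / 32" using k B0 by (simp add: \<epsilon>1_def)
          then show ?thesis by (simp only: pw)
        qed
        finally show ?thesis by (simp add: D_def)
      qed
      have "1 * 1 \<le> (2 * C) ^ k * v powr (e / 32)"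
        using C(1) v1 e by (intro mult_mono one_le_power ge_one_powr_ge_zero) auto
      then show D1: "D \<ge> 1" by (simp add: D_def)
      show L1: "L \<ge> 1" using v1 by (simp add: L_def)
      show "harm (fact k * M * X ^ k) \<le> L"
      proof -
        have pos: "fact k * M * X ^ k > 0" using M0 w0 by (simp add: X_def)
        then have pos': "0 < real (fact k * M * X ^ k)" by (simp only: of_nat_0_less_iff)
        have "harm (fact k * M * X ^ k) \<le> 1 + ln (real (fact k * M * X ^ k))" by (rule harm_le_ln[OF pos])
        also have "\<dots> \<le> 1 + ln (v ^ B)" using N pos' by (intro add_left_mono ln_mono) auto
        also have "ln (v ^ B) = real B * ln v" using v1 by (simp add: ln_realpow)
        finally show ?thesis by (simp add: L_def)
      qed
      have "128 * D * fact k * L \<ge> 0" using D1 L1 by simp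
      then show "E \<ge> 128 * D * fact k * L" "E \<ge> 2 * (real k * 3 ^ k)"
        using c unfolding E_def by (simp_all add: c2_def)
      have "E = c1 * v powr (e / 32) * (1 + real B * ln v) + c2"
        by (simp add: E_def D_def L_def c1_def mult_ac)
      then have E8: "E \<le> v powr (e / 8)" using W by (simp add: v_def)
      also have "\<dots> \<le> v powr 1" using v1 e by (intro powr_mono) auto
      finally show "E \<le> real w" using v1 by (simp add: v_def)
      have E0: "E \<ge> 0" using \<open>128 * D * fact k * L \<ge> 0\<close> c by (simp add: E_def)
      show "E ^ 2 * (36 * real M) ^ (2 ^ (k - 1)) \<le> real w ^ k"
      proof -
        have "E ^ 2 \<le> (v powr (e / 8)) ^ 2" using E8 E0 by (rule power_mono)
        also have "\<dots> = v powr (e / 4)" by (simp add: power2_eq_square flip: powr_add)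
        finally have 1: "E ^ 2 \<le> v powr (e / 4)" .
        have "(36 * real M) ^ K \<le> (72 * real p * (H * v powr \<delta>)) ^ K"
        proof (rule power_mono)
          show "36 * real M \<le> 72 * real p * (H * v powr \<delta>)" using Mle by linarith
        qed simp
        also have "\<dots> = (72 * real p) ^ K * (H * v powr \<delta>) ^ K" by (rule power_mult_distrib)
        also have "(H * v powr \<delta>) ^ K = v powr (real k - e + e / 4)"
        proof -
          have "H * v powr \<delta> = v powr ((real k - e) / real K + \<delta>)" by (simp add: H_def powr_add)
          then have "(H * v powr \<delta>) ^ K = v powr (((real k - e) / real K + \<delta>) * real K)"
            by (simp only: pw)
          also have "((real k - e) / real K + \<delta>) * real K = real k - e + real K * \<delta>"
            using K2 by (simp add: field_simps)
          finally show ?thesis by (simp add: \<delta>)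
        qed
        also have "(72 * real p) ^ K * v powr (real k - e + e / 4) \<le> v powr (e / 2) * v powr (real k - e + e / 4)"
          using W by (intro mult_right_mono) (auto simp: v_def)
        finally have 2: "(36 * real M) ^ K \<le> v powr (e / 2 + (real k - e + e / 4))" by (simp only: powr_add)
        have "E ^ 2 * (36 * real M) ^ K \<le> v powr (e / 4) * v powr (e / 2 + (real k - e + e / 4))"
          using 1 2 by (intro mult_mono) auto
        also have "\<dots> = v powr real k" by (simp flip: powr_add)
        also have "\<dots> = v ^ k" using v1 by (simp add: powr_realpow)
        finally show ?thesis by (simp add: K_def v_def)
      qed
    qed
    moreover have "1 / H = real w powr (- ((real k - e) / 2 ^ (k - 1)))"
      by (simp add: H_def v_def K_def powr_minus_divide)
    ultimately show "\<exists>x y::int. (x, y) \<noteq> (0, 0) \<and>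
        0 \<le> x \<and> x \<le> int (w ^ (k - 1)) \<and> 0 \<le> y \<and> y \<le> int (w ^ (k - 1)) \<and>
        nint (\<alpha> * of_int x ^ k + (\<Sum>i\<le>k - 2. b i * of_int x ^ i * of_int y ^ (k - i)))
          < real w powr (- ((real k - e) / 2 ^ (k - 1)))"
      unfolding X_def by simp
  qed
qed

section \<open>Reduction to a form without its second coefficient\<close>

lemma homogeneous_substitution:
  fixes \<gamma> :: "nat \<Rightarrow> real" and a b :: real
  shows "(\<Sum>i\<le>k. \<gamma> i * (u + a * t) ^ i * (b * t) ^ (k - i))
    = (\<Sum>s\<le>k. (\<Sum>i\<in>{s..k}. \<gamma> i * real (i choose s) * a ^ (i - s) * b ^ (k - i)) * u ^ s * t ^ (k - s))"
proof -
  have "(\<Sum>i\<le>k. \<gamma> i * (u + a * t) ^ i * (b * t) ^ (k - i))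
      = (\<Sum>i\<in>{..k}. \<Sum>s\<in>{s \<in> {..k}. s \<le> i}. \<gamma> i * real (i choose s) * a ^ (i - s) * b ^ (k - i) * u ^ s * t ^ (k - s))"
  proof (rule sum.cong[OF refl])
    fix i assume i: "i \<in> {..k}"
    have "\<gamma> i * (u + a * t) ^ i * (b * t) ^ (k - i)
        = (\<Sum>s\<le>i. \<gamma> i * (real (i choose s) * u ^ s * (a * t) ^ (i - s)) * (b * t) ^ (k - i))"
      unfolding binomial_ring by (simp add: sum_distrib_left sum_distrib_right)
    also have "\<dots> = (\<Sum>s\<le>i. \<gamma> i * real (i choose s) * a ^ (i - s) * b ^ (k - i) * u ^ s * t ^ (k - s))"
    proof (rule sum.cong[OF refl])
      fix s assume "s \<in> {..i}"
      then have "k - s = (i - s) + (k - i)" using i by simp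
      then show "\<gamma> i * (real (i choose s) * u ^ s * (a * t) ^ (i - s)) * (b * t) ^ (k - i)
          = \<gamma> i * real (i choose s) * a ^ (i - s) * b ^ (k - i) * u ^ s * t ^ (k - s)"
        by (simp only: power_add power_mult_distrib) (simp add: mult_ac)
    qed
    also have "{..i} = {s \<in> {..k}. s \<le> i}" using i by auto
    finally show "\<gamma> i * (u + a * t) ^ i * (b * t) ^ (k - i)
        = (\<Sum>s\<in>{s \<in> {..k}. s \<le> i}. \<gamma> i * real (i choose s) * a ^ (i - s) * b ^ (k - i) * u ^ s * t ^ (k - s))" .
  qed
  also have "\<dots> = (\<Sum>s\<in>{..k}. \<Sum>i\<in>{i \<in> {..k}. s \<le> i}. \<gamma> i * real (i choose s) * a ^ (i - s) * b ^ (k - i) * u ^ s * t ^ (k - s))"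
    by (rule sum.swap_restrict) auto
  also have "\<dots> = (\<Sum>s\<le>k. (\<Sum>i\<in>{s..k}. \<gamma> i * real (i choose s) * a ^ (i - s) * b ^ (k - i)) * u ^ s * t ^ (k - s))"
    unfolding sum_distrib_right by (intro sum.cong) auto
  finally show ?thesis .
qed

text \<open>The shift that removes the second coefficient of a polynomial, scaled by
  \<open>k * c k\<close> to stay integral: the contributions of \<open>x ^ k\<close> and
  \<open>x ^ (k - 1) * y\<close> to the coefficient of \<open>u ^ (k - 1) * t\<close> are opposite.
  This relies on both top coefficients being integer multiples of \<open>\<alpha> k\<close>; with a
  free real coefficient at \<open>k - 1\<close> the required shift would in general be
  irrational.\<close>

lemma perturbed_form_substitution:
  fixes c :: "nat \<Rightarrow> int" and \<alpha> :: "nat \<Rightarrow> real"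
  assumes k: "k \<ge> 2"
  shows "\<exists>A \<beta>. \<forall>u t::int. perturbed_form k c \<alpha> (u - c (k - 1) * t) (int k * c k * t)
    = A * of_int u ^ k + (\<Sum>i\<le>k - 2. \<beta> i * of_int u ^ i * of_int t ^ (k - i))"
proof -
  define \<gamma> where "\<gamma> i = \<alpha> k * of_int (c i) + (if i \<le> k - 2 then \<alpha> i else 0)" for i
  define a b :: real where "a = - of_int (c (k - 1))" and "b = real k * of_int (c k)"
  define \<beta> where "\<beta> s = (\<Sum>i\<in>{s..k}. \<gamma> i * real (i choose s) * a ^ (i - s) * b ^ (k - i))" for s
  have form: "perturbed_form k c \<alpha> x y = (\<Sum>i\<le>k. \<gamma> i * of_int x ^ i * of_int y ^ (k - i))" for x y
  proof -
    have "(\<Sum>i\<le>k - 2. \<alpha> i * of_int x ^ i * of_int y ^ (k - i))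
        = (\<Sum>i\<le>k. (if i \<le> k - 2 then \<alpha> i else 0) * of_int x ^ i * of_int y ^ (k - i))"
      using k by (intro sum.mono_neutral_cong_left) auto
    then show ?thesis
      unfolding perturbed_form_def binary_form_def \<gamma>_def
      by (simp add: sum_distrib_left distrib_left sum.distrib mult_ac)
  qed
  obtain n where "k = 2 + n" using le_Suc_ex[OF k] by blast
  then have n: "k = Suc (Suc n)" by simp
  have vanish: "\<beta> (k - 1) = 0"
  proof -
    have set: "{k - 1..k} = {k - 1, k}" "k - 1 \<noteq> k" using k by auto
    have ch: "k choose (k - 1) = k" "k - (k - 1) = 1" using k by (simp_all add: n)
    have \<gamma>: "\<gamma> (k - 1) = \<alpha> k * of_int (c (k - 1))" "\<gamma> k = \<alpha> k * of_int (c k)"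
      using k by (simp_all add: \<gamma>_def)
    have "\<beta> (k - 1) = \<gamma> (k - 1) * b + \<gamma> k * real k * a"
      unfolding \<beta>_def set(1) using set(2) ch by simp
    also have "\<dots> = 0" unfolding \<gamma> a_def b_def by simp
    finally show ?thesis .
  qed
  have "perturbed_form k c \<alpha> (u - c (k - 1) * t) (int k * c k * t)
      = \<beta> k * of_int u ^ k + (\<Sum>i\<le>k - 2. \<beta> i * of_int u ^ i * of_int t ^ (k - i))" for u t
  proof -
    have "perturbed_form k c \<alpha> (u - c (k - 1) * t) (int k * c k * t)
        = (\<Sum>i\<le>k. \<gamma> i * (of_int u + a * of_int t) ^ i * (b * of_int t) ^ (k - i))"
      unfolding form by (simp add: a_def b_def)
    also have "\<dots> = (\<Sum>s\<le>k. \<beta> s * of_int u ^ s * of_int t ^ (k - s))"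
      unfolding homogeneous_substitution \<beta>_def ..
    also have "\<dots> = \<beta> k * of_int u ^ k + (\<Sum>i\<le>k - 2. \<beta> i * of_int u ^ i * of_int t ^ (k - i))"
      using vanish unfolding n by simp
    finally show ?thesis .
  qed
  then show ?thesis by blast
qed

lemma finite_box_points: "finite (box_points X)"
proof -
  have "box_points X \<subseteq> {- \<lfloor>X\<rfloor>..\<lfloor>X\<rfloor>} \<times> {- \<lfloor>X\<rfloor>..\<lfloor>X\<rfloor>}"
    unfolding box_points_def by (auto simp: le_floor_iff abs_le_iff minus_le_iff)
  then show ?thesis by (rule finite_subset) simp
qed

lemma Min_box_points_less:
  assumes "(x, y) \<in> box_points X" "f (x, y) < B"
  shows "Min (f ` box_points X) < (B :: real)"
  using assms finite_box_points by (subst Min_less_iff) auto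

theorem corollary1p2:
  fixes k :: nat and \<epsilon> :: real and ck ck1 :: int
  assumes "k \<ge> 2" and "\<epsilon> > 0"
  shows "\<exists>X0::real. \<forall>(c :: nat \<Rightarrow> int) (\<alpha> :: nat \<Rightarrow> real) (X :: real).
           c k = ck \<longrightarrow> c (k - 1) = ck1 \<longrightarrow> X \<ge> X0 \<longrightarrow>
             Min ((\<lambda>(x, y). dist_nearest_int (perturbed_form k c \<alpha> x y)) ` box_points X)
               < X powr (- sigma_exponent k + \<epsilon>)"
proof (cases "ck = 0")
  case True
  \<comment> \<open>The substitution degenerates here, as it would always give \<open>y = 0\<close>;
    but the form vanishes at \<open>(1, 0)\<close>.\<close>
  show ?thesis
  proof (intro exI[of _ 1] allI impI)
    fix c :: "nat \<Rightarrow> int" and \<alpha> :: "nat \<Rightarrow> real" and X :: real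
    assume c: "c k = ck" and X: "X \<ge> 1"
    have "(\<Sum>j\<le>k. c j * 1 ^ j * 0 ^ (k - j)) = (\<Sum>j\<in>{k}. c j * 1 ^ j * 0 ^ (k - j))"
      by (rule sum.mono_neutral_right) auto
    then have "binary_form k c 1 0 = 0" using c True by (simp add: binary_form_def)
    moreover have "(\<Sum>j\<le>k - 2. \<alpha> j * of_int 1 ^ j * of_int 0 ^ (k - j)) = 0"
      using assms(1) by (intro sum.neutral) auto
    ultimately have "perturbed_form k c \<alpha> 1 0 = 0" by (simp add: perturbed_form_def)
    then show "Min ((\<lambda>(x, y). dist_nearest_int (perturbed_form k c \<alpha> x y)) ` box_points X)
        < X powr (- sigma_exponent k + \<epsilon>)"
      using X by (intro Min_box_points_less[of 1 0]) (auto simp: box_points_def dist_nearest_int_def)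
  qed
next
  case False
  note k = assms(1)
  define n where "n = k - 1"
  have n: "n \<ge> 1" "real k = real n + 1" using k by (auto simp: n_def)
  \<comment> \<open>Half of \<open>\<epsilon>\<close> covers the shortfall \<open>e\<close> in the
    exponent of \<open>w\<close>; the other half absorbs the constants
    \<open>2 powr s * C powr (s / n)\<close>.\<close>
  define e where "e = min 1 (\<epsilon> / 2)"
  have e: "0 < e" "e \<le> 1" "e \<le> \<epsilon> / 2" using assms(2) by (auto simp: e_def)
  define s where "s = (real k - e) / 2 ^ n"
  have s: "s > 0" using e n by (simp add: s_def)
  \<comment> \<open>For \<open>u\<close> and \<open>t\<close> between 0 and \<open>w ^ n\<close>
    both coordinates of the substituted point are bounded by \<open>C * w ^ n\<close>. Through
    \<open>C\<close> the threshold depends on \<open>ck\<close> and \<open>ck1\<close>.\<close>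
  define C where "C = 1 + \<bar>real_of_int ck1\<bar> + real k * \<bar>real_of_int ck\<bar>"
  have C: "C \<ge> 1" by (simp add: C_def)
  obtain w0 where w0: "\<And>w \<alpha> b. w \<ge> w0 \<Longrightarrow> \<exists>x y::int. (x, y) \<noteq> (0, 0) \<and>
    0 \<le> x \<and> x \<le> int (w ^ n) \<and> 0 \<le> y \<and> y \<le> int (w ^ n) \<and>
    nint (\<alpha> * of_int x ^ k + (\<Sum>i\<le>k - 2. b i * of_int x ^ i * of_int y ^ (k - i))) < real w powr (- s)"
    using exists_small_value_large[OF k e(1,2)] unfolding n_def s_def by blast
  have "eventually (\<lambda>X::real. (X / C) powr (1 / real n) \<ge> real w0 + 2) at_top"
    using n C by real_asymp
  moreover have "eventually (\<lambda>X::real. X powr (\<epsilon> / 2) > 2 powr s * C powr (s / real n)) at_top"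
    using assms(2) by real_asymp
  moreover have "eventually (\<lambda>X::real. X \<ge> 1) at_top" by (rule eventually_ge_at_top)
  ultimately have "eventually (\<lambda>X::real. (X / C) powr (1 / real n) \<ge> real w0 + 2
      \<and> X powr (\<epsilon> / 2) > 2 powr s * C powr (s / real n) \<and> X \<ge> 1) at_top"
    by eventually_elim auto
  then obtain X0 where X0: "\<And>X::real. X \<ge> X0 \<Longrightarrow> (X / C) powr (1 / real n) \<ge> real w0 + 2
      \<and> X powr (\<epsilon> / 2) > 2 powr s * C powr (s / real n) \<and> X \<ge> 1"
    unfolding eventually_at_top_linorder by blast
  show ?thesis
  proof (intro exI[of _ X0] allI impI)
    fix c :: "nat \<Rightarrow> int" and \<alpha> :: "nat \<Rightarrow> real" and X :: real
    assume c: "c k = ck" "c (k - 1) = ck1" and "X \<ge> X0"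
    note X = X0[OF \<open>X \<ge> X0\<close>]
    define z where "z = (X / C) powr (1 / real n)"
    \<comment> \<open>The largest integer with \<open>C * w ^ n \<le> X\<close>. Rounding down loses
      at most a factor 2, which is paid for by \<open>2 powr s\<close>.\<close>
    define w where "w = nat \<lfloor>z\<rfloor>"
    have z: "z \<ge> real w0 + 2" using X by (simp add: z_def)
    have w: "real w \<le> z" "z / 2 \<le> real w" "w \<ge> w0" "w > 0" using z unfolding w_def by linarith+
    obtain A \<beta> where form: "\<And>u t::int. perturbed_form k c \<alpha> (u - ck1 * t) (int k * ck * t)
        = A * of_int u ^ k + (\<Sum>i\<le>k - 2. \<beta> i * of_int u ^ i * of_int t ^ (k - i))"
      using perturbed_form_substitution[OF k, of c \<alpha>] unfolding c by blast
    obtain u t :: int where ut: "(u, t) \<noteq> (0, 0)" "0 \<le> u" "u \<le> int (w ^ n)" "0 \<le> t" "t \<le> int (w ^ n)"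
      and small: "nint (A * of_int u ^ k + (\<Sum>i\<le>k - 2. \<beta> i * of_int u ^ i * of_int t ^ (k - i))) < real w powr (- s)"
      using w0[OF w(3)] by blast
    have zn: "z ^ n = X / C"
    proof -
      have "z > 0" using z by simp
      then have "z ^ n = z powr real n" by (simp add: powr_realpow)
      also have "\<dots> = X / C" unfolding z_def using n X C by (simp add: powr_powr)
      finally show ?thesis .
    qed
    have wX: "real_of_int (int (w ^ n)) * C \<le> X"
    proof -
      have "real w ^ n \<le> z ^ n" using w by (intro power_mono) auto
      then show ?thesis using zn C by (simp add: field_simps)
    qed
    have mem: "(u - ck1 * t, int k * ck * t) \<in> box_points X"
    proof -
      have "real_of_int u \<le> real_of_int (int (w ^ n))" using ut by (simp only: of_int_le_iff)
      moreover have "real_of_int t \<le> real_of_int (int (w ^ n))" using ut by (simp only: of_int_le_iff)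
      ultimately have le: "real_of_int u \<le> real (w ^ n)" "real_of_int t \<le> real (w ^ n)" by simp_all
      have "\<bar>real_of_int (u - ck1 * t)\<bar> \<le> real_of_int u + \<bar>real_of_int ck1\<bar> * real_of_int t"
        using ut abs_triangle_ineq4[of "real_of_int u" "real_of_int (ck1 * t)"] by (simp add: abs_mult)
      also have "\<dots> \<le> real (w ^ n) + \<bar>real_of_int ck1\<bar> * real (w ^ n)"
        using le by (intro add_mono mult_left_mono) auto
      also have "\<dots> = real (w ^ n) * (1 + \<bar>real_of_int ck1\<bar>)" by (simp add: algebra_simps)
      also have "\<dots> \<le> real (w ^ n) * C" by (intro mult_left_mono) (auto simp: C_def)
      finally have 1: "\<bar>real_of_int (u - ck1 * t)\<bar> \<le> X" using wX by simp
      have "\<bar>real_of_int (int k * ck * t)\<bar> = (real k * \<bar>real_of_int ck\<bar>) * real_of_int t"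
        using ut by (simp add: abs_mult)
      also have "\<dots> \<le> C * real (w ^ n)"
        using le ut by (intro mult_mono) (auto simp: C_def)
      finally have 2: "\<bar>real_of_int (int k * ck * t)\<bar> \<le> X" using wX by (simp add: mult.commute)
      \<comment> \<open>As \<open>k * ck\<close> is nonzero, a vanishing second coordinate forces
        \<open>t = 0\<close>, and then the first one is \<open>u\<close>.\<close>
      have "(u - ck1 * t, int k * ck * t) \<noteq> (0, 0)" using ut(1) False k by auto
      then show ?thesis using 1 2 by (simp add: box_points_def)
    qed
    have "real w powr (- s) \<le> X powr (- sigma_exponent k + \<epsilon>)"
    proof -
      have z0: "z > 0" using z by simp
      have X1: "X \<ge> 1" using X by simp
      have "real w powr (- s) \<le> (z / 2) powr (- s)"
        using w z0 s by (intro powr_mono2') auto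
      also have "\<dots> = 2 powr s * z powr (- s)"
        using z0 by (simp add: powr_divide powr_minus field_simps)
      also have "z powr (- s) = C powr (s / real n) * X powr (- (s / real n))"
        unfolding z_def using X1 C by (simp add: powr_powr powr_divide powr_minus field_simps)
      also have "2 powr s * (C powr (s / real n) * X powr (- (s / real n)))
          \<le> X powr (\<epsilon> / 2) * X powr (- (s / real n))"
        using X mult_right_mono[of "2 powr s * C powr (s / real n)" "X powr (\<epsilon> / 2)" "X powr (- (s / real n))"]
        by (simp add: mult.assoc)
      also have "\<dots> = X powr (\<epsilon> / 2 - s / real n)" by (simp flip: powr_add)
      also have "\<dots> \<le> X powr (- sigma_exponent k + \<epsilon>)"
      proof (rule powr_mono[OF _ X1])
        \<comment> \<open>The factor \<open>k / (k - 1)\<close> of the exponent arises here: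
          \<open>w\<close> has size \<open>X powr (1 / n)\<close> with \<open>n = k - 1\<close>, and
          the saving in terms of \<open>w\<close> is almost \<open>k / 2 ^ n\<close>.\<close>
        have "sigma_exponent k = real k / real n / 2 ^ n"
          by (simp add: sigma_exponent_def n(2) powr_minus_divide powr_realpow)
        then have "s / real n = sigma_exponent k - e / (2 ^ n * real n)"
          by (simp add: s_def diff_divide_distrib mult.commute)
        moreover have "e / (2 ^ n * real n) \<le> e / 1"
        proof (rule frac_le)
          have "1 * 1 \<le> (2::real) ^ n * real n" using n by (intro mult_mono one_le_power) auto
          then show "1 \<le> (2::real) ^ n * real n" by simp
        qed (use e in auto)
        ultimately show "\<epsilon> / 2 - s / real n \<le> - sigma_exponent k + \<epsilon>" using e by simp
      qed
      finally show ?thesis .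
    qed
    then have "nint (perturbed_form k c \<alpha> (u - ck1 * t) (int k * ck * t)) < X powr (- sigma_exponent k + \<epsilon>)"
      using small unfolding form by linarith
    then show "Min ((\<lambda>(x, y). dist_nearest_int (perturbed_form k c \<alpha> x y)) ` box_points X)
        < X powr (- sigma_exponent k + \<epsilon>)"
      by (intro Min_box_points_less[OF mem]) simp
  qed
qed

end
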